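(* For all integers $n \geq 0$ the following congruences hold: \begin{align*} a_\omega(40n+27)&\equiv a_\omega(40n+35) \equiv 0 \pmod{5},\\ a_{\mathcal{C}}(3n+1) &\equiv 0 \pmod{3},\\ a_{\mathcal{C}}(7n+2) &\equiv a_{\mathcal{C}}(7n+3) \equiv a_{\mathcal{C}}(7n+5) \equiv 0 \pmod{7}. \end{align*}
   Context: The integers $a_\omega(n)$ are the coefficients of Ramanujan's mock theta function $$\omega=\sum_{n=0}^\infty \frac{q^{2n^2+2n}}{(1-q)^2(1-q^3)^2\cdots(1-q^{1+2n})^2}=\sum_{n=0}^\infty a_\omega(n)q^n .$$ The integers $a_{\mathcal{C}}(n)$ are the coefficients of the Cesaro function $$\mathcal{C}=2\prod_{n=1}^\infty \frac{1-q^{2n-1}}{1-q^{2n}}\sum_{n \in \mathbb{Z}} \frac{q^{\frac{1}{2}n(n+1)}}{1+q^n}=\sum_{n=0}^\infty a_{\mathcal{C}}(n)q^n .$$ Both are power series expansions in $q$, with $|q|<1$; in the sum over $n\in\mathbb{Z}$ the terms with indices $n$ and $-n$ coincide. *)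

theory Defs
  imports "HOL-Analysis.Analysis" "HOL-Computational_Algebra.Formal_Laurent_Series"
    "HOL-Number_Theory.Cong"
begin

text \<open>
  The generating functions are formal series over the rationals, and infinite sums and products are
  limits in the X-adic topology of \<^typ>\<open>rat fps\<close> and \<^typ>\<open>rat fls\<close>.
  The Cesaro function is written in the field of formal Laurent series because the terms with
  negative index of the two-sided sum involve negative powers of the variable.
\<close>

definition mock_omega :: "rat fps" where
  "mock_omega =
     (\<Sum>n. fps_X ^ (2 * n\<^sup>2 + 2 * n) / (\<Prod>k\<le>n. (1 - fps_X ^ (1 + 2 * k))\<^sup>2))"

text \<open>
  Index \<open>m\<close> of the product below is the factor \<open>n = m + 1\<close> of the usual product over \<open>n \<ge> 1\<close>.
\<close>

definition cesaro_fun :: "rat fls" where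
  "cesaro_fun =
     2 * (\<Prod>m. (1 - fls_X ^ (2 * (m + 1) - 1)) / (1 - fls_X ^ (2 * (m + 1))))
       * (\<Sum>\<^sub>\<infinity>n\<in>(UNIV :: int set). fls_X powi (n * (n + 1) div 2) / (1 + fls_X powi n))"

text \<open>
  The integer coefficient sequences; they exist and are unique by the lemmas
  \<open>mock_omega_eq\<close> and \<open>cesaro_fun_eq\<close> below.
\<close>

definition a_omega :: "nat \<Rightarrow> int" where
  "a_omega = (THE a. mock_omega = Abs_fps (\<lambda>n. of_int (a n)))"

definition a_cesaro :: "nat \<Rightarrow> int" where
  "a_cesaro = (THE a. cesaro_fun = fps_to_fls (Abs_fps (\<lambda>n. of_int (a n))))"


subsection \<open>Convergence and integrality\<close>

definition int_coeffs :: "rat fps \<Rightarrow> bool" where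
  "int_coeffs F \<longleftrightarrow> (\<forall>k. fps_nth F k \<in> \<int>)"

lemma int_coeffs_basic [simp, intro]:
  "int_coeffs 0" "int_coeffs 1" "int_coeffs fps_X"
  by (auto simp: int_coeffs_def fps_X_def)

lemma int_coeffs_add: "int_coeffs F \<Longrightarrow> int_coeffs G \<Longrightarrow> int_coeffs (F + G)"
  by (auto simp: int_coeffs_def)

lemma int_coeffs_diff: "int_coeffs F \<Longrightarrow> int_coeffs G \<Longrightarrow> int_coeffs (F - G)"
  by (auto simp: int_coeffs_def)

lemma int_coeffs_mult: "int_coeffs F \<Longrightarrow> int_coeffs G \<Longrightarrow> int_coeffs (F * G)"
  by (auto simp: int_coeffs_def fps_mult_nth intro!: Ints_sum Ints_mult)

lemma int_coeffs_power: "int_coeffs F \<Longrightarrow> int_coeffs (F ^ n)"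
  by (induction n) (auto intro: int_coeffs_mult)

lemma int_coeffs_prod: "(\<And>x. x \<in> A \<Longrightarrow> int_coeffs (f x)) \<Longrightarrow> int_coeffs (prod f A)"
  by (induction A rule: infinite_finite_induct) (auto intro: int_coeffs_mult)

lemma int_coeffs_sum: "(\<And>x. x \<in> A \<Longrightarrow> int_coeffs (f x)) \<Longrightarrow> int_coeffs (sum f A)"
  by (induction A rule: infinite_finite_induct) (auto intro: int_coeffs_add)

lemma int_coeffs_inverse:
  assumes "int_coeffs F" "fps_nth F 0 = 1"
  shows "int_coeffs (inverse F)"
  unfolding int_coeffs_def
proof
  fix k show "fps_nth (inverse F) k \<in> \<int>"
  proof (induction k rule: less_induct)
    case (less k)
    show ?case
    proof (cases "k = 0")
      case True
      then show ?thesis using assms by simp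
    next
      case False
      then have "fps_nth (inverse F) k = - (\<Sum>i=1..k. fps_nth F i * fps_nth (inverse F) (k - i))"
        using assms(2) by (cases k) (simp_all add: fps_inverse_def)
      moreover have "(\<Sum>i=1..k. fps_nth F i * fps_nth (inverse F) (k - i)) \<in> \<int>"
        using assms(1) less by (intro Ints_sum Ints_mult) (auto simp: int_coeffs_def)
      ultimately show ?thesis by simp
    qed
  qed
qed

lemma int_coeffs_divide:
  assumes "int_coeffs F" "int_coeffs G" "fps_nth G 0 = 1"
  shows "int_coeffs (F / G)"
  using assms by (simp add: fps_divide_unit int_coeffs_mult int_coeffs_inverse)

lemma int_coeffs_obtain:
  assumes "int_coeffs F"
  obtains a :: "nat \<Rightarrow> int" where "F = Abs_fps (\<lambda>n. of_int (a n))"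
proof -
  have "\<forall>n. \<exists>z. fps_nth F n = of_int z"
    using assms by (auto simp: int_coeffs_def elim: Ints_cases)
  then obtain a where "\<forall>n. fps_nth F n = of_int (a n)" by metis
  then show ?thesis using that by (auto simp: fps_eq_iff)
qed

lemma LIMSEQ_fps_diagonal:
  fixes S :: "nat \<Rightarrow> 'a :: group_add fps"
  assumes "\<And>n k. k \<le> n \<Longrightarrow> fps_nth (S (Suc n)) k = fps_nth (S n) k"
  shows "S \<longlonglongrightarrow> Abs_fps (\<lambda>k. fps_nth (S k) k)"
proof (rule tendsto_fpsI)
  fix k
  have "fps_nth (S n) k = fps_nth (S k) k" if "n \<ge> k" for n
    using that assms by (induction n rule: dec_induct) auto
  then show "\<forall>\<^sub>F n in sequentially. fps_nth (S n) k = fps_nth (Abs_fps (\<lambda>k. fps_nth (S k) k)) k"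
    unfolding fps_nth_Abs_fps by (rule eventually_sequentiallyI)
qed

lemma tendsto_fps_to_fls:
  fixes g :: "'a :: group_add fps"
  assumes "(f \<longlongrightarrow> g) F"
  shows "((\<lambda>x. fps_to_fls (f x)) \<longlongrightarrow> fps_to_fls g) F"
proof -
  have "dist (fps_to_fls a) (fps_to_fls b) = dist a b" for a b :: "'a fps"
    by (auto simp: dist_fls_def dist_fps_def fls_subdegree_fls_to_fps simp flip: fps_to_fls_minus)
  then show ?thesis using assms by (simp add: tendsto_iff)
qed

lemma fps_to_fls_sum: "fps_to_fls (sum f A) = (\<Sum>x\<in>A. fps_to_fls (f x))"
  by (induction A rule: infinite_finite_induct) auto

lemma fps_to_fls_prod:
  fixes f :: "'b \<Rightarrow> 'a :: comm_ring_1 fps"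
  shows "fps_to_fls (prod f A) = (\<Prod>x\<in>A. fps_to_fls (f x))"
  by (induction A rule: infinite_finite_induct) (auto simp: fls_times_fps_to_fls)

lemma fps_prod_nth_0: "fps_nth (prod f A) 0 = (\<Prod>x\<in>A. fps_nth (f x) 0)"
  by (induction A rule: infinite_finite_induct) auto

lemma mock_omega_sums:
  "(\<lambda>n. fps_X ^ (2 * n\<^sup>2 + 2 * n) / (\<Prod>k\<le>n. (1 - fps_X ^ (1 + 2 * k))\<^sup>2)) sums mock_omega"
  and int_coeffs_mock_omega: "int_coeffs mock_omega"
proof -
  define t :: "nat \<Rightarrow> rat fps" where
    "t n = fps_X ^ (2 * n\<^sup>2 + 2 * n) / (\<Prod>k\<le>n. (1 - fps_X ^ (1 + 2 * k))\<^sup>2)" for n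
  have D: "fps_nth (\<Prod>k\<le>n. (1 - fps_X ^ (1 + 2 * k) :: rat fps)\<^sup>2) 0 = 1" for n
    by (simp add: fps_prod_nth_0 fps_power_zeroth)
  have t: "int_coeffs (t n)" for n
    unfolding t_def
    by (intro int_coeffs_divide D int_coeffs_prod int_coeffs_power int_coeffs_diff) auto
  have z: "fps_nth (t n) k = 0" if "k < n" for n k
  proof -
    have "t n = fps_X ^ (2 * n\<^sup>2 + 2 * n) * inverse (\<Prod>k\<le>n. (1 - fps_X ^ (1 + 2 * k))\<^sup>2)"
      unfolding t_def using D[of n] by (simp add: fps_divide_unit)
    then show ?thesis using that by (simp add: fps_X_power_mult_nth)
  qed
  define G where "G = Abs_fps (\<lambda>k. fps_nth (sum t {..<Suc k}) k)"
  have "(\<lambda>n. sum t {..<Suc n}) \<longlonglongrightarrow> G"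
    unfolding G_def by (rule LIMSEQ_fps_diagonal) (simp add: z)
  then have s: "t sums G"
    unfolding sums_def by (rule LIMSEQ_imp_Suc)
  then have "mock_omega = G"
    unfolding mock_omega_def t_def by (simp add: sums_iff)
  moreover have "fps_nth (sum t {..<Suc k}) k \<in> \<int>" for k
    using int_coeffs_sum[of "{..<Suc k}" t] t by (auto simp: int_coeffs_def)
  then have "int_coeffs G"
    unfolding G_def int_coeffs_def fps_nth_Abs_fps by blast
  ultimately show "int_coeffs mock_omega"
    and "(\<lambda>n. fps_X ^ (2 * n\<^sup>2 + 2 * n) / (\<Prod>k\<le>n. (1 - fps_X ^ (1 + 2 * k))\<^sup>2)) sums mock_omega"
    using s unfolding t_def by auto
qed

lemma mock_omega_eq: "mock_omega = Abs_fps (\<lambda>n. of_int (a_omega n))"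
proof -
  obtain a where a: "mock_omega = Abs_fps (\<lambda>n. of_int (a n))"
    using int_coeffs_obtain[OF int_coeffs_mock_omega] .
  show ?thesis
    unfolding a_omega_def by (rule theI[of _ a]) (use a in \<open>auto simp: fps_eq_iff\<close>)
qed

definition cesaro_prod :: "rat fps" where
  "cesaro_prod = lim (\<lambda>N. \<Prod>m\<le>N. (1 - fps_X ^ (2 * m + 1)) / (1 - fps_X ^ (2 * m + 2)))"

lemma cesaro_prod_LIMSEQ:
    "(\<lambda>N. \<Prod>m\<le>N. (1 - fps_X ^ (2 * m + 1)) / (1 - fps_X ^ (2 * m + 2))) \<longlonglongrightarrow> cesaro_prod"
  and int_coeffs_cesaro_prod: "int_coeffs cesaro_prod"
  and cesaro_prod_nth_0: "fps_nth cesaro_prod 0 = 1"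
proof -
  define p :: "nat \<Rightarrow> rat fps" where
    "p m = (1 - fps_X ^ (2 * m + 1)) / (1 - fps_X ^ (2 * m + 2))" for m
  define G where "G = Abs_fps (\<lambda>k. fps_nth (\<Prod>m\<le>k. p m) k)"
  have int: "int_coeffs (p m)" for m
    unfolding p_def by (intro int_coeffs_divide int_coeffs_diff int_coeffs_power) auto
  have p: "p m = 1 + fps_X ^ (2 * m + 1) * ((fps_X - 1) / (1 - fps_X ^ (2 * m + 2)))" for m
  proof -
    define d :: "rat fps" where "d = 1 - fps_X ^ (2 * m + 2)"
    have d: "fps_nth d 0 \<noteq> 0" by (simp add: d_def)
    have "p m = (1 - fps_X ^ (2 * m + 1)) * inverse d"
      by (simp only: p_def fps_divide_unit[OF d] flip: d_def)
    also have "1 - fps_X ^ (2 * m + 1) = d + fps_X ^ (2 * m + 1) * (fps_X - 1)"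
      by (simp add: d_def algebra_simps)
    also have "\<dots> * inverse d = 1 + fps_X ^ (2 * m + 1) * ((fps_X - 1) * inverse d)"
      using inverse_mult_eq_1'[OF d] by (simp add: algebra_simps)
    finally show ?thesis
      by (simp only: fps_divide_unit[OF d] flip: d_def)
  qed
  have "(\<lambda>N. \<Prod>m\<le>N. p m) \<longlonglongrightarrow> G"
    unfolding G_def
  proof (rule LIMSEQ_fps_diagonal)
    fix n k :: nat assume "k \<le> n"
    define R where "R = (fps_X - 1) / (1 - fps_X ^ (2 * Suc n + 2) :: rat fps)"
    have "(\<Prod>m\<le>Suc n. p m) = prod p {..n} + fps_X ^ (2 * Suc n + 1) * (prod p {..n} * R)"
      by (simp only: prod.atMost_Suc p[of "Suc n"] distrib_left mult_1_right mult.left_commute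
          flip: R_def)
    then show "fps_nth (\<Prod>m\<le>Suc n. p m) k = fps_nth (\<Prod>m\<le>n. p m) k"
      using \<open>k \<le> n\<close> by (simp add: fps_X_power_mult_nth del: power_Suc prod.atMost_Suc)
  qed
  moreover from this have "cesaro_prod = G"
    unfolding cesaro_prod_def by (intro limI) (simp add: p_def)
  moreover have "fps_nth (\<Prod>m\<le>k. p m) k \<in> \<int>" for k
    using int_coeffs_prod[of "{..k}" p] int by (auto simp: int_coeffs_def)
  then have "int_coeffs G"
    unfolding G_def int_coeffs_def fps_nth_Abs_fps by blast
  moreover have "fps_nth G 0 = 1"
    unfolding G_def p_def by (simp add: fps_divide_unit)
  ultimately show
    "(\<lambda>N. \<Prod>m\<le>N. (1 - fps_X ^ (2 * m + 1)) / (1 - fps_X ^ (2 * m + 2))) \<longlonglongrightarrow> cesaro_prod"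
    "int_coeffs cesaro_prod" "fps_nth cesaro_prod 0 = 1"
    by (simp_all add: p_def)
qed

lemma cesaro_has_prod:
  "(\<lambda>m. (1 - fls_X ^ (2 * (m + 1) - 1)) / (1 - fls_X ^ (2 * (m + 1)))) has_prod fps_to_fls cesaro_prod"
proof -
  have "(1 - fls_X ^ (2 * (m + 1) - 1)) / (1 - fls_X ^ (2 * (m + 1))) =
      fps_to_fls ((1 - fps_X ^ (2 * m + 1)) / (1 - fps_X ^ (2 * m + 2)) :: rat fps)" for m
  proof -
    have "fps_nth (1 - fps_X ^ (2 * m + 2) :: rat fps) 0 \<noteq> 0" by simp
    then have "subdegree (1 - fps_X ^ (2 * m + 2) :: rat fps) = 0"
      using subdegree_eq_0_iff by blast
    then have "fps_to_fls ((1 - fps_X ^ (2 * m + 1)) / (1 - fps_X ^ (2 * m + 2)) :: rat fps) =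
        fps_to_fls (1 - fps_X ^ (2 * m + 1)) / fps_to_fls (1 - fps_X ^ (2 * m + 2))"
      by (subst fls_divide_fps_to_fls) auto
    moreover have "2 * (m + 1) - 1 = 2 * m + 1" "2 * (m + 1) = 2 * m + 2" by auto
    ultimately show ?thesis
      by (simp only: fps_to_fls_minus fps_one_to_fls fps_to_fls_power fps_X_to_fls)
  qed
  moreover have "cesaro_prod \<noteq> 0"
    using cesaro_prod_nth_0 by auto
  ultimately show ?thesis
    using tendsto_fps_to_fls[OF cesaro_prod_LIMSEQ]
    by (simp only: has_prod_def raw_has_prod_def fps_to_fls_prod add_0_right
        fps_to_fls_eq_0_iff simp_thms)
qed

text \<open>
  Multiplying numerator and denominator of a term of negative index by a power of the variable
  turns it into the term of the opposite index.
\<close>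

definition cesaro_term :: "nat \<Rightarrow> rat fps" where
  "cesaro_term m = fps_X ^ (m * (m + 1) div 2) / (1 + fps_X ^ m)"

lemma cesaro_term_eq:
  "fls_X powi (n * (n + 1) div 2) / (1 + fls_X powi n) = fps_to_fls (cesaro_term (nat \<bar>n\<bar>))"
proof -
  have pos: "fls_X powi (int m * (int m + 1) div 2) / (1 + fls_X powi int m) =
      fps_to_fls (cesaro_term m)" for m
  proof -
    have "fps_nth (1 + fps_X ^ m :: rat fps) 0 \<noteq> 0" by (cases m) auto
    then have "subdegree (1 + fps_X ^ m :: rat fps) = 0"
      using subdegree_eq_0_iff by blast
    then have "fps_to_fls (cesaro_term m) =
        fps_to_fls (fps_X ^ (m * (m + 1) div 2)) / fps_to_fls (1 + fps_X ^ m)"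
      unfolding cesaro_term_def by (subst fls_divide_fps_to_fls) auto
    moreover have "int m * (int m + 1) div 2 = int (m * (m + 1) div 2)"
      by (simp add: zdiv_int algebra_simps)
    ultimately show ?thesis by (simp add: fps_to_fls_power power_int_of_nat)
  qed
  show ?thesis
  proof (cases "n \<ge> 0")
    case True
    then show ?thesis using pos[of "nat n"] by simp
  next
    case False
    define m where "m = nat (- n)"
    have n: "n = - int m" and "m > 0" using False by (auto simp: m_def)
    define X :: "rat fls" where "X = fls_X"
    have X: "X \<noteq> 0" by (simp add: X_def)
    have nz: "1 + X powi int m \<noteq> 0"
    proof
      assume "1 + X powi int m = 0"
      then have "fls_nth (1 + X ^ m) 0 = 0" by (simp add: power_int_of_nat)
      then show False using \<open>m > 0\<close> by (simp add: X_def fls_X_power_nth)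
    qed
    have e: "int m * (int m + 1) div 2 = n * (n + 1) div 2 + int m"
    proof -
      have "int m * (int m + 1) = n * (n + 1) + int m * 2"
        by (simp add: n algebra_simps)
      then show ?thesis by simp
    qed
    have "X powi (n * (n + 1) div 2) / (1 + X powi n) =
        (X powi (n * (n + 1) div 2) * X powi int m) / ((1 + X powi n) * X powi int m)"
      using X by simp
    also have "X powi (n * (n + 1) div 2) * X powi int m = X powi (int m * (int m + 1) div 2)"
      using X by (simp add: e power_int_add)
    also have "(1 + X powi n) * X powi int m = 1 + X powi int m"
      using X by (simp add: n distrib_right power_int_minus)
    finally show ?thesis using pos[of m] by (simp add: X_def n)
  qed
qed

definition cesaro_sum :: "rat fps" where
  "cesaro_sum = Abs_fps (\<lambda>k. fps_nth (\<Sum>n\<in>{- int k..int k}. cesaro_term (nat \<bar>n\<bar>)) k)"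

lemma cesaro_term_nth_eq_0:
  assumes "k < m"
  shows "fps_nth (cesaro_term m) k = 0"
proof -
  have "fps_nth (1 + fps_X ^ m :: rat fps) 0 \<noteq> 0" by (cases m) auto
  then have "cesaro_term m = fps_X ^ (m * (m + 1) div 2) * inverse (1 + fps_X ^ m)"
    by (simp add: cesaro_term_def fps_divide_unit)
  moreover have "2 * m \<le> m * (m + 1)"
    using assms by (cases m) auto
  then have "m \<le> m * (m + 1) div 2" by linarith
  ultimately show ?thesis using assms by (simp add: fps_X_power_mult_nth)
qed

lemma cesaro_has_sum:
  "((\<lambda>n. fls_X powi (n * (n + 1) div 2) / (1 + fls_X powi n)) has_sum fps_to_fls cesaro_sum)
     (UNIV :: int set)"
proof -
  have "((\<lambda>A. \<Sum>n\<in>A. cesaro_term (nat \<bar>n\<bar>)) \<longlongrightarrow> cesaro_sum)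
      (finite_subsets_at_top (UNIV :: int set))"
  proof (rule tendsto_fpsI)
    fix k
    have "fps_nth (\<Sum>n\<in>A. cesaro_term (nat \<bar>n\<bar>)) k = fps_nth cesaro_sum k"
      if "finite A" "{- int k..int k} \<subseteq> A" for A
      unfolding cesaro_sum_def fps_nth_Abs_fps fps_sum_nth
      using that by (intro sum.mono_neutral_right) (auto intro!: cesaro_term_nth_eq_0)
    then show "\<forall>\<^sub>F A in finite_subsets_at_top UNIV.
        fps_nth (\<Sum>n\<in>A. cesaro_term (nat \<bar>n\<bar>)) k = fps_nth cesaro_sum k"
      unfolding eventually_finite_subsets_at_top
      by (intro exI[of _ "{- int k..int k}"]) auto
  qed
  from tendsto_fps_to_fls[OF this] show ?thesis
    by (simp only: has_sum_def fps_to_fls_sum cesaro_term_eq)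
qed

lemma cesaro_fun_eq_fps: "cesaro_fun = fps_to_fls (2 * cesaro_prod * cesaro_sum)"
  unfolding cesaro_fun_def
  by (simp only: infsumI[OF cesaro_has_sum] has_prod_unique[OF cesaro_has_prod, symmetric]
      fls_times_fps_to_fls fps_to_fls_numeral)

lemma int_coeffs_cesaro_sum: "int_coeffs (2 * cesaro_sum)"
proof -
  have t: "int_coeffs (2 * cesaro_term m)" for m
  proof (cases "m = 0")
    case True
    have "(1 :: rat fps) / 2 = fps_const (1 / 2)"
      by (simp add: fps_divide_unit numeral_fps_const fps_const_inverse inverse_eq_divide)
    then have "2 * ((1 :: rat fps) / 2) = 1"
      by (simp add: numeral_fps_const)
    then show ?thesis using True by (simp add: cesaro_term_def)
  next
    case False
    have "int_coeffs (cesaro_term m)"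
      unfolding cesaro_term_def using False
      by (intro int_coeffs_divide int_coeffs_add int_coeffs_power) auto
    then show ?thesis by (simp only: mult_2 int_coeffs_add)
  qed
  have "fps_nth (\<Sum>n\<in>{- int k..int k}. 2 * cesaro_term (nat \<bar>n\<bar>)) k \<in> \<int>" for k
    using int_coeffs_sum[of "{- int k..int k}" "\<lambda>n. 2 * cesaro_term (nat \<bar>n\<bar>)"] t
    by (auto simp: int_coeffs_def)
  then show ?thesis
    by (simp add: int_coeffs_def cesaro_sum_def numeral_fps_const sum_distrib_left fps_sum_nth)
qed

lemma cesaro_fun_eq: "cesaro_fun = fps_to_fls (Abs_fps (\<lambda>n. of_int (a_cesaro n)))"
proof -
  have "int_coeffs (2 * cesaro_prod * cesaro_sum)"
    using int_coeffs_mult[OF int_coeffs_cesaro_prod int_coeffs_cesaro_sum]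
    by (simp add: mult_ac)
  then obtain a where "2 * cesaro_prod * cesaro_sum = Abs_fps (\<lambda>n. of_int (a n))"
    using int_coeffs_obtain by blast
  then have a: "cesaro_fun = fps_to_fls (Abs_fps (\<lambda>n. of_int (a n)))"
    by (simp only: cesaro_fun_eq_fps)
  show ?thesis
    unfolding a_cesaro_def
  proof (rule theI[of _ a])
    fix b assume "cesaro_fun = fps_to_fls (Abs_fps (\<lambda>n. of_int (b n)))"
    then show "b = a"
      unfolding a fps_to_fls_eq_iff by (auto simp: fps_eq_iff)
  qed (rule a)
qed

end

theory Submission
  imports Defs
begin

text \<open>
  The Cesaro function is the value at \<open>w = 0\<close> of \<open>4 A / Th\<close>, where \<open>A\<close> is an Appell sum and \<open>Th\<close> a
  theta function, both expanded in a second variable \<open>exp w\<close>.  Multiplying \<open>A\<close> by \<open>Th\<close> gives a combination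
  of two theta functions with coefficients free of \<open>w\<close>, so that \<open>R = C Th - 4 A\<close>, with \<open>C\<close> the Cesaro function, satisfies
  \<open>Th(0)^2 R Th = 4 s S^2\<close>, where \<open>S\<close> is the signed theta function and \<open>s = S'(0) / 2\<close> is Jacobi's series for the
  cube of the Dedekind eta product.  Expanding in \<open>w\<close> expresses the moments \<open>sum a(N - l(l+1)/2) (2l+1)^k\<close> of
  the coefficients of \<open>C\<close>, up to the explicit moments of \<open>A\<close>, by the series \<open>kap = s / psi\<close> and logarithmic derivatives.
  For \<open>p = 3\<close> and \<open>p = 7\<close> a combination of the moments of \<open>R\<close> is modulo \<open>p\<close> a multiple of a \<open>p\<close>-th power, so it
  contributes only when \<open>p\<close> divides \<open>N\<close>.  Since \<open>x^2 + x\<close> resp. \<open>x^4 + x\<close> vanishes modulo \<open>p\<close> on negatives of squares,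
  in all cases \<open>p\<close> divides the sum over \<open>l\<close> of \<open>a(n) (x^2 + x)\<close> resp. \<open>a(n) (x^4 + x)\<close> with \<open>n = N - l(l+1)/2\<close> and
  \<open>x = 8 n - 1 = 8 N - (2l+1)^2\<close>.  Hence \<open>p\<close> divides \<open>a(n)\<close> unless \<open>x\<close> is the negative of a square modulo \<open>p\<close>.

  For \<open>omega\<close>, Lagrange interpolation of the constant 1 at points \<open>x^l + x^(-l)\<close> is used twice.  At odd \<open>l\<close>
  it gives Watson's formula \<open>E2 omega = sum (-1)^n q^(3n(n+1)) (1 + q^(2n+1)) / (1 - q^(2n+1))\<close>.  At odd \<open>l\<close> together with
  multiples of 4 it identifies the resulting Lambert series, up to terms in \<open>q^4\<close>, with a quotient of
  infinite products.  Dissecting that quotient by \<open>phi(q)^2 = phi(q^2)^2 + 4 q psi(q^4)^2\<close> yields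
  \<open>sum a(8n+3) q^n = 4 E2^10 / E1^9\<close>, where \<open>Eb = prod (1 - q^(bn))\<close>.  Modulo 5 this is \<open>E1\<close> times a series in \<open>q^5\<close>,
  and the pentagonal numbers avoid the residues 3 and 4.
\<close>

text \<open>The weights \<open>x^2 + x\<close> and \<open>x^4 + x\<close> are forced from two sides.
  The moments of the Appell sum only involve values \<open>8 N - T^2 = - (2 i + 1)^2\<close>
  (\<open>Pexp_Todd\<close>), so a weight must vanish modulo \<open>p\<close> at negatives of
  squares. At \<open>x = M - t^2\<close> Fermat turns \<open>t^4\<close> modulo 3 and
  \<open>t^8\<close> modulo 7 into \<open>t^2\<close>, so only moments up to order 2 resp. 6 occur.
  Multiplication by \<open>M = 8 N\<close> is \<open>8 q d/dq\<close> on series; hence the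
  combination for 7 contains derivatives of \<open>kap\<close>. It closes up through two
  differential equations for theta constants, found by comparing Taylor coefficients in
  \<open>w\<close> of squared theta functions with derivatives in \<open>q\<close>. For
  \<open>omega\<close>, the extra nodes are multiples of 4 because the factors that they add at an
  odd node \<open>2 n + 1\<close> turn its term into the summand of the odd part of Watson's series,
  up to a factor independent of \<open>n\<close>. The terms of the new nodes are, after division by
  a common product, series in \<open>q^4\<close>, invisible in coefficients of index 2 modulo
  4.\<close>

declare [[simproc del: poly_fps_eq]]

subsection \<open>Locally finite sums of power series\<close>

definition lfin :: "'i set \<Rightarrow> ('i \<Rightarrow> 'a::comm_monoid_add fps) \<Rightarrow> bool" where
  "lfin I F \<longleftrightarrow> (\<forall>n. finite {i \<in> I. fps_nth (F i) n \<noteq> 0})"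

text \<open>If the family is not locally finite, the coefficients with infinitely many contributions are 0.\<close>

definition fsum :: "'i set \<Rightarrow> ('i \<Rightarrow> 'a::comm_monoid_add fps) \<Rightarrow> 'a fps" where
  "fsum I F = Abs_fps (\<lambda>n. \<Sum>i | i \<in> I \<and> fps_nth (F i) n \<noteq> 0. fps_nth (F i) n)"

lemma lfinI:
  assumes "\<And>i k. i \<in> I \<Longrightarrow> k < e i \<Longrightarrow> fps_nth (F i) k = 0"
    and "\<And>n::nat. finite {i \<in> I. e i \<le> n}"
  shows "lfin I F"
  unfolding lfin_def
proof
  fix n show "finite {i \<in> I. fps_nth (F i) n \<noteq> 0}"
    by (rule finite_subset[OF _ assms(2)[of n]]) (use assms(1) not_le in blast)
qed

text \<open>\<open>J\<close> may be any finite set containing the support, so that several families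
  can be compared over one index set.\<close>

lemma fsum_nth:
  assumes "finite J" "J \<subseteq> I" "\<And>i. i \<in> I \<Longrightarrow> i \<notin> J \<Longrightarrow> fps_nth (F i) n = 0"
  shows "fps_nth (fsum I F) n = (\<Sum>i\<in>J. fps_nth (F i) n)"
  unfolding fsum_def fps_nth_Abs_fps
  by (rule sum.mono_neutral_left) (use assms in auto)

lemma fsum_cong: "I = J \<Longrightarrow> (\<And>i. i \<in> J \<Longrightarrow> F i = G i) \<Longrightarrow> fsum I F = fsum J G"
  unfolding fsum_def by (auto simp: fps_eq_iff intro!: sum.cong)

lemma lfin_cong: "I = J \<Longrightarrow> (\<And>i. i \<in> J \<Longrightarrow> F i = G i) \<Longrightarrow> lfin I F = lfin J G"
  unfolding lfin_def by (auto cong: conj_cong)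

lemma fsum_finite: "finite I \<Longrightarrow> fsum I F = sum F I"
  by (rule fps_ext, subst fsum_nth[where J = I]) (auto simp: fps_sum_nth)

lemma lfin_finite: "finite I \<Longrightarrow> lfin I F"
  by (simp add: lfin_def)

lemma lfin_subset:
  assumes "lfin I F" "J \<subseteq> I" shows "lfin J F"
  unfolding lfin_def
proof
  fix n
  have "{i \<in> J. fps_nth (F i) n \<noteq> 0} \<subseteq> {i \<in> I. fps_nth (F i) n \<noteq> 0}" using assms(2) by auto
  then show "finite {i \<in> J. fps_nth (F i) n \<noteq> 0}"
    using assms(1) unfolding lfin_def by (meson finite_subset)
qed

lemma fsum_reindex_bij:
  assumes "bij_betw h I J" "\<And>i. i \<in> I \<Longrightarrow> F (h i) = G i"
  shows "fsum J F = fsum I G"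
proof (rule fps_ext)
  fix n
  have "bij_betw h {i \<in> I. fps_nth (G i) n \<noteq> 0} {j \<in> J. fps_nth (F j) n \<noteq> 0}"
    using assms unfolding bij_betw_def by (auto simp: inj_on_def image_iff)
  from sum.reindex_bij_betw[OF this, of "\<lambda>j. fps_nth (F j) n"]
  show "fps_nth (fsum J F) n = fps_nth (fsum I G) n"
    unfolding fsum_def fps_nth_Abs_fps by (simp add: assms(2))
qed

lemma lfin_reindex_bij:
  assumes "bij_betw h I J" "\<And>i. i \<in> I \<Longrightarrow> F (h i) = G i"
  shows "lfin J F \<longleftrightarrow> lfin I G"
proof -
  have "bij_betw h {i \<in> I. fps_nth (G i) n \<noteq> 0} {j \<in> J. fps_nth (F j) n \<noteq> 0}" for n
    using assms unfolding bij_betw_def by (auto simp: inj_on_def image_iff)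
  then show ?thesis unfolding lfin_def using bij_betw_finite by blast
qed

lemma lfin_add:
  assumes "lfin I F" "lfin I G" shows "lfin I (\<lambda>i. F i + G i)"
  unfolding lfin_def
proof
  fix n
  have "{i \<in> I. fps_nth (F i + G i) n \<noteq> 0} \<subseteq> {i \<in> I. fps_nth (F i) n \<noteq> 0} \<union> {i \<in> I. fps_nth (G i) n \<noteq> 0}"
    by auto
  then show "finite {i \<in> I. fps_nth (F i + G i) n \<noteq> 0}"
    using assms unfolding lfin_def by (meson finite_UnI finite_subset)
qed

lemma fsum_add:
  assumes "lfin I F" "lfin I G" shows "fsum I (\<lambda>i. F i + G i) = fsum I F + fsum I G"
proof (rule fps_ext)
  fix n
  let ?J = "{i \<in> I. fps_nth (F i) n \<noteq> 0} \<union> {i \<in> I. fps_nth (G i) n \<noteq> 0}"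
  have J: "finite ?J" using assms unfolding lfin_def by blast
  show "fps_nth (fsum I (\<lambda>i. F i + G i)) n = fps_nth (fsum I F + fsum I G) n"
    by (simp only: fps_add_nth, subst (1 2 3) fsum_nth[where J = ?J])
      (use J in \<open>auto simp: sum.distrib\<close>)
qed

lemma fsum_zero [simp]: "fsum I (\<lambda>_. 0) = 0"
  by (simp add: fsum_def fps_eq_iff)

lemma fsum_Un_disjoint:
  assumes "lfin I F" "lfin J F" "I \<inter> J = {}"
  shows "fsum (I \<union> J) F = fsum I F + fsum J F"
proof (rule fps_ext)
  fix n
  let ?I = "{i \<in> I. fps_nth (F i) n \<noteq> 0}" and ?J = "{i \<in> J. fps_nth (F i) n \<noteq> 0}"
  have "finite ?I" "finite ?J" using assms unfolding lfin_def by auto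
  moreover have "fps_nth (fsum (I \<union> J) F) n = (\<Sum>i\<in>?I \<union> ?J. fps_nth (F i) n)"
    by (rule fsum_nth) (use calculation in auto)
  ultimately show "fps_nth (fsum (I \<union> J) F) n = fps_nth (fsum I F + fsum J F) n"
    using assms(3) by (simp add: fsum_def, subst sum.union_disjoint) (auto intro: sum.cong)
qed

lemma lfin_Un:
  assumes "lfin I F" "lfin J F" shows "lfin (I \<union> J) F"
  unfolding lfin_def
proof
  fix n
  have "{i \<in> I \<union> J. fps_nth (F i) n \<noteq> 0} = {i \<in> I. fps_nth (F i) n \<noteq> 0} \<union> {i \<in> J. fps_nth (F i) n \<noteq> 0}"
    by auto
  then show "finite {i \<in> I \<union> J. fps_nth (F i) n \<noteq> 0}"
    using assms unfolding lfin_def by auto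
qed

lemma fsum_insert:
  assumes "lfin I F" "i \<notin> I"
  shows "fsum (insert i I) F = F i + fsum I F"
  using fsum_Un_disjoint[of "{i}" F I] assms by (simp add: lfin_finite fsum_finite)

lemma fps_nth_low_mult_eq_0:
  fixes F G :: "'a::semiring_0 fps"
  assumes "\<And>k. k \<le> n \<Longrightarrow> fps_nth F k = 0"
  shows "fps_nth (F * G) n = 0"
  using assms by (simp add: fps_mult_nth)

text \<open>A nonzero coefficient of \<open>F i * G j\<close> at \<open>n\<close> needs a nonzero
  coefficient of each factor at an index at most \<open>n\<close>, which leaves finitely many
  \<open>i\<close> and \<open>j\<close>.\<close>

lemma lfin_times:
  fixes F :: "'i \<Rightarrow> 'a::comm_semiring_0 fps"
  assumes "lfin I F" "lfin J G"
  shows "lfin (I \<times> J) (\<lambda>(i, j). F i * G j)"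
  unfolding lfin_def
proof
  fix n
  have "finite ((\<Union>k\<le>n. {i \<in> I. fps_nth (F i) k \<noteq> 0}) \<times> (\<Union>k\<le>n. {i \<in> J. fps_nth (G i) k \<noteq> 0}))"
    using assms unfolding lfin_def by auto
  moreover have "\<exists>k\<le>n. fps_nth (F i) k \<noteq> 0" "\<exists>k\<le>n. fps_nth (G j) k \<noteq> 0"
    if "fps_nth (F i * G j) n \<noteq> 0" for i j
    using that fps_nth_low_mult_eq_0[of n "F i" "G j"] fps_nth_low_mult_eq_0[of n "G j" "F i"]
    by (metis mult.commute)+
  ultimately show "finite {x \<in> I \<times> J. fps_nth (case x of (i, j) \<Rightarrow> F i * G j) n \<noteq> 0}"
    by (elim finite_subset[rotated]) (auto, (blast intro: atMost_iff[THEN iffD2])+)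
qed

lemma fsum_times:
  fixes F :: "'i \<Rightarrow> 'a::comm_semiring_0 fps"
  assumes "lfin I F" "lfin J G"
  shows "fsum I F * fsum J G = fsum (I \<times> J) (\<lambda>(i, j). F i * G j)"
proof (rule fps_ext)
  fix n
  define A where "A = (\<Union>k\<le>n. {i \<in> I. fps_nth (F i) k \<noteq> 0})"
  define B where "B = (\<Union>k\<le>n. {i \<in> J. fps_nth (G i) k \<noteq> 0})"
  have fin: "finite A" "finite B" using assms unfolding lfin_def A_def B_def by auto
  have sub: "A \<subseteq> I" "B \<subseteq> J" by (auto simp: A_def B_def)
  have A: "fps_nth (fsum I F) k = (\<Sum>i\<in>A. fps_nth (F i) k)" if "k \<le> n" for k
    by (rule fsum_nth) (use fin sub that in \<open>auto simp: A_def\<close>)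
  have B: "fps_nth (fsum J G) k = (\<Sum>i\<in>B. fps_nth (G i) k)" if "k \<le> n" for k
    by (rule fsum_nth) (use fin sub that in \<open>auto simp: B_def\<close>)
  have z: "fps_nth (F i * G j) n = 0" if "i \<in> I" "j \<in> J" "i \<notin> A \<or> j \<notin> B" for i j
  proof (cases "i \<in> A")
    case True
    then have "\<And>k. k \<le> n \<Longrightarrow> fps_nth (G j) k = 0" using that by (auto simp: B_def)
    then show ?thesis using fps_nth_low_mult_eq_0[of n "G j" "F i"] by (simp add: mult.commute)
  next
    case False
    then have "\<And>k. k \<le> n \<Longrightarrow> fps_nth (F i) k = 0" using that by (auto simp: A_def)
    then show ?thesis by (rule fps_nth_low_mult_eq_0)
  qed
  have "fps_nth (fsum I F * fsum J G) n = (\<Sum>k=0..n. (\<Sum>i\<in>A. fps_nth (F i) k) * (\<Sum>i\<in>B. fps_nth (G i) (n - k)))"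
    unfolding fps_mult_nth by (rule sum.cong) (auto simp: A B)
  also have "\<dots> = (\<Sum>k=0..n. \<Sum>i\<in>A. \<Sum>j\<in>B. fps_nth (F i) k * fps_nth (G j) (n - k))"
    by (simp add: sum_product)
  also have "\<dots> = (\<Sum>i\<in>A. \<Sum>j\<in>B. fps_nth (F i * G j) n)"
    by (subst sum.swap, rule sum.cong[OF refl], subst sum.swap) (simp add: fps_mult_nth)
  also have "\<dots> = (\<Sum>(i,j)\<in>A \<times> B. fps_nth (F i * G j) n)"
    by (simp add: sum.cartesian_product)
  also have "\<dots> = fps_nth (fsum (I \<times> J) (\<lambda>(i, j). F i * G j)) n"
  proof (subst fsum_nth[where J = "A \<times> B"])
    show "fps_nth (case x of (i, j) \<Rightarrow> F i * G j) n = 0" if "x \<in> I \<times> J" "x \<notin> A \<times> B" for x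
      using z[of "fst x" "snd x"] that by (cases x) auto
  qed (use fin sub in \<open>auto intro!: sum.cong\<close>)
  finally show "fps_nth (fsum I F * fsum J G) n = fps_nth (fsum (I \<times> J) (\<lambda>(i, j). F i * G j)) n" .
qed

lemma lfin_mult_left:
  fixes F :: "'i \<Rightarrow> 'a::comm_semiring_0 fps"
  assumes "lfin I F" shows "lfin I (\<lambda>i. c * F i)"
proof -
  have "lfin ({()} \<times> I) (\<lambda>(_, i). c * F i)"
    using lfin_times[of "{()}" "\<lambda>_. c" I F] assms by (simp add: lfin_finite)
  moreover have "bij_betw (\<lambda>i. ((), i)) I ({()} \<times> I)"
    by (auto simp: bij_betw_def inj_on_def)
  ultimately show ?thesis by (subst (asm) lfin_reindex_bij[where G = "\<lambda>i. c * F i"]) auto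
qed

lemma fsum_mult_left:
  fixes F :: "'i \<Rightarrow> 'a::comm_semiring_0 fps"
  assumes "lfin I F" shows "fsum I (\<lambda>i. c * F i) = c * fsum I F"
proof -
  have "fsum {()} (\<lambda>_. c) * fsum I F = fsum ({()} \<times> I) (\<lambda>(_, i). c * F i)"
    by (rule fsum_times) (auto intro: assms lfin_finite)
  moreover have "bij_betw (\<lambda>i. ((), i)) I ({()} \<times> I)"
    by (auto simp: bij_betw_def inj_on_def)
  ultimately show ?thesis
    by (subst (asm) fsum_reindex_bij[where G = "\<lambda>i. c * F i"]) (auto simp: fsum_finite)
qed

text \<open>Fubini: the pairs with a nonzero coefficient at \<open>n\<close> form a finite set
  \<open>S n\<close>. Rows outside its projection contribute 0; rows inside may cancel, so the
  projection serves only as a set containing the support of the row sums.\<close>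

lemma fsum_Sigma:
  assumes "lfin (Sigma I J) (\<lambda>(i, j). F i j)"
  shows "fsum (Sigma I J) (\<lambda>(i, j). F i j) = fsum I (\<lambda>i. fsum (J i) (F i))"
    and "lfin I (\<lambda>i. fsum (J i) (F i))"
    and "\<And>i. i \<in> I \<Longrightarrow> lfin (J i) (F i)"
proof -
  define S where "S n = {x \<in> Sigma I J. fps_nth (F (fst x) (snd x)) n \<noteq> 0}" for n
  have fin: "finite (S n)" for n
    using assms unfolding lfin_def S_def by (simp add: case_prod_unfold)
  have row: "finite {j \<in> J i. fps_nth (F i j) n \<noteq> 0}" if "i \<in> I" for i n
    by (rule finite_subset[OF _ finite_imageI[OF fin[of n], of snd]])
      (use that in \<open>auto simp: S_def image_iff\<close>)
  show *: "lfin (J i) (F i)" if "i \<in> I" for i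
    using row[OF that] by (simp add: lfin_def)
  have out: "fps_nth (fsum (J i) (F i)) n = 0" if "i \<in> I" "i \<notin> fst ` S n" for i n
    unfolding fsum_def fps_nth_Abs_fps
    by (rule sum.neutral) (use that in \<open>auto simp: S_def image_iff\<close>)
  show "lfin I (\<lambda>i. fsum (J i) (F i))"
    unfolding lfin_def
  proof
    fix n show "finite {i \<in> I. fps_nth (fsum (J i) (F i)) n \<noteq> 0}"
      by (rule finite_subset[OF _ finite_imageI[OF fin[of n], of fst]]) (use out in blast)
  qed
  show "fsum (Sigma I J) (\<lambda>(i, j). F i j) = fsum I (\<lambda>i. fsum (J i) (F i))"
  proof (rule fps_ext)
    fix n
    define R where "R i = {j \<in> J i. fps_nth (F i j) n \<noteq> 0}" for i
    have sub: "fst ` S n \<subseteq> I" by (auto simp: S_def)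
    have "fps_nth (fsum I (\<lambda>i. fsum (J i) (F i))) n = (\<Sum>i\<in>fst ` S n. fps_nth (fsum (J i) (F i)) n)"
      by (rule fsum_nth) (use fin sub out in auto)
    also have "\<dots> = (\<Sum>i\<in>fst ` S n. \<Sum>j\<in>R i. fps_nth (F i j) n)"
      by (simp add: fsum_def R_def)
    also have "\<dots> = (\<Sum>(i,j)\<in>Sigma (fst ` S n) R. fps_nth (F i j) n)"
      by (rule sum.Sigma) (use fin sub row in \<open>auto simp: R_def\<close>)
    also have "Sigma (fst ` S n) R = S n"
      by (auto simp: S_def R_def image_iff) blast
    also have "(\<Sum>(i,j)\<in>S n. fps_nth (F i j) n) = fps_nth (fsum (Sigma I J) (\<lambda>(i, j). F i j)) n"
      by (subst fsum_nth[where J = "S n"]) (use fin in \<open>auto simp: S_def case_prod_unfold\<close>)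
    finally show "fps_nth (fsum (Sigma I J) (\<lambda>(i, j). F i j)) n = fps_nth (fsum I (\<lambda>i. fsum (J i) (F i))) n"
      by simp
  qed
qed

lemma fsum_swap:
  assumes "lfin (I \<times> J) (\<lambda>(i, j). F i j)"
  shows "fsum I (\<lambda>i. fsum J (F i)) = fsum J (\<lambda>j. fsum I (\<lambda>i. F i j))"
proof -
  have b: "bij_betw prod.swap (I \<times> J) (J \<times> I)"
    by (auto simp: bij_betw_def inj_on_def)
  have "lfin (J \<times> I) (\<lambda>(j, i). F i j)"
    using lfin_reindex_bij[OF b, of "\<lambda>(j, i). F i j" "\<lambda>(i, j). F i j"] assms by auto
  then have "fsum J (\<lambda>j. fsum I (\<lambda>i. F i j)) = fsum (J \<times> I) (\<lambda>(j, i). F i j)"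
    using fsum_Sigma(1)[of J "\<lambda>_. I" "\<lambda>j i. F i j"] by simp
  also have "\<dots> = fsum (I \<times> J) (\<lambda>(i, j). F i j)"
    by (rule fsum_reindex_bij[OF b]) auto
  finally show ?thesis using fsum_Sigma(1)[OF assms] by simp
qed

lemma lfin_uminus:
  fixes F :: "'i \<Rightarrow> 'a::ab_group_add fps"
  assumes "lfin I F" shows "lfin I (\<lambda>i. - F i)"
  using assms by (simp add: lfin_def)

lemma fsum_uminus:
  fixes F :: "'i \<Rightarrow> 'a::ab_group_add fps"
  shows "fsum I (\<lambda>i. - F i) = - fsum I F"
  by (simp add: fsum_def fps_eq_iff sum_negf)

section \<open>Coefficientwise limits of power series\<close>

definition flim :: "(nat \<Rightarrow> 'a::zero fps) \<Rightarrow> 'a fps \<Rightarrow> bool" where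
  "flim F G \<longleftrightarrow> (\<forall>n. \<exists>N0. \<forall>N\<ge>N0. fps_nth (F N) n = fps_nth G n)"

lemma flim_unique:
  assumes "flim F G" "flim F H" shows "G = H"
proof (rule fps_ext)
  fix n
  obtain a b where "\<forall>N\<ge>a. fps_nth (F N) n = fps_nth G n" "\<forall>N\<ge>b. fps_nth (F N) n = fps_nth H n"
    using assms unfolding flim_def by blast
  then show "fps_nth G n = fps_nth H n"
    by (metis max.cobounded1 max.cobounded2)
qed

lemma flim_const: "flim (\<lambda>_. G) G"
  by (simp add: flim_def)

lemma flim_up_to:
  assumes "flim F G" shows "\<exists>N0. \<forall>N\<ge>N0. \<forall>k\<le>n. fps_nth (F N) k = fps_nth G k"
proof (induction n)
  case 0 then show ?case using assms by (auto simp: flim_def)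
next
  case (Suc n)
  then obtain a where a: "\<forall>N\<ge>a. \<forall>k\<le>n. fps_nth (F N) k = fps_nth G k" by blast
  obtain b where "\<forall>N\<ge>b. fps_nth (F N) (Suc n) = fps_nth G (Suc n)" using assms by (auto simp: flim_def)
  then show ?case using a by (intro exI[of _ "max a b"]) (auto simp: le_Suc_eq)
qed

lemma flim_mult:
  fixes F F' :: "nat \<Rightarrow> 'a::semiring_0 fps"
  assumes "flim F G" "flim F' G'" shows "flim (\<lambda>N. F N * F' N) (G * G')"
  unfolding flim_def
proof
  fix n
  obtain a b where "\<forall>N\<ge>a. \<forall>k\<le>n. fps_nth (F N) k = fps_nth G k"
    "\<forall>N\<ge>b. \<forall>k\<le>n. fps_nth (F' N) k = fps_nth G' k"
    using flim_up_to[OF assms(1)] flim_up_to[OF assms(2)] by blast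
  then show "\<exists>N0. \<forall>N\<ge>N0. fps_nth (F N * F' N) n = fps_nth (G * G') n"
    by (intro exI[of _ "max a b"]) (auto simp: fps_mult_nth intro!: sum.cong)
qed

lemma flim_add:
  fixes F F' :: "nat \<Rightarrow> 'a::monoid_add fps"
  assumes "flim F G" "flim F' G'" shows "flim (\<lambda>N. F N + F' N) (G + G')"
  unfolding flim_def
proof
  fix n
  obtain a b where "\<forall>N\<ge>a. fps_nth (F N) n = fps_nth G n" "\<forall>N\<ge>b. fps_nth (F' N) n = fps_nth G' n"
    using assms unfolding flim_def by blast
  then show "\<exists>N0. \<forall>N\<ge>N0. fps_nth (F N + F' N) n = fps_nth (G + G') n"
    by (intro exI[of _ "max a b"]) auto
qed

lemma flim_subseq:
  assumes "flim F G" "\<And>N. s N \<ge> N" shows "flim (\<lambda>N. F (s N)) G"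
  using assms unfolding flim_def by (meson order_trans)

text \<open>The recursion for an inverse uses coefficients of the series only up to the same index,
  so agreement up to \<open>n\<close> passes to the inverses.\<close>

lemma flim_inverse:
  fixes F :: "nat \<Rightarrow> 'a::field fps"
  assumes "flim F G" "\<And>N. fps_nth (F N) 0 \<noteq> 0" "fps_nth G 0 \<noteq> 0"
  shows "flim (\<lambda>N. inverse (F N)) (inverse G)"
  unfolding flim_def
proof
  fix n
  obtain a where a: "\<forall>N\<ge>a. \<forall>k\<le>n. fps_nth (F N) k = fps_nth G k"
    using flim_up_to[OF assms(1)] by blast
  have "fps_nth (inverse (F N)) k = fps_nth (inverse G) k" if "N \<ge> a" "k \<le> n" for N k
    using that(2)
  proof (induction k rule: less_induct)
    case (less k)
    show ?case
    proof (cases k)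
      case 0 then show ?thesis using a that by simp
    next
      case (Suc m)
      show ?thesis using less a that Suc
        by (simp add: fps_inverse_def)
    qed
  qed
  then show "\<exists>N0. \<forall>N\<ge>N0. fps_nth (inverse (F N)) n = fps_nth (inverse G) n"
    by blast
qed

text \<open>Dominated convergence: \<open>e i\<close> bounds the order of \<open>F N i\<close> from
  below for all \<open>N\<close> at once, so a fixed coefficient depends on finitely many
  \<open>i\<close>, for which a common \<open>N0\<close> exists.\<close>

lemma flim_fsum:
  assumes lim: "\<And>i. i \<in> I \<Longrightarrow> flim (\<lambda>N. F N i) (G i)"
    and low: "\<And>N i k. i \<in> I \<Longrightarrow> k < e i \<Longrightarrow> fps_nth (F N i) k = 0"
    and fin: "\<And>n::nat. finite {i \<in> I. e i \<le> n}"
  shows "flim (\<lambda>N. fsum I (F N)) (fsum I G)"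
  unfolding flim_def
proof
  fix n
  define J where "J = {i \<in> I. e i \<le> n}"
  have J: "finite J" "J \<subseteq> I" using fin by (auto simp: J_def)
  have Gz: "fps_nth (G i) n = 0" if "i \<in> I" "i \<notin> J" for i
  proof -
    have "\<exists>N. fps_nth (F N i) n = fps_nth (G i) n"
      using lim[OF that(1)] unfolding flim_def by blast
    then obtain N where "fps_nth (F N i) n = fps_nth (G i) n" ..
    then show ?thesis using low[of i n N] that by (simp add: J_def)
  qed
  have "\<exists>N0. \<forall>i\<in>J. \<forall>N\<ge>N0. fps_nth (F N i) n = fps_nth (G i) n"
  proof -
    have "\<forall>i\<in>J. \<exists>N0. \<forall>N\<ge>N0. fps_nth (F N i) n = fps_nth (G i) n"
      using lim J unfolding flim_def by blast
    then obtain f where f: "\<forall>i\<in>J. \<forall>N\<ge>f i. fps_nth (F N i) n = fps_nth (G i) n" by metis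
    show ?thesis
      by (rule exI[of _ "Max (insert 0 (f ` J))"]) (use f J in \<open>auto simp: Max_ge_iff\<close>)
  qed
  then obtain N0 where N0: "\<forall>i\<in>J. \<forall>N\<ge>N0. fps_nth (F N i) n = fps_nth (G i) n" by blast
  show "\<exists>N0. \<forall>N\<ge>N0. fps_nth (fsum I (F N)) n = fps_nth (fsum I G) n"
  proof (intro exI[of _ N0] allI impI)
    fix N assume "N \<ge> N0"
    then show "fps_nth (fsum I (F N)) n = fps_nth (fsum I G) n"
      using J N0 Gz low
      by (subst (1 2) fsum_nth[where J = J]) (auto simp: J_def not_le)
  qed
qed

subsection \<open>The product of an Appell sum and a theta function\<close>

definition tri :: "int \<Rightarrow> nat" where
  "tri l = nat (l * (l + 1) div 2)"

lemma two_tri: "2 * int (tri l) = l * (l + 1)"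
proof -
  have "0 \<le> l * (l + 1)"
    by (cases "l \<ge> 0") (auto intro: mult_nonpos_nonpos)
  moreover have "even (l * (l + 1))" by simp
  ultimately show ?thesis by (simp add: tri_def)
qed

lemma tri_0 [simp]: "tri 0 = 0"
  by (simp add: tri_def)

lemma tri_reflect: "tri (- 1 - l) = tri l"
  unfolding tri_def by (simp add: algebra_simps)

lemma tri_reflect':
  assumes "l + m = - 1" shows "tri l = tri m"
proof -
  have "l = - 1 - m" using assms by simp
  then show ?thesis using tri_reflect[of m] by simp
qed

lemma tri_add_1: "tri (int n + 1) = tri (int n) + n + 1"
  using two_tri[of "int n + 1"] two_tri[of "int n"] by (simp add: algebra_simps)

lemma abs_le_tri: "\<bar>l\<bar> \<le> int (tri l) + 1"
proof (cases "l \<ge> 0")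
  case True
  have "2 * int (tri l) = l * (l + 1)" by (rule two_tri)
  moreover have "2 * l \<le> l * (l + 1)" if "l \<ge> 1"
    using that mult_left_mono[of 1 l l] by (simp add: algebra_simps)
  ultimately show ?thesis using True by linarith
next
  case False
  define k where "k = - 1 - l"
  have "k \<ge> 0" using False by (simp add: k_def)
  have "2 * int (tri l) = k * (k + 1)" using two_tri[of l] by (simp add: k_def algebra_simps)
  moreover have "2 * k \<le> k * (k + 1)" if "k \<ge> 1"
    using that mult_left_mono[of 1 k k] by (simp add: algebra_simps)
  ultimately have "k \<le> int (tri l)" using \<open>k \<ge> 0\<close> by linarith
  then show ?thesis using False by (simp add: k_def)
qed

lemma finite_tri_le: "finite {l. tri (l + c) \<le> n}"
proof (rule finite_subset)
  show "{l. tri (l + c) \<le> n} \<subseteq> {- int n - 1 - c..int n + 1 - c}"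
  proof
    fix l assume "l \<in> {l. tri (l + c) \<le> n}"
    then show "l \<in> {- int n - 1 - c..int n + 1 - c}" using abs_le_tri[of "l + c"] by auto
  qed
qed simp

lemma fps_nth_mult_X_power_low: "k < e \<Longrightarrow> fps_nth (c * fps_X ^ e :: 'a::comm_ring_1 fps) k = 0"
  by (simp add: fps_X_power_mult_right_nth)

lemma lfin_X_power:
  fixes c :: "'i \<Rightarrow> 'a::comm_ring_1 fps"
  assumes "\<And>n. finite {i \<in> I. e i \<le> n}"
  shows "lfin I (\<lambda>i. c i * fps_X ^ e i)"
  by (rule lfinI[of _ e]) (use assms in \<open>auto simp: fps_nth_mult_X_power_low\<close>)

text \<open>
  The function \<open>E\<close> below plays the role of \<open>t \<mapsto> exp (t w)\<close>.  The terms \<open>Pmon n i\<close> with \<open>i \<ge> 0\<close> expand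
  \<open>q^(n(n+1)/2) / (1 + q^n)\<close>, and \<open>Xser u\<close> is the coefficient of \<open>E (2 u)\<close> in the product of the
  Appell sum with \<open>Theta E\<close>.
\<close>

definition Bser :: "int \<Rightarrow> 'a::comm_ring_1 fps" where
  "Bser u = fsum UNIV (\<lambda>i::nat. (- 1) ^ i * fps_X ^ tri (\<bar>u\<bar> + int i))"

definition Pmon :: "nat \<Rightarrow> nat \<Rightarrow> 'a::comm_ring_1 fps" where
  "Pmon n i = (- 1) ^ i * fps_X ^ (tri (int n) + n * i)"

text \<open>With \<open>s = Suc n + i\<close>, the odd exponents \<open>2 s + 1\<close> and
  \<open>- (2 s + 1)\<close> combine with an exponent \<open>2 l + 1\<close> of theta to
  \<open>2 u\<close> for \<open>l = u - 1 - s\<close> resp. \<open>l = u + s\<close>, and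
  \<open>tri (u - 1 - s) = tri (s - u)\<close>. \<open>Bser\<close> is the share of the Appell term
  of index 0.\<close>

definition Wser :: "int \<Rightarrow> 'a::comm_ring_1 fps" where
  "Wser u = fsum UNIV (\<lambda>(n, i). Pmon (Suc n) i *
     (fps_X ^ tri (int (Suc n + i) - u) + fps_X ^ tri (int (Suc n + i) + u)))"

definition Xser :: "int \<Rightarrow> 'a::comm_ring_1 fps" where
  "Xser u = Bser u + Wser u"

definition Theta :: "(int \<Rightarrow> 'a::comm_ring_1) \<Rightarrow> 'a fps" where
  "Theta E = fsum UNIV (\<lambda>l. fps_const (E (2 * l + 1)) * fps_X ^ tri l)"

text \<open>For \<open>E t = z^t\<close> the geometric series in \<open>i\<close> sum to
  \<open>q^(n(n+1)/2) z^(2n+1) / (1 + q^n z^2)\<close> for \<open>n >= 1\<close>, together with the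
  same expression at \<open>- n\<close>. The term \<open>n = 0\<close>, equal to
  \<open>1 / (z + 1/z)\<close>, does not expand in powers of \<open>q\<close> and is added
  separately as a constant \<open>d\<close>.\<close>

definition Appell :: "(int \<Rightarrow> 'a::comm_ring_1) \<Rightarrow> 'a fps" where
  "Appell E = fsum UNIV (\<lambda>(n, i). Pmon (Suc n) i *
     fps_const (E (2 * int (Suc n + i) + 1) + E (- (2 * int (Suc n + i) + 1))))"

text \<open>Even and odd refer to the index \<open>u\<close> of \<open>E (2 u)\<close>:
  \<open>u = 2 k\<close> here and \<open>u = 2 k + 1\<close> in \<open>theta_odd\<close>.\<close>

definition theta_even :: "(int \<Rightarrow> 'a::comm_ring_1) \<Rightarrow> 'a fps" where
  "theta_even E = fsum UNIV (\<lambda>k. fps_const (E (4 * k)) * fps_X ^ nat (k\<^sup>2))"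

definition theta_odd :: "(int \<Rightarrow> 'a::comm_ring_1) \<Rightarrow> 'a fps" where
  "theta_odd E = fsum UNIV (\<lambda>k. fps_const (E (4 * k + 2)) * fps_X ^ (2 * tri k))"

lemma finite_tri_le_nat: "finite {i::nat. tri (int i + c) \<le> n}"
proof -
  have "finite (int -` {l. tri (l + c) \<le> n})"
    by (rule finite_vimageI[OF finite_tri_le]) (auto simp: inj_def)
  then show ?thesis by (simp add: vimage_def)
qed

lemma tri_nat_ge: "i \<le> tri (int i)"
proof (cases i)
  case (Suc k)
  have "0 \<le> int k * int k" by simp
  moreover have "2 * int (tri (int i)) = 2 + (int k * int k + int k * 3)"
    using two_tri[of "int i"] by (simp add: Suc algebra_simps)
  ultimately show ?thesis using Suc by linarith
qed simp

lemma finite_Pmon_index: "finite {(n, i). tri (int (Suc n)) + Suc n * i \<le> m}"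
proof (rule finite_subset)
  show "{(n, i). tri (int (Suc n)) + Suc n * i \<le> m} \<subseteq> {..m} \<times> {..m}"
  proof clarify
    fix n i assume a: "tri (int (Suc n)) + Suc n * i \<le> m"
    have "i \<le> Suc n * i" by simp
    then have "i \<le> m" using a by (meson le_trans le_add2)
    moreover have "n \<le> m" using a tri_nat_ge[of "Suc n"] by (meson le_trans le_add1 Suc_leD)
    ultimately show "n \<in> {..m} \<and> i \<in> {..m}" by simp
  qed
qed simp

lemma lfin_Pmon: "lfin UNIV (\<lambda>(n, i). Pmon (Suc n) i * c n i :: 'a::comm_ring_1 fps)"
proof (rule lfinI[of _ "\<lambda>(n, i). tri (int (Suc n)) + Suc n * i"])
  fix x :: "nat \<times> nat" and k
  obtain n i where x: "x = (n, i)" by force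
  assume "k < (case x of (n, i) \<Rightarrow> tri (int (Suc n)) + Suc n * i)"
  then show "fps_nth (case x of (n, i) \<Rightarrow> Pmon (Suc n) i * c n i) k = 0"
    using fps_nth_mult_X_power_low[of k "tri (int (Suc n)) + Suc n * i" "(- 1) ^ i * c n i"]
    unfolding x Pmon_def prod.case by (simp only: mult.assoc mult.commute[of _ "c n i"])
next
  fix m
  show "finite {x \<in> UNIV. (case x of (n, i) \<Rightarrow> tri (int (Suc n)) + Suc n * i) \<le> m}"
    using finite_Pmon_index[of m] by (simp add: case_prod_unfold)
qed

lemma lfin_Theta: "lfin UNIV (\<lambda>l. c l * fps_X ^ tri l :: 'a::comm_ring_1 fps)"
  by (rule lfin_X_power) (use finite_tri_le[of 0] in auto)

lemma lfin_Bser: "lfin UNIV (\<lambda>i::nat. (- 1) ^ i * fps_X ^ tri (int i + c) :: 'a::comm_ring_1 fps)"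
  by (rule lfin_X_power) (use finite_tri_le_nat in auto)

lemma fsum_nat_shift:
  assumes "lfin UNIV F"
  shows "fsum UNIV F = F 0 + fsum UNIV (\<lambda>i::nat. F (Suc i))"
proof -
  have b: "bij_betw Suc UNIV (range Suc)" by (simp add: bij_betw_def)
  have "fsum UNIV F = fsum (insert 0 (range Suc)) F"
    by (rule fsum_cong[OF UNIV_nat_eq refl])
  also have "\<dots> = F 0 + fsum (range Suc) F"
    by (rule fsum_insert) (use assms lfin_subset in auto)
  also have "fsum (range Suc) F = fsum UNIV (\<lambda>i::nat. F (Suc i))"
    by (rule fsum_reindex_bij[OF b]) simp
  finally show ?thesis .
qed

lemma fsum_rows:
  fixes G :: "nat \<Rightarrow> 'j \<Rightarrow> 'a::comm_monoid_add fps"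
  assumes "lfin UNIV (G 0)" "lfin UNIV (\<lambda>(n, i). G (Suc n) i)"
  shows "fsum UNIV (\<lambda>(n, i). G n i) = fsum UNIV (G 0) + fsum UNIV (\<lambda>(n, i). G (Suc n) i)"
    and "lfin UNIV (\<lambda>(n, i). G n i)"
proof -
  let ?F = "\<lambda>(n, i). G n i"
  have b0: "bij_betw (Pair 0) UNIV ({0::nat} \<times> (UNIV :: 'j set))"
    by (auto simp: bij_betw_def inj_on_def)
  have b1: "bij_betw (\<lambda>(n, i). (Suc n, i)) UNIV (range Suc \<times> (UNIV :: 'j set))"
    by (auto simp: bij_betw_def inj_on_def image_iff)
  have U: "(UNIV :: (nat \<times> 'j) set) = {0} \<times> UNIV \<union> range Suc \<times> UNIV"
    using UNIV_nat_eq by auto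
  have l0: "lfin ({0} \<times> UNIV) ?F" using lfin_reindex_bij[OF b0, of ?F "G 0"] assms by simp
  have l1: "lfin (range Suc \<times> UNIV) ?F"
    using lfin_reindex_bij[OF b1, of ?F "\<lambda>(n, i). G (Suc n) i"] assms by auto
  show "lfin UNIV ?F" unfolding U by (rule lfin_Un[OF l0 l1])
  have "fsum UNIV ?F = fsum ({0} \<times> UNIV) ?F + fsum (range Suc \<times> UNIV) ?F"
    unfolding U by (rule fsum_Un_disjoint[OF l0 l1]) auto
  also have "fsum ({0} \<times> UNIV) ?F = fsum UNIV (G 0)"
    by (rule fsum_reindex_bij[OF b0]) simp
  also have "fsum (range Suc \<times> UNIV) ?F = fsum UNIV (\<lambda>(n, i). G (Suc n) i)"
    by (rule fsum_reindex_bij[OF b1]) auto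
  finally show "fsum UNIV ?F = fsum UNIV (G 0) + fsum UNIV (\<lambda>(n, i). G (Suc n) i)" .
qed

lemma Bser_add_Bser_Suc:
  assumes "u \<ge> 0" shows "Bser u + Bser (u + 1) = (fps_X ^ tri u :: 'a::comm_ring_1 fps)"
proof -
  have "Bser u = fsum UNIV (\<lambda>i::nat. (- 1) ^ i * fps_X ^ tri (int i + u) :: 'a fps)"
    using assms by (simp add: Bser_def add.commute)
  also have "\<dots> = fps_X ^ tri u + fsum UNIV (\<lambda>i::nat. - ((- 1) ^ i * fps_X ^ tri (int i + (u + 1))))"
    by (subst fsum_nat_shift[OF lfin_Bser]) (simp add: algebra_simps)
  also have "\<dots> = fps_X ^ tri u - Bser (u + 1)"
    using assms by (simp add: fsum_uminus Bser_def add.commute)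
  finally show ?thesis by simp
qed

text \<open>By reflection the terms \<open>i\<close> and \<open>2 u - 1 - i\<close> have equal
  exponents and opposite signs, so the first \<open>2 u\<close> terms cancel. The induction instead
  peels off one term and compares with \<open>Bser_add_Bser_Suc\<close>.\<close>

lemma Bser_reflect:
  fixes u :: nat
  shows "fsum UNIV (\<lambda>i::nat. (- 1) ^ i * fps_X ^ tri (int i - int u)) = (Bser (int u) :: 'a::comm_ring_1 fps)"
proof (induction u)
  case 0
  then show ?case by (simp add: Bser_def)
next
  case (Suc u)
  have "fsum UNIV (\<lambda>i::nat. (- 1) ^ i * fps_X ^ tri (int i - int (Suc u)) :: 'a fps)
      = fps_X ^ tri (- int (Suc u)) - fsum UNIV (\<lambda>i::nat. (- 1) ^ i * fps_X ^ tri (int i - int u))"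
    using lfin_Bser[of "- int (Suc u)", where ?'a = 'a]
    by (subst fsum_nat_shift) (simp_all add: algebra_simps fsum_uminus)
  also have "tri (- int (Suc u)) = tri (int u)"
    by (rule tri_reflect') simp
  also have "fps_X ^ tri (int u) - fsum UNIV (\<lambda>i::nat. (- 1) ^ i * fps_X ^ tri (int i - int u)) = (Bser (int (Suc u)) :: 'a fps)"
    unfolding Suc.IH using Bser_add_Bser_Suc[of "int u", where ?'a = 'a] by (simp add: algebra_simps)
  finally show ?case .
qed

lemma mult_X_powers:
  fixes s :: "'a::comm_ring_1 fps"
  assumes "a + (b + c) = d + e"
  shows "fps_X ^ a * (s * fps_X ^ b * fps_X ^ c) = s * fps_X ^ d * fps_X ^ e"
proof -
  have "fps_X ^ a * (s * fps_X ^ b * fps_X ^ c) = s * fps_X ^ (a + (b + c))"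
    by (simp add: power_add mult_ac)
  then show ?thesis unfolding assms by (simp add: power_add mult_ac)
qed

text \<open>\<open>Bser u\<close> is the row \<open>n = 0\<close> both of \<open>f1\<close> (by
  \<open>Bser_reflect\<close>) and of \<open>f2\<close>. So \<open>Xser u\<close> is
  \<open>f1\<close> over \<open>n >= 0\<close> plus \<open>f2\<close> over \<open>n >= 1\<close>.
  Multiplication by \<open>q^(u+1)\<close> moves \<open>f1\<close> one row up and \<open>f2\<close>
  one row down, which gives the sum for \<open>u + 2\<close> with \<open>Bser\<close> now read as
  row 0 of \<open>f2\<close>.\<close>

lemma Xser_add_2:
  fixes u :: nat
  shows "Xser (int u + 2) = fps_X ^ (u + 1) * (Xser (int u) :: 'a::comm_ring_1 fps)"
proof -
  define f1 :: "int \<Rightarrow> nat \<Rightarrow> nat \<Rightarrow> 'a fps" where "f1 = (\<lambda>u n i. Pmon n i * fps_X ^ tri (int (n + i) - u))"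
  define f2 :: "int \<Rightarrow> nat \<Rightarrow> nat \<Rightarrow> 'a fps" where "f2 = (\<lambda>u n i. Pmon n i * fps_X ^ tri (int (n + i) + u))"
  have l1: "lfin UNIV (\<lambda>(n, i). f1 u (Suc n) i)" and l2: "lfin UNIV (\<lambda>(n, i). f2 u (Suc n) i)" for u
    unfolding f1_def f2_def by (rule lfin_Pmon)+
  have W: "Wser u = fsum UNIV (\<lambda>(n, i). f1 u (Suc n) i) + fsum UNIV (\<lambda>(n, i). f2 u (Suc n) i)" for u
    unfolding Wser_def fsum_add[OF l1 l2, symmetric]
    by (rule fsum_cong) (auto simp: f1_def f2_def distrib_left add.assoc)
  have r1: "fsum UNIV (f1 (int u) 0) = Bser (int u)" "lfin UNIV (f1 (int u) 0)" for u
    using lfin_Bser[of "- int u", where ?'a = 'a] Bser_reflect[of u, where ?'a = 'a]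
    by (simp_all add: f1_def Pmon_def)
  have r2: "fsum UNIV (f2 (int u) 0) = Bser (int u)" "lfin UNIV (f2 (int u) 0)" for u
    using lfin_Bser[of "int u", where ?'a = 'a]
    by (simp_all add: f2_def Pmon_def Bser_def add.commute)
  have e1: "fps_X ^ (u + 1) * f1 (int u) n i = f1 (int (u + 2)) (Suc n) i" for n i
  proof -
    have "int ((u + 1) + (tri (int n) + n * i + tri (int (n + i) - int u)))
        = int (tri (int (Suc n)) + Suc n * i + tri (int (Suc n + i) - int (u + 2)))"
      using two_tri[of "int n"] two_tri[of "int (n + i) - int u"] two_tri[of "int (Suc n)"]
        two_tri[of "int (Suc n + i) - int (u + 2)"] by (simp add: algebra_simps)
    then have "(u + 1) + (tri (int n) + n * i + tri (int (n + i) - int u))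
        = (tri (int (Suc n)) + Suc n * i) + tri (int (Suc n + i) - int (u + 2))"
      by (simp only: of_nat_eq_iff)
    then show ?thesis unfolding f1_def Pmon_def by (rule mult_X_powers)
  qed
  have e2: "fps_X ^ (u + 1) * f2 (int u) (Suc n) i = f2 (int (u + 2)) n i" for n i
  proof -
    have "int ((u + 1) + (tri (int (Suc n)) + Suc n * i + tri (int (Suc n + i) + int u)))
        = int (tri (int n) + n * i + tri (int (n + i) + int (u + 2)))"
      using two_tri[of "int n"] two_tri[of "int (n + i) + int (u + 2)"] two_tri[of "int (Suc n)"]
        two_tri[of "int (Suc n + i) + int u"] by (simp add: algebra_simps)
    then have "(u + 1) + (tri (int (Suc n)) + Suc n * i + tri (int (Suc n + i) + int u))
        = tri (int n) + n * i + tri (int (n + i) + int (u + 2))"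
      by (simp only: of_nat_eq_iff)
    then show ?thesis unfolding f2_def Pmon_def by (rule mult_X_powers)
  qed
  have m1: "fps_X ^ (u + 1) * fsum UNIV (\<lambda>(n, i). f1 (int u) n i) = fsum UNIV (\<lambda>(n, i). f1 (int (u + 2)) (Suc n) i)"
    unfolding fsum_mult_left[OF fsum_rows(2)[of "f1 (int u)", OF r1(2) l1], symmetric]
    by (rule fsum_cong[OF refl]) (simp only: case_prod_unfold e1)
  have m2: "fps_X ^ (u + 1) * fsum UNIV (\<lambda>(n, i). f2 (int u) (Suc n) i) = fsum UNIV (\<lambda>(n, i). f2 (int (u + 2)) n i)"
    unfolding fsum_mult_left[OF l2, symmetric]
    by (rule fsum_cong[OF refl]) (simp only: case_prod_unfold e2)
  have "Xser (int u) = fsum UNIV (\<lambda>(n, i). f1 (int u) n i) + fsum UNIV (\<lambda>(n, i). f2 (int u) (Suc n) i)"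
    unfolding Xser_def W fsum_rows(1)[of "f1 (int u)", OF r1(2) l1] r1(1) by (rule add.assoc[symmetric])
  then have "fps_X ^ (u + 1) * Xser (int u) = fsum UNIV (\<lambda>(n, i). f1 (int (u + 2)) (Suc n) i) + fsum UNIV (\<lambda>(n, i). f2 (int (u + 2)) n i)"
    by (simp only: distrib_left m1 m2)
  also have "\<dots> = Xser (int (u + 2))"
    unfolding Xser_def W fsum_rows(1)[of "f2 (int (u + 2))", OF r2(2) l2] r2(1) by (rule add.left_commute)
  finally show ?thesis by (simp add: add.commute)
qed

lemma bij_int_add: "bij_betw (\<lambda>u::int. u + c) UNIV UNIV"
  by (rule bij_betwI[of _ _ _ "\<lambda>u. u - c"]) auto

lemma fsum_int_shift: "fsum UNIV (\<lambda>u::int. F (u + c)) = fsum UNIV F"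
  by (rule fsum_reindex_bij[OF bij_int_add, symmetric]) simp

lemma Appell_times_Theta:
  fixes E :: "int \<Rightarrow> 'a::comm_ring_1"
  assumes E: "\<And>s t. E (s + t) = E s * E t"
  shows "Appell E * Theta E = fsum UNIV (\<lambda>u. Wser u * fps_const (E (2 * u)))"
    and "lfin UNIV (\<lambda>u. Wser u * fps_const (E (2 * u)))"
proof -
  define P where "P = (\<lambda>x. Pmon (Suc (fst x)) (snd x) :: 'a fps)"
  define s where "s x = int (Suc (fst x + snd x))" for x :: "nat \<times> nat"
  have lP: "lfin UNIV (\<lambda>x. P x * fps_const (c x))" for c
    using lfin_Pmon[of "\<lambda>n i. fps_const (c (n, i))"] by (simp add: P_def case_prod_unfold)
  define F where "F e = (\<lambda>(x, l). P x * fps_const (E (e * (2 * s x + 1))) * (fps_const (E (2 * l + 1)) * fps_X ^ tri l))"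
    for e :: int
  define G where "G e = (\<lambda>(x, u). P x * (fps_X ^ tri (s x - e * u) * fps_const (E (2 * u))))" for e :: int
  have lF: "lfin (UNIV \<times> UNIV) (F e)" for e
    unfolding F_def by (rule lfin_times[OF lP lfin_Theta])
  \<comment> \<open>These substitutions \<open>l = u - 1 - s\<close> and \<open>l = u + s\<close>
    make the total exponent of \<open>E\<close> equal to \<open>2 u\<close>.\<close>
  have b1: "bij_betw (\<lambda>(x, u). (x, u - 1 - s x)) UNIV UNIV"
    by (rule bij_betwI[of _ _ _ "\<lambda>(x, l). (x, l + 1 + s x)"]) auto
  have b2: "bij_betw (\<lambda>(x, u). (x, u + s x)) UNIV UNIV"
    by (rule bij_betwI[of _ _ _ "\<lambda>(x, l). (x, l - s x)"]) auto
  have c1: "F 1 (case z of (x, u) \<Rightarrow> (x, u - 1 - s x)) = G 1 z" for z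
  proof -
    obtain x u where z: "z = (x, u)" by (cases z)
    have "E (2 * u) = E (1 * (2 * s x + 1)) * E (2 * (u - 1 - s x) + 1)"
      by (subst E[symmetric]) (simp add: algebra_simps)
    moreover have "tri (s x - 1 * u) = tri (u - 1 - s x)" by (rule tri_reflect') simp
    ultimately show ?thesis by (simp add: F_def G_def z mult_ac flip: fps_const_mult)
  qed
  have c2: "F (- 1) (case z of (x, u) \<Rightarrow> (x, u + s x)) = G (- 1) z" for z
  proof -
    obtain x u where z: "z = (x, u)" by (cases z)
    have "E (2 * u) = E (- 1 * (2 * s x + 1)) * E (2 * (u + s x) + 1)"
      by (subst E[symmetric]) (simp add: algebra_simps)
    then show ?thesis by (simp add: F_def G_def z mult_ac add.commute flip: fps_const_mult)
  qed
  have lG: "lfin UNIV (G 1)" "lfin UNIV (G (- 1))"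
    using lfin_reindex_bij[OF b1, of "F 1" "G 1"] lfin_reindex_bij[OF b2, of "F (- 1)" "G (- 1)"] lF c1 c2
    by auto
  have A: "Appell E = fsum UNIV (\<lambda>x. P x * fps_const (E (1 * (2 * s x + 1)))) + fsum UNIV (\<lambda>x. P x * fps_const (E (- 1 * (2 * s x + 1))))"
    unfolding fsum_add[OF lP lP, symmetric] Appell_def
    by (rule fsum_cong[OF refl]) (simp add: P_def s_def case_prod_unfold distrib_left flip: fps_const_add)
  have "Appell E * Theta E = fsum (UNIV \<times> UNIV) (F 1) + fsum (UNIV \<times> UNIV) (F (- 1))"
    unfolding A Theta_def F_def distrib_right by (simp only: fsum_times[OF lP lfin_Theta])
  also have "fsum (UNIV \<times> UNIV) (F 1) = fsum UNIV (G 1)"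
    unfolding UNIV_Times_UNIV by (rule fsum_reindex_bij[OF b1]) (rule c1)
  also have "fsum (UNIV \<times> UNIV) (F (- 1)) = fsum UNIV (G (- 1))"
    unfolding UNIV_Times_UNIV by (rule fsum_reindex_bij[OF b2]) (rule c2)
  also have "fsum UNIV (G 1) + fsum UNIV (G (- 1)) = fsum UNIV (\<lambda>z. G 1 z + G (- 1) z)"
    by (rule fsum_add[OF lG, symmetric])
  also have Geq: "(\<lambda>z. G 1 z + G (- 1) z) = (\<lambda>(x, u). fps_const (E (2 * u)) * (P x * (fps_X ^ tri (s x - u) + fps_X ^ tri (s x + u))))"
    by (auto simp: G_def fun_eq_iff algebra_simps)
  finally have 1: "Appell E * Theta E = fsum (UNIV \<times> UNIV) (\<lambda>(x, u). fps_const (E (2 * u)) * (P x * (fps_X ^ tri (s x - u) + fps_X ^ tri (s x + u))))"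
    by simp
  have l: "lfin (UNIV \<times> UNIV) (\<lambda>(x, u). fps_const (E (2 * u)) * (P x * (fps_X ^ tri (s x - u) + fps_X ^ tri (s x + u))))"
    using lfin_add[OF lG] by (simp add: Geq)
  have bs: "bij_betw prod.swap (UNIV \<times> UNIV) (UNIV \<times> UNIV)"
    by (auto simp: bij_betw_def inj_on_def)
  have l': "lfin (UNIV \<times> UNIV) (\<lambda>(u, x). fps_const (E (2 * u)) * (P x * (fps_X ^ tri (s x - u) + fps_X ^ tri (s x + u))))"
    using l by (subst lfin_reindex_bij[OF bs]) auto
  have W: "fsum UNIV (\<lambda>x. fps_const (E (2 * u)) * (P x * (fps_X ^ tri (s x - u) + fps_X ^ tri (s x + u)))) = Wser u * fps_const (E (2 * u))" for u
  proof -
    have "lfin UNIV (\<lambda>x. P x * (fps_X ^ tri (s x - u) + fps_X ^ tri (s x + u)))"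
      using lfin_Pmon[of "\<lambda>n i. fps_X ^ tri (int (Suc n + i) - u) + fps_X ^ tri (int (Suc n + i) + u)"]
      by (simp add: P_def s_def case_prod_unfold)
    from fsum_mult_left[OF this] show ?thesis
      by (simp add: Wser_def P_def s_def case_prod_unfold mult.commute)
  qed
  show "Appell E * Theta E = fsum UNIV (\<lambda>u. Wser u * fps_const (E (2 * u)))"
    unfolding 1 using fsum_Sigma(1)[OF l'] fsum_swap[OF l] fsum_Sigma(1)[OF l] by (simp only: W)
  show "lfin UNIV (\<lambda>u. Wser u * fps_const (E (2 * u)))"
    using fsum_Sigma(2)[OF l'] by (simp only: W)
qed

lemma lfin_Bser_const: "lfin UNIV (\<lambda>u. Bser (u + c) * fps_const (e u) :: 'a::comm_ring_1 fps)"
proof (rule lfinI[of _ "\<lambda>u. nat \<bar>u + c\<bar>"])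
  fix u :: int and k assume k: "k < nat \<bar>u + c\<bar>"
  have "fps_nth (Bser v :: 'a fps) j = 0" if "j < nat \<bar>v\<bar>" for j v
  proof -
    have "j < tri (\<bar>v\<bar> + int i)" for i
      using that tri_nat_ge[of "nat \<bar>v\<bar> + i"] by simp
    then show ?thesis
      unfolding Bser_def by (subst fsum_nth[of "{}"]) (auto simp: fps_nth_mult_X_power_low)
  qed
  then show "fps_nth (Bser (u + c) * fps_const (e u) :: 'a fps) k = 0" using k by simp
next
  fix n
  have "{u. nat \<bar>u + c\<bar> \<le> n} \<subseteq> {- int n - c..int n - c}" by auto
  then show "finite {u \<in> UNIV. nat \<bar>u + c\<bar> \<le> n}" by (simp add: finite_subset)
qed

text \<open>Multiplying the right-hand side by \<open>E 1 + E (- 1)\<close> adds neighbouring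
  coefficients, and \<open>Bser u + Bser (u + 1) = q^(tri u)\<close> extends to negative
  \<open>u\<close> by symmetry.\<close>

lemma const_times_Theta:
  fixes E :: "int \<Rightarrow> 'a::comm_ring_1"
  assumes E: "\<And>s t. E (s + t) = E s * E t" and d: "d * (E 1 + E (- 1)) = 1"
  shows "fps_const d * Theta E = fsum UNIV (\<lambda>u. Bser u * fps_const (E (2 * u)))"
proof -
  have BB: "Bser u + Bser (u + 1) = (fps_X ^ tri u :: 'a fps)" for u :: int
  proof (cases "u \<ge> 0")
    case True then show ?thesis by (rule Bser_add_Bser_Suc)
  next
    case False
    have "Bser (u + 1) = (Bser (- u - 1) :: 'a fps)" "Bser u = (Bser ((- u - 1) + 1) :: 'a fps)"
      using False by (simp_all add: Bser_def)
    moreover have "tri u = tri (- u - 1)" by (rule tri_reflect') simp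
    ultimately show ?thesis using Bser_add_Bser_Suc[of "- u - 1", where ?'a = 'a] False by (simp add: add.commute)
  qed
  have l0: "lfin UNIV (\<lambda>u. Bser u * fps_const (e u) :: 'a fps)" for e
    using lfin_Bser_const[of 0 e] by simp
  have "fps_const (E 1 + E (- 1)) * fsum UNIV (\<lambda>u. Bser u * fps_const (E (2 * u)))
      = fsum UNIV (\<lambda>u. fps_const (E 1) * (Bser u * fps_const (E (2 * u)))) + fsum UNIV (\<lambda>u. fps_const (E (- 1)) * (Bser u * fps_const (E (2 * u))))"
    by (simp only: fsum_mult_left[OF l0] distrib_right flip: fps_const_add)
  also have "fsum UNIV (\<lambda>u. fps_const (E 1) * (Bser u * fps_const (E (2 * u)))) = fsum UNIV (\<lambda>u. Bser u * fps_const (E (2 * u + 1)))"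
  proof (rule fsum_cong[OF refl])
    fix u
    show "fps_const (E 1) * (Bser u * fps_const (E (2 * u))) = Bser u * fps_const (E (2 * u + 1))"
      unfolding E[of "2 * u" 1] fps_const_mult[symmetric] by (simp only: mult_ac)
  qed
  also have "fsum UNIV (\<lambda>u. fps_const (E (- 1)) * (Bser u * fps_const (E (2 * u)))) = fsum UNIV (\<lambda>u. Bser (u + 1) * fps_const (E (2 * u + 1)))"
    unfolding fsum_int_shift[of "\<lambda>u. fps_const (E (- 1)) * (Bser u * fps_const (E (2 * u)))" 1, symmetric]
  proof (rule fsum_cong[OF refl])
    fix u
    have e: "E (2 * u + 1) = E (2 * (u + 1)) * E (- 1)"
      by (subst E[symmetric]) (simp add: algebra_simps)
    show "fps_const (E (- 1)) * (Bser (u + 1) * fps_const (E (2 * (u + 1)))) = Bser (u + 1) * fps_const (E (2 * u + 1))"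
      unfolding e fps_const_mult[symmetric] by (simp only: mult_ac)
  qed
  also have "fsum UNIV (\<lambda>u. Bser u * fps_const (E (2 * u + 1))) + fsum UNIV (\<lambda>u. Bser (u + 1) * fps_const (E (2 * u + 1))) = Theta E"
    unfolding Theta_def
    by (subst fsum_add[OF l0 lfin_Bser_const, symmetric], rule fsum_cong) (auto simp: mult.commute simp flip: BB distrib_right)
  finally have "fps_const d * (fps_const (E 1 + E (- 1)) * fsum UNIV (\<lambda>u. Bser u * fps_const (E (2 * u)))) = fps_const d * Theta E"
    by simp
  then show ?thesis using d by (simp flip: mult.assoc)
qed

text \<open>The steps of size 2 contribute \<open>1 + 3 + ... + (2 k - 1) = k^2\<close>; for odd
  indices, below, \<open>2 + 4 + ... + 2 k\<close>.\<close>

lemma Xser_even: "Xser (2 * int k) = fps_X ^ (k ^ 2) * (Xser 0 :: 'a::comm_ring_1 fps)"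
proof (induction k)
  case (Suc k)
  have "Xser (2 * int (Suc k)) = (Xser (int (2 * k) + 2) :: 'a fps)" by (simp add: algebra_simps)
  also have "\<dots> = fps_X ^ (2 * k + 1) * Xser (2 * int k)" using Xser_add_2[of "2 * k", where ?'a = 'a] by simp
  also have "\<dots> = fps_X ^ ((2 * k + 1) + k ^ 2) * Xser 0" unfolding Suc.IH power_add by (simp only: mult.assoc)
  also have "(2 * k + 1) + k ^ 2 = (Suc k) ^ 2" by (simp add: power2_eq_square)
  finally show ?case .
qed simp

lemma Xser_odd: "Xser (2 * int k + 1) = fps_X ^ (2 * tri (int k)) * (Xser 1 :: 'a::comm_ring_1 fps)"
proof (induction k)
  case (Suc k)
  have "Xser (2 * int (Suc k) + 1) = (Xser (int (2 * k + 1) + 2) :: 'a fps)" by (simp add: algebra_simps)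
  also have "\<dots> = fps_X ^ ((2 * k + 1) + 1) * Xser (2 * int k + 1)" using Xser_add_2[of "2 * k + 1", where ?'a = 'a] by (simp add: add.commute)
  also have "\<dots> = fps_X ^ (((2 * k + 1) + 1) + 2 * tri (int k)) * Xser 1" unfolding Suc.IH power_add by (simp only: mult.assoc)
  also have "((2 * k + 1) + 1) + 2 * tri (int k) = 2 * tri (int (Suc k))" using tri_add_1[of k] by (simp add: add.commute)
  finally show ?case .
qed simp

lemma Wser_minus: "Wser (- u) = Wser u"
  unfolding Wser_def by (rule fsum_cong[OF refl]) (simp add: case_prod_unfold add.commute)

lemma Xser_minus: "Xser (- u) = Xser u"
  unfolding Xser_def Wser_minus by (simp add: Bser_def)

lemma Xser_even': "Xser (2 * k) = fps_X ^ nat (k\<^sup>2) * (Xser 0 :: 'a::comm_ring_1 fps)"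
proof -
  have "Xser (2 * k) = (Xser (2 * int (nat \<bar>k\<bar>)) :: 'a fps)"
    using Xser_minus[of "2 * k", where ?'a = 'a] by (cases "k \<ge> 0") auto
  also have "\<dots> = fps_X ^ (nat \<bar>k\<bar> ^ 2) * Xser 0" by (rule Xser_even)
  also have "nat \<bar>k\<bar> ^ 2 = nat (k\<^sup>2)" by (simp flip: nat_power_eq)
  finally show ?thesis .
qed

lemma Xser_odd': "Xser (2 * k + 1) = fps_X ^ (2 * tri k) * (Xser 1 :: 'a::comm_ring_1 fps)"
proof (cases "k \<ge> 0")
  case True
  then show ?thesis using Xser_odd[of "nat k"] by simp
next
  case False
  have "Xser (2 * k + 1) = (Xser (2 * int (nat (- 1 - k)) + 1) :: 'a fps)"
    using Xser_minus[of "2 * k + 1", where ?'a = 'a] False by (simp add: algebra_simps)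
  moreover have "tri (int (nat (- 1 - k))) = tri k" using False by (intro tri_reflect') simp
  ultimately show ?thesis by (simp only: Xser_odd)
qed

lemma fsum_int_parity:
  assumes "lfin UNIV F"
  shows "fsum UNIV F = fsum UNIV (\<lambda>k::int. F (2 * k)) + fsum UNIV (\<lambda>k. F (2 * k + 1))"
proof -
  have b: "bij_betw (\<lambda>k::int. 2 * k) UNIV {u. even u}" "bij_betw (\<lambda>k::int. 2 * k + 1) UNIV {u. odd u}"
    by (rule bij_betwI[of _ _ _ "\<lambda>u. u div 2"]; auto)+
  have "fsum UNIV F = fsum ({u. even u} \<union> {u. odd u}) F" by (rule fsum_cong) auto
  also have "\<dots> = fsum {u. even u} F + fsum {u. odd u} F"
    by (rule fsum_Un_disjoint) (use assms lfin_subset in auto)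
  finally show ?thesis
    using fsum_reindex_bij[OF b(1), of F "\<lambda>k. F (2 * k)"] fsum_reindex_bij[OF b(2), of F "\<lambda>k. F (2 * k + 1)"] by simp
qed

lemma finite_nat_square_le: "finite {k::int. nat (k\<^sup>2) \<le> n}"
proof (rule finite_subset)
  show "{k::int. nat (k\<^sup>2) \<le> n} \<subseteq> {- int n..int n}"
  proof
    fix k :: int assume "k \<in> {k. nat (k\<^sup>2) \<le> n}"
    then have "k\<^sup>2 \<le> int n" by auto
    moreover have "\<bar>k\<bar> \<le> k\<^sup>2"
      using mult_left_mono[of 1 "\<bar>k\<bar>" "\<bar>k\<bar>"] by (cases "k = 0") (auto simp: power2_eq_square)
    ultimately show "k \<in> {- int n..int n}" by auto
  qed
qed simp

lemma lfin_theta_even: "lfin UNIV (\<lambda>k::int. c k * fps_X ^ nat (k\<^sup>2) :: 'a::comm_ring_1 fps)"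
  by (rule lfin_X_power) (use finite_nat_square_le in auto)

lemma lfin_theta_odd: "lfin UNIV (\<lambda>k::int. c k * fps_X ^ (2 * tri k) :: 'a::comm_ring_1 fps)"
proof (rule lfin_X_power)
  fix n
  have "{k::int. 2 * tri k \<le> n} \<subseteq> {k. tri (k + 0) \<le> n}" by auto
  then show "finite {k \<in> UNIV. 2 * tri k \<le> n}" using finite_tri_le[of 0 n] by (simp add: finite_subset)
qed

theorem Appell_Theta:
  fixes E :: "int \<Rightarrow> 'a::comm_ring_1"
  assumes E: "\<And>s t. E (s + t) = E s * E t" and d: "d * (E 1 + E (- 1)) = 1"
  shows "(fps_const d + Appell E) * Theta E = Xser 0 * theta_even E + Xser 1 * theta_odd E"
proof -
  have l: "lfin UNIV (\<lambda>u. Bser u * fps_const (E (2 * u)))" "lfin UNIV (\<lambda>u. Wser u * fps_const (E (2 * u)))"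
    using lfin_Bser_const[of 0 "\<lambda>u. E (2 * u)"] Appell_times_Theta(2)[OF E] by simp_all
  have eq: "(\<lambda>u. Xser u * fps_const (E (2 * u))) = (\<lambda>u. Bser u * fps_const (E (2 * u)) + Wser u * fps_const (E (2 * u)))"
    by (simp add: Xser_def distrib_right)
  have lX: "lfin UNIV (\<lambda>u. Xser u * fps_const (E (2 * u)))"
    unfolding eq by (rule lfin_add[OF l])
  have "(fps_const d + Appell E) * Theta E = fsum UNIV (\<lambda>u. Xser u * fps_const (E (2 * u)))"
    unfolding eq distrib_right[of "fps_const d"] Appell_times_Theta(1)[OF E] const_times_Theta[OF E d] fsum_add[OF l] ..
  also have "\<dots> = fsum UNIV (\<lambda>k. Xser (2 * k) * fps_const (E (2 * (2 * k)))) + fsum UNIV (\<lambda>k. Xser (2 * k + 1) * fps_const (E (2 * (2 * k + 1))))"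
    by (rule fsum_int_parity[OF lX])
  also have "fsum UNIV (\<lambda>k. Xser (2 * k) * fps_const (E (2 * (2 * k)))) = Xser 0 * theta_even E"
    unfolding theta_even_def fsum_mult_left[OF lfin_theta_even, symmetric] Xser_even'
    by (rule fsum_cong[OF refl]) (simp add: mult_ac)
  also have "fsum UNIV (\<lambda>k. Xser (2 * k + 1) * fps_const (E (2 * (2 * k + 1)))) = Xser 1 * theta_odd E"
    unfolding theta_odd_def fsum_mult_left[OF lfin_theta_odd, symmetric] Xser_odd'
    by (rule fsum_cong[OF refl]) (simp add: mult_ac distrib_left)
  finally show ?thesis .
qed

subsection \<open>Squares of theta functions and Jacobi's series\<close>

lemma fps_const_minus_one: "fps_const (- 1) = (- 1 :: 'a::comm_ring_1 fps)"
  by (simp flip: fps_const_neg)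

definition par_sign :: "int \<Rightarrow> 'a::comm_ring_1" where
  "par_sign u = (if even u then 1 else - 1)"

text \<open>The twist \<open>\<sigma>\<close> lets one computation of the square serve both the
  plain and the alternating theta function.\<close>

definition Theta_tw :: "(int \<Rightarrow> 'a) \<Rightarrow> (int \<Rightarrow> 'a::comm_ring_1) \<Rightarrow> 'a fps" where
  "Theta_tw \<sigma> E = fsum UNIV (\<lambda>l. fps_const (\<sigma> l * E (2 * l + 1)) * fps_X ^ tri l)"

lemma Theta_eq_tw: "Theta E = Theta_tw (\<lambda>_. 1) E"
  by (simp add: Theta_def Theta_tw_def)

text \<open>Pairs \<open>(l, m)\<close> are written as \<open>(k + j, k - j)\<close> or
  \<open>(k + j, k - 1 - j)\<close> by the parity of \<open>l + m\<close>. The exponents add up to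
  \<open>2 tri k + j^2\<close> resp. \<open>k^2 + 2 tri j\<close>, which separates \<open>k\<close>
  from \<open>j\<close>; the conditions on \<open>\<sigma>\<close> make the sign constant on each
  class.\<close>

lemma Theta_tw_square:
  fixes E \<sigma> :: "int \<Rightarrow> 'a::comm_ring_1"
  assumes E: "\<And>s t. E (s + t) = E s * E t"
    and \<sigma>0: "\<And>k j. \<sigma> (k + j) * \<sigma> (k - j) = 1" and \<sigma>1: "\<And>k j. \<sigma> (k + j) * \<sigma> (k - 1 - j) = e"
  shows "Theta_tw \<sigma> E ^ 2 = fps_const e * theta_even E * theta_odd (\<lambda>_. 1) + theta_odd E * theta_even (\<lambda>_. 1)"
proof -
  define F where "F = (\<lambda>(l, m). (fps_const (\<sigma> l * E (2 * l + 1)) * fps_X ^ tri l) * (fps_const (\<sigma> m * E (2 * m + 1)) * fps_X ^ tri m))"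
  have lF: "lfin (UNIV \<times> UNIV) F" unfolding F_def by (rule lfin_times[OF lfin_Theta lfin_Theta])
  have b0: "bij_betw (\<lambda>(k, j). (k + j, k - j)) (UNIV \<times> UNIV) {(l::int, m). even (l + m)}"
    by (rule bij_betwI[of _ _ _ "\<lambda>(l, m). ((l + m) div 2, (l - m) div 2)"]) (clarsimp; presburger)+
  have b1: "bij_betw (\<lambda>(k, j). (k + j, k - 1 - j)) (UNIV \<times> UNIV) {(l::int, m). odd (l + m)}"
    by (rule bij_betwI[of _ _ _ "\<lambda>(l, m). ((l + m + 1) div 2, (l - m - 1) div 2)"]) (clarsimp; presburger)+
  have F0: "F (case z of (k, j) \<Rightarrow> (k + j, k - j)) = (\<lambda>(k, j). (fps_const (E (4 * k + 2)) * fps_X ^ (2 * tri k)) * (fps_const 1 * fps_X ^ nat (j\<^sup>2))) z" for z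
  proof (cases z)
    case (Pair k j)
    have e: "E (4 * k + 2) = E (2 * (k + j) + 1) * E (2 * (k - j) + 1)" by (subst E[symmetric]) (simp add: algebra_simps)
    have "int (tri (k + j) + tri (k - j)) = int (2 * tri k + nat (j\<^sup>2))"
      using two_tri[of "k + j"] two_tri[of "k - j"] two_tri[of k] by (simp add: algebra_simps power2_eq_square)
    then have t: "tri (k + j) + tri (k - j) = 2 * tri k + nat (j\<^sup>2)" by (simp only: of_nat_eq_iff)
    have "F (k + j, k - j) = fps_const (\<sigma> (k + j) * \<sigma> (k - j) * (E (2 * (k + j) + 1) * E (2 * (k - j) + 1))) * fps_X ^ (tri (k + j) + tri (k - j))"
      by (simp add: F_def power_add mult_ac flip: fps_const_mult)
    also have "\<dots> = fps_const (E (4 * k + 2)) * fps_X ^ (2 * tri k + nat (j\<^sup>2))"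
      unfolding \<sigma>0 e[symmetric] t by simp
    finally show ?thesis by (simp add: Pair power_add mult_ac)
  qed
  have F1: "F (case z of (k, j) \<Rightarrow> (k + j, k - 1 - j)) = (\<lambda>(k, j). (fps_const e * (fps_const (E (4 * k)) * fps_X ^ nat (k\<^sup>2))) * (fps_const 1 * fps_X ^ (2 * tri j))) z" for z
  proof (cases z)
    case (Pair k j)
    have e: "E (4 * k) = E (2 * (k + j) + 1) * E (2 * (k - 1 - j) + 1)" by (subst E[symmetric]) (simp add: algebra_simps)
    have "int (tri (k + j) + tri (k - 1 - j)) = int (nat (k\<^sup>2) + 2 * tri j)"
      using two_tri[of "k + j"] two_tri[of "k - 1 - j"] two_tri[of j] by (simp add: algebra_simps power2_eq_square)
    then have t: "tri (k + j) + tri (k - 1 - j) = nat (k\<^sup>2) + 2 * tri j" by (simp only: of_nat_eq_iff)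
    have "F (k + j, k - 1 - j) = fps_const (\<sigma> (k + j) * \<sigma> (k - 1 - j) * (E (2 * (k + j) + 1) * E (2 * (k - 1 - j) + 1))) * fps_X ^ (tri (k + j) + tri (k - 1 - j))"
      by (simp add: F_def power_add mult_ac flip: fps_const_mult)
    also have "\<dots> = fps_const e * fps_const (E (4 * k)) * fps_X ^ (nat (k\<^sup>2) + 2 * tri j)"
      unfolding \<sigma>1 e[symmetric] t by simp
    finally show ?thesis by (simp add: Pair power_add mult_ac flip: fps_const_mult)
  qed
  have "Theta_tw \<sigma> E ^ 2 = fsum (UNIV \<times> UNIV) F"
    unfolding power2_eq_square Theta_tw_def F_def by (rule fsum_times[OF lfin_Theta lfin_Theta])
  also have "\<dots> = fsum ({(l, m). even (l + m)} \<union> {(l, m). odd (l + m)}) F"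
    by (rule fsum_cong) auto
  also have "\<dots> = fsum {(l, m). even (l + m)} F + fsum {(l, m). odd (l + m)} F"
    by (rule fsum_Un_disjoint) (use lF lfin_subset in auto)
  also have "fsum {(l, m). even (l + m)} F = theta_odd E * theta_even (\<lambda>_. 1)"
    unfolding theta_odd_def theta_even_def fsum_times[OF lfin_theta_odd lfin_theta_even]
    by (rule fsum_reindex_bij[OF b0]) (rule F0)
  also have "fsum {(l, m). odd (l + m)} F = (fps_const e * theta_even E) * theta_odd (\<lambda>_. 1)"
    unfolding theta_odd_def theta_even_def fsum_mult_left[OF lfin_theta_even, symmetric]
      fsum_times[OF lfin_mult_left[OF lfin_theta_even] lfin_theta_odd]
    by (rule fsum_reindex_bij[OF b1]) (rule F1)
  finally show ?thesis by simp
qed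

lemma Theta_square:
  assumes "\<And>s t. E (s + t) = E s * (E t :: 'a::comm_ring_1)"
  shows "Theta E ^ 2 = theta_even E * theta_odd (\<lambda>_. 1) + theta_odd E * theta_even (\<lambda>_. 1)"
  using Theta_tw_square[of E "\<lambda>_. 1" 1] assms by (simp add: Theta_eq_tw)

lemma Theta_sign_square:
  assumes "\<And>s t. E (s + t) = E s * (E t :: 'a::comm_ring_1)"
  shows "Theta_tw par_sign E ^ 2 = theta_odd E * theta_even (\<lambda>_. 1) - theta_even E * theta_odd (\<lambda>_. 1)"
  using Theta_tw_square[of E par_sign "- 1"] assms by (simp add: par_sign_def fps_const_minus_one)

lemma fsum_int_fold:
  assumes "lfin UNIV F"
  shows "fsum UNIV F = fsum UNIV (\<lambda>j::nat. F (int j)) + fsum UNIV (\<lambda>j::nat. F (- 1 - int j))"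
proof -
  have b0: "bij_betw int UNIV {l. l \<ge> 0}"
    by (rule bij_betwI[of _ _ _ nat]) auto
  have b1: "bij_betw (\<lambda>j. - 1 - int j) UNIV {l. l < 0}"
    by (rule bij_betwI[of _ _ _ "\<lambda>l. nat (- 1 - l)"]) auto
  have "fsum UNIV F = fsum ({l. l \<ge> 0} \<union> {l. l < 0}) F" by (rule fsum_cong) auto
  also have "\<dots> = fsum {l. l \<ge> 0} F + fsum {l. l < 0} F"
    by (rule fsum_Un_disjoint) (use assms lfin_subset in auto)
  finally show ?thesis
    using fsum_reindex_bij[OF b0, of F "\<lambda>j. F (int j)"] fsum_reindex_bij[OF b1, of F "\<lambda>j. F (- 1 - int j)"] by simp
qed

lemma par_sign_theta_eq_0: "fsum UNIV (\<lambda>l. fps_const (par_sign l) * fps_X ^ tri l) = (0 :: 'a::comm_ring_1 fps)"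
proof -
  have "fps_const (par_sign (- 1 - int j)) * fps_X ^ tri (- 1 - int j) = - (fps_const (par_sign (int j)) * fps_X ^ tri (int j) :: 'a fps)" for j
    by (simp add: tri_reflect par_sign_def flip: fps_const_neg)
  then have "fsum UNIV (\<lambda>j. fps_const (par_sign (- 1 - int j)) * fps_X ^ tri (- 1 - int j))
      = - fsum UNIV (\<lambda>j. fps_const (par_sign (int j)) * fps_X ^ tri (int j) :: 'a fps)"
    unfolding fsum_uminus[symmetric] by (intro fsum_cong refl)
  then show ?thesis
    by (subst fsum_int_fold[OF lfin_Theta]) simp
qed

definition jacobi_cube :: "'a::comm_ring_1 fps" where
  "jacobi_cube = fsum UNIV (\<lambda>j::nat. fps_const ((- 1) ^ j * of_nat (2 * j + 1)) * fps_X ^ tri (int j))"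

text \<open>For fixed \<open>(n, i)\<close> the sum over \<open>u\<close> of
  \<open>(-1)^u q^(tri (u + c))\<close> vanishes, since \<open>l\<close> and \<open>- 1 - l\<close>
  carry opposite signs. The work is in the local finiteness that allows the exchange of the
  sums.\<close>

lemma signed_Wser: "fsum UNIV (\<lambda>u. fps_const (par_sign u) * Wser u) = (0 :: 'a::comm_ring_1 fps)"
proof -
  define P where "P = (\<lambda>x. Pmon (Suc (fst x)) (snd x) :: 'a fps)"
  define s where "s x = int (Suc (fst x + snd x))" for x :: "nat \<times> nat"
  define ex where "ex x = tri (int (Suc (fst x))) + Suc (fst x) * snd x" for x
  define G where "G e = (\<lambda>(x, u). fps_const (par_sign u) * (P x * fps_X ^ tri (s x + e * u)))" for e :: int
  have l: "lfin UNIV (G e)" if e: "e = 1 \<or> e = - 1" for e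
  proof -
    have "lfin UNIV (\<lambda>z. (fps_const (par_sign (snd z)) * (- 1) ^ (snd (fst z))) * fps_X ^ (ex (fst z) + tri (s (fst z) + e * snd z)) :: 'a fps)"
    proof (rule lfin_X_power)
      fix n
      have f1: "finite {x. ex x \<le> n}" using finite_Pmon_index[of n] by (simp add: ex_def case_prod_unfold)
      have f2: "finite {u. tri (s x + e * u) \<le> n}" for x
        using e
      proof (elim disjE)
        assume "e = - 1"
        have "tri (s x + e * u) = tri (u + (- 1 - s x))" for u
          unfolding \<open>e = - 1\<close> by (rule tri_reflect') simp
        then show ?thesis using finite_tri_le[of "- 1 - s x" n] by simp
      qed (use finite_tri_le[of "s x" n] in \<open>simp add: add.commute\<close>)
      have "{z. ex (fst z) + tri (s (fst z) + e * snd z) \<le> n} \<subseteq> Sigma {x. ex x \<le> n} (\<lambda>x. {u. tri (s x + e * u) \<le> n})"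
        by auto
      then show "finite {z \<in> UNIV. ex (fst z) + tri (s (fst z) + e * snd z) \<le> n}"
        using finite_subset[OF _ finite_SigmaI[OF f1 f2, of "\<lambda>x. x"]] by simp
    qed
    moreover have "G e = (\<lambda>z. (fps_const (par_sign (snd z)) * (- 1) ^ (snd (fst z))) * fps_X ^ (ex (fst z) + tri (s (fst z) + e * snd z)))"
      by (simp add: G_def P_def Pmon_def ex_def fun_eq_iff power_add mult_ac)
    ultimately show ?thesis by simp
  qed
  define H where "H = (\<lambda>x u. fps_const (par_sign u) * (P x * (fps_X ^ tri (s x - u) + fps_X ^ tri (s x + u))))"
  have H: "(\<lambda>(x, u). H x u) = (\<lambda>z. G (- 1) z + G 1 z)"
    by (auto simp: H_def G_def fun_eq_iff algebra_simps)
  have lH: "lfin (UNIV \<times> UNIV) (\<lambda>(x, u). H x u)"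
    unfolding H using lfin_add[OF l l] by simp
  have row: "fsum UNIV (H x) = 0" for x
  proof -
    have z: "fsum UNIV (\<lambda>u. fps_const (par_sign u) * fps_X ^ tri (u + c)) = (0 :: 'a fps)"
      and lz: "lfin UNIV (\<lambda>u. fps_const (par_sign u) * fps_X ^ tri (u + c) :: 'a fps)" for c
    proof -
      have "fps_const (par_sign u) * fps_X ^ tri (u + c) = fps_const (par_sign c) * (fps_const (par_sign (u + c)) * fps_X ^ tri (u + c) :: 'a fps)" for u
        by (auto simp: par_sign_def fps_const_minus_one)
      then have "fsum UNIV (\<lambda>u. fps_const (par_sign u) * fps_X ^ tri (u + c)) = fsum UNIV (\<lambda>u. fps_const (par_sign c) * (fps_const (par_sign (u + c)) * fps_X ^ tri (u + c)) :: 'a fps)"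
        by (intro fsum_cong refl)
      then show "fsum UNIV (\<lambda>u. fps_const (par_sign u) * fps_X ^ tri (u + c)) = (0 :: 'a fps)"
        using fsum_int_shift[of "\<lambda>u. fps_const (par_sign c) * (fps_const (par_sign u) * fps_X ^ tri u) :: 'a fps" c]
        by (simp add: fsum_mult_left[OF lfin_Theta] par_sign_theta_eq_0)
      show "lfin UNIV (\<lambda>u. fps_const (par_sign u) * fps_X ^ tri (u + c) :: 'a fps)"
        by (rule lfin_X_power) (use finite_tri_le in auto)
    qed
    have t: "tri (s x - u) = tri (u + (- 1 - s x))" for u by (rule tri_reflect') simp
    have "H x = (\<lambda>u. P x * (fps_const (par_sign u) * fps_X ^ tri (u + (- 1 - s x))) + P x * (fps_const (par_sign u) * fps_X ^ tri (u + s x)))"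
      by (simp add: H_def t fun_eq_iff algebra_simps)
    then show ?thesis
      by (simp only: fsum_add[OF lfin_mult_left[OF lz] lfin_mult_left[OF lz]] fsum_mult_left[OF lz] z) simp
  qed
  have col: "fsum UNIV (\<lambda>x. H x u) = fps_const (par_sign u) * Wser u" for u
  proof -
    have "lfin UNIV (\<lambda>x. P x * (fps_X ^ tri (s x - u) + fps_X ^ tri (s x + u)))"
      using lfin_Pmon[of "\<lambda>n i. fps_X ^ tri (int (Suc n + i) - u) + fps_X ^ tri (int (Suc n + i) + u)"]
      by (simp add: P_def s_def case_prod_unfold)
    from fsum_mult_left[OF this] show ?thesis
      by (simp add: H_def Wser_def P_def s_def case_prod_unfold)
  qed
  show ?thesis using fsum_swap[OF lH] by (simp add: row col)
qed

text \<open>Grouping by \<open>j = |u| + i\<close> gives the common sign \<open>(-1)^j\<close>, the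
  exponent \<open>tri j\<close> and the \<open>2 j + 1\<close> values
  \<open>u = - j, ..., j\<close>.\<close>

lemma signed_Bser: "fsum UNIV (\<lambda>u. fps_const (par_sign u) * Bser u) = (jacobi_cube :: 'a::comm_ring_1 fps)"
proof -
  define F where "F = (\<lambda>(u::int, i::nat). (fps_const (par_sign u) * (- 1) ^ i) * fps_X ^ tri (\<bar>u\<bar> + int i) :: 'a fps)"
  have lF: "lfin UNIV F"
  proof -
    have fin: "finite {z :: int \<times> nat. tri (\<bar>fst z\<bar> + int (snd z)) \<le> n}" for n
    proof (rule finite_subset)
      show "{z :: int \<times> nat. tri (\<bar>fst z\<bar> + int (snd z)) \<le> n} \<subseteq> {- int n..int n} \<times> {..n}"
      proof
        fix z :: "int \<times> nat" assume "z \<in> {z. tri (\<bar>fst z\<bar> + int (snd z)) \<le> n}"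
        then have "nat \<bar>fst z\<bar> + snd z \<le> n" using tri_nat_ge[of "nat \<bar>fst z\<bar> + snd z"] by simp
        then show "z \<in> {- int n..int n} \<times> {..n}" by (cases z) auto
      qed
    qed simp
    show ?thesis unfolding F_def case_prod_unfold by (rule lfin_X_power) (use fin in simp)
  qed
  have b: "bij_betw (\<lambda>(u, i). (nat \<bar>u\<bar> + i, u)) UNIV (Sigma UNIV (\<lambda>j. {- int j..int j}))"
    by (rule bij_betwI[of _ _ _ "\<lambda>(j, u). (u, j - nat \<bar>u\<bar>)"]) auto
  define G where "G = (\<lambda>j (u::int). fps_const ((- 1) ^ j) * fps_X ^ tri (int j) :: 'a fps)"
  have GF: "(\<lambda>(j, u). G j u) (case z of (u, i) \<Rightarrow> (nat \<bar>u\<bar> + i, u)) = F z" for z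
  proof (cases z)
    case (Pair u i)
    have "(- 1) ^ nat \<bar>u\<bar> = (fps_const (par_sign u) :: 'a fps)"
      by (simp add: par_sign_def minus_one_power_iff even_nat_iff fps_const_minus_one)
    then show ?thesis by (simp add: Pair F_def G_def power_add fps_const_minus_one flip: fps_const_mult fps_const_power)
  qed
  have lG: "lfin (Sigma UNIV (\<lambda>j. {- int j..int j})) (\<lambda>(j, u). G j u)"
    using lfin_reindex_bij[OF b, of "\<lambda>(j, u). G j u" F] GF lF by simp
  have "fsum UNIV (\<lambda>u. fps_const (par_sign u) * Bser u) = fsum UNIV (\<lambda>u. fsum UNIV (\<lambda>i. F (u, i)))"
  proof (rule fsum_cong[OF refl])
    fix u :: int
    have "lfin UNIV (\<lambda>i::nat. (- 1) ^ i * fps_X ^ tri (\<bar>u\<bar> + int i) :: 'a fps)"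
      using lfin_Bser[of "\<bar>u\<bar>", where ?'a = 'a] by (simp add: add.commute)
    from fsum_mult_left[OF this, of "fps_const (par_sign u)"]
    show "fps_const (par_sign u) * Bser u = fsum UNIV (\<lambda>i. F (u, i))"
      by (simp add: Bser_def F_def mult.assoc)
  qed
  also have "\<dots> = fsum UNIV F"
    using fsum_Sigma(1)[of UNIV "\<lambda>_. UNIV" "\<lambda>u i. F (u, i)"] lF by simp
  also have "\<dots> = fsum (Sigma UNIV (\<lambda>j. {- int j..int j})) (\<lambda>(j, u). G j u)"
    by (rule fsum_reindex_bij[OF b, symmetric]) (rule GF)
  also have "\<dots> = fsum UNIV (\<lambda>j. fsum {- int j..int j} (G j))"
    by (rule fsum_Sigma(1)[OF lG])
  also have "\<dots> = jacobi_cube"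
    unfolding jacobi_cube_def
  proof (rule fsum_cong[OF refl])
    fix j :: nat
    have "nat (1 + 2 * int j) = 2 * j + 1" by simp
    then show "fsum {- int j..int j} (G j) = fps_const ((- 1) ^ j * of_nat (2 * j + 1)) * fps_X ^ tri (int j)"
      by (subst fsum_finite) (simp_all add: G_def mult_ac add.commute flip: fps_const_mult fps_of_nat fps_const_add)
  qed
  finally show ?thesis .
qed

text \<open>Formally this is \<open>Appell_Theta\<close> at \<open>z^2 = - 1\<close>, where
  \<open>E (2 u) = (-1)^u\<close>: theta vanishes there and cancels the pole of the term of index 0.
  The signed sum of \<open>Xser\<close> is evaluated once through \<open>Bser\<close> and
  \<open>Wser\<close> and once by the parity of \<open>u\<close>.\<close>

theorem Xser_signed: "Xser 0 * theta_even (\<lambda>_. 1) - Xser 1 * theta_odd (\<lambda>_. 1) = (jacobi_cube :: 'a::comm_ring_1 fps)"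
proof -
  have lB: "lfin UNIV (\<lambda>u. fps_const (c u) * Bser u :: 'a fps)" for c
    using lfin_Bser_const[of 0 c] by (simp add: mult.commute)
  have lW: "lfin UNIV (\<lambda>u. fps_const (par_sign u) * Wser u :: 'a fps)"
  proof -
    have "lfin UNIV (\<lambda>u. Wser u * fps_const 1 :: 'a fps)"
      using Appell_times_Theta(2)[of "\<lambda>_. 1 :: 'a"] by simp
    then show ?thesis unfolding lfin_def by (elim all_forward) (simp add: par_sign_def)
  qed
  have lX: "lfin UNIV (\<lambda>u. fps_const (par_sign u) * Xser u :: 'a fps)"
    unfolding Xser_def distrib_left by (rule lfin_add[OF lB lW])
  have "jacobi_cube = fsum UNIV (\<lambda>u. fps_const (par_sign u) * Xser u :: 'a fps)"
    unfolding Xser_def distrib_left fsum_add[OF lB lW] signed_Wser signed_Bser by simp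
  also have "\<dots> = fsum UNIV (\<lambda>k. Xser 0 * (fps_const 1 * fps_X ^ nat (k\<^sup>2))) + fsum UNIV (\<lambda>k. - Xser 1 * (fps_const 1 * fps_X ^ (2 * tri k)))"
    by (subst fsum_int_parity[OF lX]) (simp only: Xser_even' Xser_odd' par_sign_def, simp add: fps_const_minus_one mult_ac)
  also have "\<dots> = Xser 0 * theta_even (\<lambda>_. 1) + - Xser 1 * theta_odd (\<lambda>_. 1)"
    unfolding theta_even_def theta_odd_def fsum_mult_left[OF lfin_theta_even] fsum_mult_left[OF lfin_theta_odd] ..
  finally show ?thesis by simp
qed

subsection \<open>Taylor expansion in the elliptic variable\<close>

text \<open>
  In \<open>rat fps fps\<close> the outer variable is \<open>q\<close> and the inner one is \<open>w\<close>: \<open>wcoeff k\<close> extracts the coefficient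
  of \<open>w^k\<close>, and \<open>wconst\<close> embeds the series that do not depend on \<open>w\<close>.
\<close>

definition wcoeff :: "nat \<Rightarrow> 'a::comm_ring_1 fps fps \<Rightarrow> 'a fps" where
  "wcoeff k F = Abs_fps (\<lambda>n. fps_nth (fps_nth F n) k)"

definition wconst :: "'a::comm_ring_1 fps \<Rightarrow> 'a fps fps" where
  "wconst F = Abs_fps (\<lambda>n. fps_const (fps_nth F n))"

lemma wcoeff_nth [simp]: "fps_nth (wcoeff k F) n = fps_nth (fps_nth F n) k"
  by (simp add: wcoeff_def)

lemma wconst_nth [simp]: "fps_nth (wconst F) n = fps_const (fps_nth F n)"
  by (simp add: wconst_def)

lemma wcoeff_add: "wcoeff k (F + G) = wcoeff k F + wcoeff k G"
  by (rule fps_ext) simp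

lemma wcoeff_diff: "wcoeff k (F - G) = wcoeff k F - wcoeff k G"
  by (rule fps_ext) simp

lemma wcoeff_mult: "wcoeff k (F * G) = (\<Sum>j\<le>k. wcoeff j F * wcoeff (k - j) G)"
proof (rule fps_ext)
  fix n
  have "fps_nth (wcoeff k (F * G)) n = (\<Sum>i=0..n. \<Sum>j=0..k. fps_nth (fps_nth F i) j * fps_nth (fps_nth G (n - i)) (k - j))"
    by (simp add: fps_mult_nth fps_sum_nth)
  also have "\<dots> = (\<Sum>j=0..k. \<Sum>i=0..n. fps_nth (fps_nth F i) j * fps_nth (fps_nth G (n - i)) (k - j))"
    by (rule sum.swap)
  finally show "fps_nth (wcoeff k (F * G)) n = fps_nth (\<Sum>j\<le>k. wcoeff j F * wcoeff (k - j) G) n"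
    by (simp add: fps_sum_nth fps_mult_nth atLeast0AtMost)
qed

lemma wcoeff_cf: "wcoeff k (wconst F) = (if k = 0 then F else 0)"
  by (rule fps_ext) simp

lemma wcoeff_cf_mult: "wcoeff k (wconst F * G) = F * wcoeff k G"
  by (simp add: wcoeff_mult wcoeff_cf if_distrib[of "\<lambda>x. x * _"] sum.delta cong: if_cong)

lemma fps_const_sum: "fps_const (sum f A) = (\<Sum>i\<in>A. fps_const (f i))"
  by (rule fps_ext) (simp add: fps_sum_nth)

lemma wcoeff_numeral_mult: "wcoeff k (numeral c * F) = numeral c * wcoeff k F"
  by (rule fps_ext) (simp add: numeral_fps_const)

lemma wcoeff_const_mult_X_power: "wcoeff k (fps_const c * fps_X ^ e) = fps_const (fps_nth c k) * fps_X ^ e"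
  by (rule fps_ext) (simp add: fps_X_power_iff)

lemma wcoeff_fsum:
  assumes "lfin I F" shows "wcoeff k (fsum I F) = fsum I (\<lambda>i. wcoeff k (F i))"
proof (rule fps_ext)
  fix n
  let ?J = "{i \<in> I. fps_nth (F i) n \<noteq> 0}"
  have J: "finite ?J" using assms by (simp add: lfin_def)
  have 1: "fps_nth (fsum I F) n = (\<Sum>i\<in>?J. fps_nth (F i) n)"
    by (rule fsum_nth) (use J in auto)
  have 2: "fps_nth (fsum I (\<lambda>i. wcoeff k (F i))) n = (\<Sum>i\<in>?J. fps_nth (wcoeff k (F i)) n)"
    by (rule fsum_nth) (use J in auto)
  show "fps_nth (wcoeff k (fsum I F)) n = fps_nth (fsum I (\<lambda>i. wcoeff k (F i))) n"
    by (simp only: 2) (simp only: wcoeff_nth 1 fps_sum_nth)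
qed

lemma wconst_mult: "wconst (F * G) = wconst F * wconst G"
  by (rule fps_ext) (simp add: fps_mult_nth fps_const_sum flip: fps_const_mult)

lemma wconst_add: "wconst (F + G) = wconst F + wconst G"
  by (rule fps_ext) simp

lemma wconst_diff: "wconst (F - G) = wconst F - wconst G"
  by (rule fps_ext) simp

lemma wconst_1 [simp]: "wconst 1 = 1"
  by (rule fps_ext) simp

lemma wconst_numeral [simp]: "wconst (numeral k) = numeral k"
  by (rule fps_ext) (simp add: numeral_fps_const)

lemma wconst_uminus: "wconst (- F) = - wconst F"
  by (rule fps_ext) simp

lemma wconst_power: "wconst (F ^ n) = wconst F ^ n"
  by (induction n) (simp_all add: wconst_mult)

lemma wconst_X [simp]: "wconst fps_X = fps_X"
  by (rule fps_ext) (simp add: fps_X_def)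

lemma wconst_fsum:
  assumes "lfin I F" shows "wconst (fsum I F) = fsum I (\<lambda>i. wconst (F i))"
proof (rule fps_ext)
  fix n
  let ?J = "{i \<in> I. fps_nth (F i) n \<noteq> 0}"
  have J: "finite ?J" using assms by (simp add: lfin_def)
  have 1: "fps_nth (fsum I F) n = (\<Sum>i\<in>?J. fps_nth (F i) n)"
    by (rule fsum_nth) (use J in auto)
  have 2: "fps_nth (fsum I (\<lambda>i. wconst (F i))) n = (\<Sum>i\<in>?J. fps_nth (wconst (F i)) n)"
    by (rule fsum_nth) (use J in auto)
  show "fps_nth (wconst (fsum I F)) n = fps_nth (fsum I (\<lambda>i. wconst (F i))) n"
    by (simp only: 2) (simp add: 1 fps_const_sum)
qed

text \<open>\<open>Bser\<close> is defined over every coefficient ring and involves only the outer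
  variable, so its instance in \<open>'a fps fps\<close> is the embedded one.\<close>

lemma wconst_Bser: "wconst (Bser u) = Bser u"
proof -
  have "lfin UNIV (\<lambda>i::nat. (- 1) ^ i * fps_X ^ tri (\<bar>u\<bar> + int i) :: 'a fps)"
    using lfin_Bser[of "\<bar>u\<bar>", where ?'a = 'a] by (simp add: add.commute)
  then show ?thesis
    unfolding Bser_def by (simp add: wconst_fsum wconst_mult wconst_power wconst_uminus)
qed

lemma wconst_Wser: "wconst (Wser u) = Wser u"
  unfolding Wser_def
  by (subst wconst_fsum[OF lfin_Pmon])
    (simp add: Pmon_def case_prod_unfold wconst_mult wconst_add wconst_power wconst_uminus)

lemma wconst_Xser: "wconst (Xser u) = Xser u"
  by (simp add: Xser_def wconst_add wconst_Bser wconst_Wser)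

lemma wconst_theta_even: "wconst (theta_even (\<lambda>_. 1)) = theta_even (\<lambda>_. 1)"
  unfolding theta_even_def by (subst wconst_fsum[OF lfin_theta_even]) (simp add: wconst_power)

lemma wconst_theta_odd: "wconst (theta_odd (\<lambda>_. 1)) = theta_odd (\<lambda>_. 1)"
  unfolding theta_odd_def by (subst wconst_fsum[OF lfin_theta_odd]) (simp add: wconst_power)

definition expw :: "int \<Rightarrow> rat fps" where
  "expw t = fps_exp (of_int t)"

lemma expw_add: "expw (s + t) = expw s * expw t"
  by (simp add: expw_def fps_exp_add_mult)

text \<open>Half the hyperbolic secant of \<open>w\<close>: the constant \<open>d\<close> of
  \<open>Appell_Theta\<close> for \<open>E = expw\<close>.\<close>

definition sechw :: "rat fps" where
  "sechw = inverse (expw 1 + expw (- 1))"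

lemma sechw: "sechw * (expw 1 + expw (- 1)) = 1"
  unfolding sechw_def by (rule inverse_mult_eq_1) (simp add: expw_def)

text \<open>
  The operator \<open>8 q d/dq + c\<close>.  The identity \<open>(2 l + 1)^2 = 8 (l (l + 1) / 2) + 1\<close> turns two derivatives in \<open>w\<close>
  of a theta function into one application of it (the heat equation).
\<close>

definition qD :: "'a::comm_ring_1 \<Rightarrow> 'a fps \<Rightarrow> 'a fps" where
  "qD c F = Abs_fps (\<lambda>n. (8 * of_nat n + c) * fps_nth F n)"

lemma qD_nth [simp]: "fps_nth (qD c F) n = (8 * of_nat n + c) * fps_nth F n"
  by (simp add: qD_def)

lemma qD_eq_deriv: "qD c F = fps_const 8 * fps_X * fps_deriv F + fps_const c * F"
  by (rule fps_ext) (auto simp: mult.assoc fps_X_mult_nth algebra_simps gr0_conv_Suc)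

text \<open>\<open>qD c\<close> is \<open>8 q d/dq\<close> conjugated by \<open>q^(c/8)\<close>, so
  the shifts add up in products.\<close>

lemma qD_mult: "qD (c + d) (F * G) = qD c F * G + F * qD d G"
  by (simp add: qD_eq_deriv algebra_simps flip: fps_const_add)

lemma qD_add: "qD c (F + G) = qD c F + qD c G"
  by (rule fps_ext) (simp add: algebra_simps)

lemma qD_diff: "qD c (F - G) = qD c F - qD c G"
  by (rule fps_ext) (simp add: algebra_simps)

lemma qD_fsum:
  assumes "lfin I F" shows "qD c (fsum I F) = fsum I (\<lambda>i. qD c (F i))"
proof (rule fps_ext)
  fix n
  let ?J = "{i \<in> I. fps_nth (F i) n \<noteq> 0}"
  have J: "finite ?J" using assms by (simp add: lfin_def)
  have 1: "fps_nth (fsum I F) n = (\<Sum>i\<in>?J. fps_nth (F i) n)"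
    by (rule fsum_nth) (use J in auto)
  have 2: "fps_nth (fsum I (\<lambda>i. qD c (F i))) n = (\<Sum>i\<in>?J. fps_nth (qD c (F i)) n)"
    by (rule fsum_nth) (use J in auto)
  show "fps_nth (qD c (fsum I F)) n = fps_nth (fsum I (\<lambda>i. qD c (F i))) n"
    by (simp only: 2) (simp add: 1 sum_distrib_left)
qed

lemma qD_monom: "qD c (fps_const d * fps_X ^ e) = fps_const ((8 * of_nat e + c) * d) * fps_X ^ e"
  by (rule fps_ext) (simp add: fps_X_power_iff)

lemma qD_numeral_mult: "qD c (numeral k * F) = numeral k * qD c F"
  by (rule fps_ext) (simp add: numeral_fps_const algebra_simps)

section \<open>Moments of theta functions\<close>

definition thetaM :: "(int \<Rightarrow> rat) \<Rightarrow> nat \<Rightarrow> rat fps" where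
  "thetaM \<sigma> k = fsum UNIV (\<lambda>l. fps_const (\<sigma> l * of_int (2 * l + 1) ^ k) * fps_X ^ tri l)"

lemma thetaM_step: "thetaM \<sigma> (k + 2) = qD 1 (thetaM \<sigma> k)"
proof -
  have "of_int (2 * l + 1) ^ 2 = (8 * of_nat (tri l) + 1 :: rat)" for l
  proof -
    have "(2 * l + 1) ^ 2 = 8 * int (tri l) + 1" using two_tri[of l] by (simp add: power2_eq_square algebra_simps)
    then have "of_int ((2 * l + 1) ^ 2) = (of_int (8 * int (tri l) + 1) :: rat)" by (simp only:)
    then show ?thesis by simp
  qed
  then have "\<sigma> l * of_int (2 * l + 1) ^ (k + 2) = (8 * of_nat (tri l) + 1) * (\<sigma> l * of_int (2 * l + 1) ^ k)" for l
    by (simp only: power_add mult_ac)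
  then show ?thesis
    unfolding thetaM_def qD_fsum[OF lfin_Theta] qD_monom by (simp only:)
qed

lemma wcoeff_Theta_tw:
  "wcoeff k (Theta_tw (\<lambda>l. fps_const (\<sigma> l)) expw) = fps_const (1 / fact k) * thetaM \<sigma> k"
  unfolding Theta_tw_def thetaM_def wcoeff_fsum[OF lfin_Theta] fsum_mult_left[OF lfin_Theta, symmetric] wcoeff_const_mult_X_power
  by (rule fsum_cong[OF refl]) (simp only: mult.assoc[symmetric] fps_const_mult expw_def, simp)

lemma thetaM_reflect:
  assumes "\<And>l. \<sigma> (- 1 - l) = e * \<sigma> l" "e * (- 1) ^ k = (- 1 :: rat)"
  shows "thetaM \<sigma> k = 0"
proof -
  have "thetaM \<sigma> k = fsum UNIV (\<lambda>j. fps_const (\<sigma> (int j) * of_int (2 * int j + 1) ^ k) * fps_X ^ tri (int j))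
     + fsum UNIV (\<lambda>j. - (fps_const (\<sigma> (int j) * of_int (2 * int j + 1) ^ k) * fps_X ^ tri (int j)))"
    unfolding thetaM_def
  proof (subst fsum_int_fold[OF lfin_Theta], intro arg_cong2[of _ _ _ _ "(+)"] refl fsum_cong)
    fix j
    have "of_int (2 * (- 1 - int j) + 1) = (- 1) * (of_int (2 * int j + 1) :: rat)" by simp
    then have "\<sigma> (- 1 - int j) * of_int (2 * (- 1 - int j) + 1) ^ k = (e * (- 1) ^ k) * (\<sigma> (int j) * of_int (2 * int j + 1) ^ k)"
      by (simp only: assms(1) power_mult_distrib mult_ac)
    then show "fps_const (\<sigma> (- 1 - int j) * of_int (2 * (- 1 - int j) + 1) ^ k) * fps_X ^ tri (- 1 - int j)
        = - (fps_const (\<sigma> (int j) * of_int (2 * int j + 1) ^ k) * fps_X ^ tri (int j))"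
      unfolding assms(2) by (simp add: tri_reflect flip: fps_const_neg)
  qed
  then show ?thesis by (simp add: fsum_uminus)
qed

definition evenM :: "nat \<Rightarrow> rat fps" where
  "evenM k = fsum UNIV (\<lambda>m. fps_const (of_int (4 * m) ^ k) * fps_X ^ nat (m\<^sup>2))"

definition oddM :: "nat \<Rightarrow> rat fps" where
  "oddM k = fsum UNIV (\<lambda>m. fps_const (of_int (4 * m + 2) ^ k) * fps_X ^ (2 * tri m))"

lemma wcoeff_theta_even: "wcoeff k (theta_even expw) = fps_const (1 / fact k) * evenM k"
  unfolding theta_even_def evenM_def wcoeff_fsum[OF lfin_theta_even] fsum_mult_left[OF lfin_theta_even, symmetric] wcoeff_const_mult_X_power
  by (rule fsum_cong[OF refl]) (simp only: mult.assoc[symmetric] fps_const_mult expw_def, simp)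

lemma wcoeff_theta_odd: "wcoeff k (theta_odd expw) = fps_const (1 / fact k) * oddM k"
  unfolding theta_odd_def oddM_def wcoeff_fsum[OF lfin_theta_odd] fsum_mult_left[OF lfin_theta_odd, symmetric] wcoeff_const_mult_X_power
  by (rule fsum_cong[OF refl]) (simp only: mult.assoc[symmetric] fps_const_mult expw_def, simp)

text \<open>Here \<open>(4 m)^2 = 2 * 8 m^2\<close>, and below
  \<open>(4 m + 2)^2 = 2 (8 m (m + 1) + 2)\<close>. The shifts 0 and 2 add up to 2, as do those of
  two factors \<open>th\<close> of shift 1, so the quadratic relations can be differentiated with
  \<open>qD 2\<close> on both sides.\<close>

lemma evenM_step: "evenM (k + 2) = 2 * qD 0 (evenM k)"
proof -
  have "of_int (4 * m) ^ 2 = (2 * (8 * of_nat (nat (m\<^sup>2))) :: rat)" for m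
    by (simp add: power2_eq_square)
  then have "of_int (4 * m) ^ (k + 2) = (2 * ((8 * of_nat (nat (m\<^sup>2)) + 0) * of_int (4 * m) ^ k) :: rat)" for m
    by (simp only: power_add mult_ac add_0_right)
  then show ?thesis
    unfolding evenM_def qD_fsum[OF lfin_theta_even] qD_monom fsum_mult_left[OF lfin_theta_even, symmetric]
    by (simp only: numeral_fps_const mult.assoc[symmetric] fps_const_mult)
qed

lemma oddM_step: "oddM (k + 2) = 2 * qD 2 (oddM k)"
proof -
  have "of_int (4 * m + 2) ^ 2 = (2 * (8 * of_nat (2 * tri m) + 2) :: rat)" for m
  proof -
    have "(4 * m + 2) ^ 2 = 2 * (8 * int (2 * tri m) + 2)" using two_tri[of m] by (simp add: power2_eq_square algebra_simps)
    then have "of_int ((4 * m + 2) ^ 2) = (of_int (2 * (8 * int (2 * tri m) + 2)) :: rat)" by (simp only:)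
    then show ?thesis by simp
  qed
  then have "of_int (4 * m + 2) ^ (k + 2) = (2 * ((8 * of_nat (2 * tri m) + 2) * of_int (4 * m + 2) ^ k) :: rat)" for m
    by (simp only: power_add mult_ac)
  then show ?thesis
    unfolding oddM_def qD_fsum[OF lfin_theta_odd] qD_monom fsum_mult_left[OF lfin_theta_odd, symmetric]
    by (simp only: numeral_fps_const mult.assoc[symmetric] fps_const_mult)
qed

lemma evenM_0: "evenM 0 = theta_even (\<lambda>_. 1)" and oddM_0: "oddM 0 = theta_odd (\<lambda>_. 1)"
  by (simp_all add: evenM_def oddM_def theta_even_def theta_odd_def)

lemma thetaM_sign_1: "thetaM par_sign 1 = 2 * jacobi_cube"
proof -
  have l: "lfin UNIV (\<lambda>j. fps_const ((- 1) ^ j * of_nat (2 * j + 1)) * fps_X ^ tri (int j) :: rat fps)"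
    by (rule lfin_X_power) (use finite_tri_le_nat[of 0] in simp)
  have 1: "par_sign (int j) * of_int (2 * int j + 1) ^ 1 = ((- 1) ^ j * of_nat (2 * j + 1) :: rat)" for j
    by (simp add: par_sign_def minus_one_power_iff)
  have 2: "par_sign (- 1 - int j) * of_int (2 * (- 1 - int j) + 1) ^ 1 = ((- 1) ^ j * of_nat (2 * j + 1) :: rat)" for j
    by (simp add: par_sign_def minus_one_power_iff)
  show ?thesis
    unfolding thetaM_def by (subst fsum_int_fold[OF lfin_Theta]) (simp only: 1 2 tri_reflect jacobi_cube_def mult_2[of "fsum _ _"])
qed

subsection \<open>Differential relations between theta functions\<close>

text \<open>The third and fourth hypotheses share \<open>a2 * b0 + a0 * b2\<close>; eliminating it
  leaves \<open>t0 * t2 - t1^2 = 4 * a1 * b1\<close>. Moreover \<open>4 * a0 * b0 * a1 * b1\<close>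
  is the difference of the squares of \<open>a1 * b0 + a0 * b1 = t0 * t1\<close> and
  \<open>a0 * b1 - a1 * b0 = s^2\<close>.\<close>

lemma theta_relation_1:
  fixes t0 t1 t2 a0 a1 a2 b0 b1 b2 s :: "'a::idom"
  assumes "t0\<^sup>2 = 2 * (a0 * b0)" "t0 * t1 = a1 * b0 + a0 * b1"
    "t1\<^sup>2 + t0 * t2 = a2 * b0 + 2 * (a1 * b1) + a0 * b2"
    "t0 * t2 + 3 * t1\<^sup>2 = 2 * (a2 * b0 + a0 * b2)" "s\<^sup>2 = a0 * b1 - a1 * b0"
  shows "t0 ^ 3 * t2 = 3 * t0\<^sup>2 * t1\<^sup>2 - 2 * s ^ 4"
  using assms by algebra

text \<open>Eliminating \<open>a0 * b3 - a3 * b0\<close> from the two relations with third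
  derivatives leaves \<open>2 (a1 * b2 - a2 * b1) = s * s2 - s1^2\<close>. Multiplied by
  \<open>t0^2 = 2 * a0 * b0\<close>, this minor is a combination of the other minors
  \<open>s^2\<close> and \<open>2 * s * s1\<close> with the symmetric expressions in
  \<open>t\<close>.\<close>

lemma theta_relation_2:
  fixes t0 t1 t2 a0 a1 a2 a3 b0 b1 b2 b3 s s1 s2 :: "'a::idom"
  assumes t: "t0\<^sup>2 = 2 * (a0 * b0)" "t0 * t1 = a1 * b0 + a0 * b1"
    "t0 * t2 + 3 * t1\<^sup>2 = 2 * (a2 * b0 + a0 * b2)"
    and s: "s\<^sup>2 = a0 * b1 - a1 * b0" "2 * s * s1 = a0 * b2 - a2 * b0"
    "2 * (s1\<^sup>2 + s * s2) = a1 * b2 + a0 * b3 - a3 * b0 - a2 * b1"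
    "3 * s * s2 + 5 * s1\<^sup>2 = 2 * (a0 * b3 - a3 * b0)"
    and "(2::'a) \<noteq> 0"
  shows "t0\<^sup>2 * (s * s2 - s1\<^sup>2) = 4 * t0 * t1 * s * s1 - s\<^sup>2 * (t0 * t2 + 3 * t1\<^sup>2)"
proof -
  have 1: "2 * (a1 * b2 - a2 * b1) = s * s2 - s1\<^sup>2"
    using s(3,4) by algebra
  have "2 * (t0\<^sup>2 * (s * s2 - s1\<^sup>2)) = 2 * (4 * t0 * t1 * s * s1 - s\<^sup>2 * (t0 * t2 + 3 * t1\<^sup>2))"
    unfolding 1[symmetric] using t s(1,2) by algebra
  then show ?thesis using mult_left_cancel[OF assms(8)] by blast
qed

text \<open>The \<open>k\<close>-th derivative in \<open>w\<close> at \<open>w = 0\<close>.\<close>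

definition moment :: "nat \<Rightarrow> rat fps fps \<Rightarrow> rat fps" where
  "moment k F = fps_const (fact k) * wcoeff k F"

lemma moment_add: "moment k (F + G) = moment k F + moment k G"
  and moment_diff: "moment k (F - G) = moment k F - moment k G"
  and moment_cf_mult: "moment k (wconst H * F) = H * moment k F"
  and moment_numeral_mult: "moment k (numeral c * F) = numeral c * moment k F"
  by (simp_all add: moment_def wcoeff_add wcoeff_diff wcoeff_cf_mult wcoeff_numeral_mult distrib_left right_diff_distrib mult.left_commute)

lemma moment_mult: "moment k (F * G) = (\<Sum>j\<le>k. of_nat (k choose j) * (moment j F * moment (k - j) G))"
proof -
  have "fps_const (fact k) * (wcoeff j F * wcoeff (k - j) G) = of_nat (k choose j) * (moment j F * moment (k - j) G)" if "j \<le> k" for j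
  proof -
    have "fact k = (of_nat (k choose j) * (fact j * fact (k - j)) :: rat)"
      using binomial_fact_lemma[OF that] by (metis mult.commute of_nat_fact of_nat_mult)
    then show ?thesis by (simp add: moment_def fps_of_nat[symmetric] mult_ac flip: fps_const_mult)
  qed
  then show ?thesis by (simp add: moment_def[of k] wcoeff_mult sum_distrib_left)
qed

lemma moment_square_0: "moment 0 (F ^ 2) = moment 0 F ^ 2"
  by (simp add: power2_eq_square moment_mult)

lemma choose_values: "(2 choose 1) = 2" "(4 choose 1) = 4" "(4 choose 2) = 6" "(4 choose 3) = 4"
  "(6 choose 1) = 6" "(6 choose 2) = 15" "(6 choose 3) = 20" "(6 choose 4) = 15" "(6 choose 5) = 6"
  by (simp_all add: eval_nat_numeral)

lemma atMost_values: "{..2::nat} = {0, 1, 2}" "{..4::nat} = {0, 1, 2, 3, 4}" "{..6::nat} = {0, 1, 2, 3, 4, 5, 6}"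
  by auto

lemma moment_mult_2: "moment 2 (F * G) = moment 0 F * moment 2 G + 2 * (moment 1 F * moment 1 G) + moment 2 F * moment 0 G"
  by (simp add: moment_mult atMost_values choose_values)

lemma moment_mult_4: "moment 4 (F * G) = moment 0 F * moment 4 G + 4 * (moment 1 F * moment 3 G) + 6 * (moment 2 F * moment 2 G)
    + 4 * (moment 3 F * moment 1 G) + moment 4 F * moment 0 G"
  by (simp add: moment_mult atMost_values choose_values)

lemma moment_mult_6: "moment 6 (F * G) = moment 0 F * moment 6 G + 6 * (moment 1 F * moment 5 G) + 15 * (moment 2 F * moment 4 G)
    + 20 * (moment 3 F * moment 3 G) + 15 * (moment 4 F * moment 2 G) + 6 * (moment 5 F * moment 1 G) + moment 6 F * moment 0 G"
  by (simp add: moment_mult atMost_values choose_values)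

abbreviation "th \<equiv> thetaM (\<lambda>_. 1)"
abbreviation "sth \<equiv> thetaM par_sign"

lemma moment_eqI: "wcoeff k F = fps_const (1 / fact k) * G \<Longrightarrow> moment k F = G"
  by (simp add: moment_def flip: mult.assoc)

lemma moment_Theta: "moment k (Theta expw) = th k"
  using wcoeff_Theta_tw[of k "\<lambda>_. 1"] by (intro moment_eqI) (simp add: Theta_eq_tw)

lemma par_sign_const: "(\<lambda>l. fps_const (par_sign l)) = (par_sign :: int \<Rightarrow> rat fps)"
  by (rule ext) (simp add: par_sign_def fps_const_minus_one)

lemma moment_Theta_sign: "moment k (Theta_tw par_sign expw) = sth k"
  using wcoeff_Theta_tw[of k par_sign] by (intro moment_eqI) (simp add: par_sign_const)

lemmas moment_theta_even = moment_eqI[OF wcoeff_theta_even] and moment_theta_odd = moment_eqI[OF wcoeff_theta_odd]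

lemma th_odd: "th 1 = 0" "th 3 = 0" "th 5 = 0"
  by (rule thetaM_reflect[of _ 1]; simp)+

lemma sth_even: "sth 0 = 0" "sth 2 = 0" "sth 4 = 0" "sth 6 = 0"
  by (rule thetaM_reflect[of _ "- 1"]; simp add: par_sign_def)+

lemma th_steps: "th 2 = qD 1 (th 0)" "th 4 = qD 1 (th 2)" "th 6 = qD 1 (th 4)"
  "sth 3 = qD 1 (sth 1)" "sth 5 = qD 1 (sth 3)"
  using thetaM_step[of "\<lambda>_. 1" 0] thetaM_step[of "\<lambda>_. 1" 2] thetaM_step[of "\<lambda>_. 1" 4]
    thetaM_step[of par_sign 1] thetaM_step[of par_sign 3]
  by (simp_all only: add_0_left arith_simps one_plus_numeral)

lemma even_odd_steps:
  "evenM 2 = 2 * qD 0 (evenM 0)" "evenM 4 = 4 * qD 0 (qD 0 (evenM 0))" "evenM 6 = 8 * qD 0 (qD 0 (qD 0 (evenM 0)))"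
  "oddM 2 = 2 * qD 2 (oddM 0)" "oddM 4 = 4 * qD 2 (qD 2 (oddM 0))" "oddM 6 = 8 * qD 2 (qD 2 (qD 2 (oddM 0)))"
proof -
  have d: "2 * (2 * F) = 4 * F" "2 * (4 * F) = 8 * F" for F :: "rat fps" by (simp_all add: mult.assoc[symmetric])
  show 1: "evenM 2 = 2 * qD 0 (evenM 0)" and 2: "oddM 2 = 2 * qD 2 (oddM 0)"
    using evenM_step[of 0] oddM_step[of 0] by (simp_all only: add_0_left)
  show 3: "evenM 4 = 4 * qD 0 (qD 0 (evenM 0))" and 4: "oddM 4 = 4 * qD 2 (qD 2 (oddM 0))"
    using evenM_step[of 2] oddM_step[of 2] by (simp_all only: arith_simps 1 2 qD_numeral_mult d)
  show "evenM 6 = 8 * qD 0 (qD 0 (qD 0 (evenM 0)))" "oddM 6 = 8 * qD 2 (qD 2 (qD 2 (oddM 0)))"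
    using evenM_step[of 4] oddM_step[of 4] by (simp_all only: arith_simps 3 4 qD_numeral_mult d)
qed

lemma moment_Theta_square: "moment k (Theta expw ^ 2) = evenM k * oddM 0 + evenM 0 * oddM k"
proof -
  have "moment k (Theta expw ^ 2) = moment k (wconst (oddM 0) * theta_even expw + wconst (evenM 0) * theta_odd expw)"
    unfolding Theta_square[OF expw_add] evenM_0 oddM_0 wconst_theta_even wconst_theta_odd by (simp only: mult.commute)
  then show ?thesis
    by (simp only: moment_add moment_cf_mult moment_theta_even moment_theta_odd) (simp only: mult.commute)
qed

lemma moment_Theta_sign_square: "moment k (Theta_tw par_sign expw ^ 2) = evenM 0 * oddM k - evenM k * oddM 0"
proof -
  have "moment k (Theta_tw par_sign expw ^ 2) = moment k (wconst (evenM 0) * theta_odd expw - wconst (oddM 0) * theta_even expw)"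
    unfolding Theta_sign_square[OF expw_add] evenM_0 oddM_0 wconst_theta_even wconst_theta_odd by (simp only: mult.commute)
  then show ?thesis
    by (simp only: moment_diff moment_cf_mult moment_theta_even moment_theta_odd) (simp only: mult.commute)
qed

lemma fps_cancel_numeral: "numeral k * F = numeral k * G \<Longrightarrow> F = (G :: rat fps)"
  by simp

lemma th_square: "th 0 ^ 2 = 2 * (evenM 0 * oddM 0)"
  using moment_Theta_square[of 0] by (simp add: moment_square_0 moment_Theta)

lemma th_0_th_2: "th 0 * th 2 = qD 0 (evenM 0) * oddM 0 + evenM 0 * qD 2 (oddM 0)"
proof (rule fps_cancel_numeral)
  show "2 * (th 0 * th 2) = 2 * (qD 0 (evenM 0) * oddM 0 + evenM 0 * qD 2 (oddM 0))"
    using moment_Theta_square[of 2]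
    unfolding power2_eq_square moment_mult_2 moment_Theta th_odd even_odd_steps by algebra
qed

text \<open>The \<open>q\<close>-derivative of \<open>th_0_th_2\<close>. It contains the same second
  derivatives as \<open>th_square_4\<close>, which comes from the fourth moment, but in another
  combination, and this makes the elimination possible. \<open>sth_square_3\<close> and
  \<open>sth_square_5\<close> play the same roles for the signed series.\<close>

lemma th_square_2: "th 2 ^ 2 + th 0 * th 4 = qD 0 (qD 0 (evenM 0)) * oddM 0 + 2 * (qD 0 (evenM 0) * qD 2 (oddM 0)) + evenM 0 * qD 2 (qD 2 (oddM 0))"
proof -
  have "qD (1 + 1) (th 0 * th 2) = th 2 ^ 2 + th 0 * th 4"
    unfolding qD_mult by (simp add: th_steps power2_eq_square)
  moreover have "qD (0 + 2) (qD 0 (evenM 0) * oddM 0) + qD (0 + 2) (evenM 0 * qD 2 (oddM 0)) = qD 0 (qD 0 (evenM 0)) * oddM 0 + 2 * (qD 0 (evenM 0) * qD 2 (oddM 0)) + evenM 0 * qD 2 (qD 2 (oddM 0))"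
    unfolding qD_mult by algebra
  ultimately show ?thesis by (simp add: th_0_th_2 qD_add)
qed

lemma th_square_4: "th 0 * th 4 + 3 * th 2 ^ 2 = 2 * (qD 0 (qD 0 (evenM 0)) * oddM 0 + evenM 0 * qD 2 (qD 2 (oddM 0)))"
proof (rule fps_cancel_numeral)
  show "2 * (th 0 * th 4 + 3 * th 2 ^ 2) = 2 * (2 * (qD 0 (qD 0 (evenM 0)) * oddM 0 + evenM 0 * qD 2 (qD 2 (oddM 0))))"
    using moment_Theta_square[of 4]
    unfolding power2_eq_square moment_mult_4 moment_Theta th_odd even_odd_steps by algebra
qed

lemma sth_square: "sth 1 ^ 2 = evenM 0 * qD 2 (oddM 0) - qD 0 (evenM 0) * oddM 0"
proof (rule fps_cancel_numeral)
  show "2 * sth 1 ^ 2 = 2 * (evenM 0 * qD 2 (oddM 0) - qD 0 (evenM 0) * oddM 0)"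
    using moment_Theta_sign_square[of 2]
    unfolding power2_eq_square moment_mult_2 moment_Theta_sign sth_even even_odd_steps by algebra
qed

lemma sth_1_sth_3: "2 * sth 1 * sth 3 = evenM 0 * qD 2 (qD 2 (oddM 0)) - qD 0 (qD 0 (evenM 0)) * oddM 0"
proof -
  have "qD (1 + 1) (sth 1 ^ 2) = 2 * sth 1 * sth 3"
    unfolding power2_eq_square qD_mult by (simp add: th_steps)
  moreover have "qD (0 + 2) (evenM 0 * qD 2 (oddM 0)) - qD (0 + 2) (qD 0 (evenM 0) * oddM 0) = evenM 0 * qD 2 (qD 2 (oddM 0)) - qD 0 (qD 0 (evenM 0)) * oddM 0"
    unfolding qD_mult by algebra
  ultimately show ?thesis by (simp only: sth_square qD_diff one_add_one add_0_left)
qed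

lemma sth_square_3: "2 * (sth 3 ^ 2 + sth 1 * sth 5) = qD 0 (evenM 0) * qD 2 (qD 2 (oddM 0)) + evenM 0 * qD 2 (qD 2 (qD 2 (oddM 0)))
    - qD 0 (qD 0 (qD 0 (evenM 0))) * oddM 0 - qD 0 (qD 0 (evenM 0)) * qD 2 (oddM 0)"
proof -
  have "qD (1 + 1) (sth 1 * sth 3) = sth 3 ^ 2 + sth 1 * sth 5"
    unfolding power2_eq_square qD_mult by (simp add: th_steps)
  moreover have "qD (0 + 2) (evenM 0 * qD 2 (qD 2 (oddM 0))) - qD (0 + 2) (qD 0 (qD 0 (evenM 0)) * oddM 0)
     = qD 0 (evenM 0) * qD 2 (qD 2 (oddM 0)) + evenM 0 * qD 2 (qD 2 (qD 2 (oddM 0)))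
    - qD 0 (qD 0 (qD 0 (evenM 0))) * oddM 0 - qD 0 (qD 0 (evenM 0)) * qD 2 (oddM 0)"
    unfolding qD_mult by algebra
  moreover have "2 * qD 2 (sth 1 * sth 3) = qD 2 (evenM 0 * qD 2 (qD 2 (oddM 0)) - qD 0 (qD 0 (evenM 0)) * oddM 0)"
    unfolding sth_1_sth_3[symmetric] qD_numeral_mult[symmetric] by (simp only: mult.assoc)
  ultimately show ?thesis by (simp add: qD_diff)
qed

lemma sth_square_5: "3 * sth 1 * sth 5 + 5 * sth 3 ^ 2 = 2 * (evenM 0 * qD 2 (qD 2 (qD 2 (oddM 0))) - qD 0 (qD 0 (qD 0 (evenM 0))) * oddM 0)"
proof (rule fps_cancel_numeral)
  show "4 * (3 * sth 1 * sth 5 + 5 * sth 3 ^ 2) = 4 * (2 * (evenM 0 * qD 2 (qD 2 (qD 2 (oddM 0))) - qD 0 (qD 0 (qD 0 (evenM 0))) * oddM 0))"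
    using moment_Theta_sign_square[of 6]
    unfolding power2_eq_square moment_mult_6 moment_Theta_sign sth_even even_odd_steps by algebra
qed

lemma theta_identity_1: "th 0 ^ 3 * th 4 = 3 * th 0 ^ 2 * th 2 ^ 2 - 2 * sth 1 ^ 4"
  by (rule theta_relation_1[OF th_square th_0_th_2 th_square_2 th_square_4 sth_square])

lemma theta_identity_2: "th 0 ^ 2 * (sth 1 * sth 5 - sth 3 ^ 2) = 4 * th 0 * th 2 * sth 1 * sth 3 - sth 1 ^ 2 * (th 0 * th 4 + 3 * th 2 ^ 2)"
  by (rule theta_relation_2[OF th_square th_0_th_2 th_square_4 sth_square sth_1_sth_3 sth_square_3 sth_square_5]) simp

subsection \<open>Moments of the Cesaro function\<close>

text \<open>\<open>T^2\<close> and \<open>A * T\<close> are linear in \<open>tE\<close> and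
  \<open>tO\<close>. After inserting \<open>t^2 * C\<close> and \<open>t^2 = 2 * (e * d)\<close>,
  the coefficients of \<open>tE\<close> and \<open>tO\<close> are proportional to \<open>- d\<close>
  and \<open>e\<close>, which gives the product form.\<close>

lemma Appell_algebra:
  fixes T A R C tE tO x0 x1 e d :: "'a::comm_ring_1"
  assumes "T\<^sup>2 = tE * d + tO * e" "A * T = x0 * tE + x1 * tO" "R = C * T - 4 * A"
    "t\<^sup>2 = 2 * (e * d)" "t\<^sup>2 * C = 4 * (x0 * e + x1 * d)"
  shows "t\<^sup>2 * (R * T) = 4 * (x0 * e - x1 * d) * (tO * e - tE * d)"
proof -
  have "t\<^sup>2 * (R * T) = (t\<^sup>2 * C) * T\<^sup>2 - 4 * t\<^sup>2 * (A * T)"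
    unfolding assms(3) by (simp add: algebra_simps power2_eq_square)
  also have "\<dots> = 4 * (x0 * e - x1 * d) * (tO * e - tE * d)"
    unfolding assms(5,1,2) unfolding assms(4) by (simp add: algebra_simps)
  finally show ?thesis .
qed

definition Appell_total :: "rat fps fps" where
  "Appell_total = fps_const sechw + Appell expw"

text \<open>For the Cesaro function \<open>C\<close> the Appell sum cancels in the product with the theta function, up to the square of the signed theta function.\<close>

definition Rser :: "rat fps \<Rightarrow> rat fps fps" where
  "Rser C = wconst C * Theta expw - 4 * Appell_total"

lemma Rser_times_Theta:
  assumes C: "C * th 0 = 4 * moment 0 Appell_total"
  shows "wconst (th 0 ^ 2) * (Rser C * Theta expw) = wconst (2 * sth 1) * Theta_tw par_sign expw ^ 2"
proof -
  define x0 x1 :: "rat fps" where "x0 = Xser 0" and "x1 = Xser 1"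
  have A: "Appell_total * Theta expw = wconst x0 * theta_even expw + wconst x1 * theta_odd expw"
    unfolding Appell_total_def x0_def x1_def wconst_Xser by (rule Appell_Theta[OF expw_add sechw])
  have "moment 0 Appell_total * th 0 = x0 * evenM 0 + x1 * oddM 0"
  proof -
    have "moment 0 (Appell_total * Theta expw) = x0 * evenM 0 + x1 * oddM 0"
      unfolding A by (simp only: moment_add moment_cf_mult moment_theta_even moment_theta_odd)
    then show ?thesis by (simp add: moment_mult moment_Theta)
  qed
  then have C': "th 0 ^ 2 * C = 4 * (x0 * evenM 0 + x1 * oddM 0)"
    using C by algebra
  \<comment> \<open>The factor free of \<open>w\<close> is Jacobi's series by
    \<open>Xser_signed\<close>, that is, half of \<open>sth 1\<close>.\<close>
  have J: "2 * sth 1 = 4 * (x0 * evenM 0 - x1 * oddM 0)"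
    unfolding x0_def x1_def evenM_0 oddM_0 Xser_signed thetaM_sign_1 by simp
  have S: "Theta_tw par_sign expw ^ 2 = theta_odd expw * wconst (evenM 0) - theta_even expw * wconst (oddM 0)"
    unfolding Theta_sign_square[OF expw_add] evenM_0 oddM_0 wconst_theta_even wconst_theta_odd ..
  have "wconst (th 0) ^ 2 * (Rser C * Theta expw) = 4 * (wconst x0 * wconst (evenM 0) - wconst x1 * wconst (oddM 0)) * (theta_odd expw * wconst (evenM 0) - theta_even expw * wconst (oddM 0))"
  proof (rule Appell_algebra[OF _ A Rser_def])
    show "Theta expw ^ 2 = theta_even expw * wconst (oddM 0) + theta_odd expw * wconst (evenM 0)"
      unfolding Theta_square[OF expw_add] evenM_0 oddM_0 wconst_theta_even wconst_theta_odd ..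
    show "wconst (th 0) ^ 2 = 2 * (wconst (evenM 0) * wconst (oddM 0))"
      using arg_cong[OF th_square, of wconst] by (simp add: wconst_power wconst_mult)
    show "wconst (th 0) ^ 2 * wconst C = 4 * (wconst x0 * wconst (evenM 0) + wconst x1 * wconst (oddM 0))"
      using arg_cong[OF C', of wconst] by (simp add: wconst_power wconst_mult wconst_add)
  qed
  then show ?thesis
    unfolding S J by (simp only: wconst_power wconst_mult wconst_diff wconst_numeral)
qed

lemma moment_Rser_times_Theta:
  assumes "C * th 0 = 4 * moment 0 Appell_total"
  shows "th 0 ^ 2 * moment k (Rser C * Theta expw) = 2 * sth 1 * moment k (Theta_tw par_sign expw ^ 2)"
  using arg_cong[OF Rser_times_Theta[OF assms], of "moment k"] by (simp only: moment_cf_mult)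

section \<open>Integral series built from psi and Jacobi's series\<close>

definition psi :: "rat fps" where
  "psi = fsum UNIV (\<lambda>l::nat. fps_X ^ tri (int l))"

lemma lfin_psi: "lfin UNIV (\<lambda>l::nat. c l * fps_X ^ tri (int l) :: rat fps)"
  by (rule lfin_X_power) (use finite_tri_le_nat[of 0] in simp)

lemma th_0: "th 0 = 2 * psi"
proof -
  have "th 0 = fsum UNIV (\<lambda>l::nat. 1 * fps_X ^ tri (int l)) + fsum UNIV (\<lambda>l::nat. 1 * fps_X ^ tri (int l))"
    unfolding thetaM_def by (subst fsum_int_fold[OF lfin_Theta]) (simp add: tri_reflect)
  then show ?thesis by (simp add: psi_def)
qed

lemma int_coeffs_fsum:
  assumes "lfin I F" "\<And>i. i \<in> I \<Longrightarrow> int_coeffs (F i)" shows "int_coeffs (fsum I F)"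
  using assms unfolding int_coeffs_def fsum_def fps_nth_Abs_fps by (auto intro!: Ints_sum)

lemma int_coeffs_const: "c \<in> \<int> \<Longrightarrow> int_coeffs (fps_const c)"
  by (auto simp: int_coeffs_def)

lemma int_coeffs_numeral: "int_coeffs (numeral k)"
  unfolding numeral_fps_const by (rule int_coeffs_const) simp

lemma int_coeffs_psi: "int_coeffs psi"
  unfolding psi_def using lfin_psi[of "\<lambda>_. 1"] by (intro int_coeffs_fsum int_coeffs_power) auto

lemma int_coeffs_jacobi: "int_coeffs (jacobi_cube)"
  unfolding jacobi_cube_def
  by (intro int_coeffs_fsum lfin_psi int_coeffs_mult int_coeffs_const int_coeffs_power) (auto intro!: Ints_mult Ints_power Ints_add)

lemma fps_nth_0_theta: "fps_nth (fsum UNIV (\<lambda>l::nat. c l * fps_X ^ tri (int l))) 0 = (fps_nth (c 0) 0 :: rat)"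
proof -
  have "fps_nth (c l * fps_X ^ tri (int l)) 0 = 0" if "l \<noteq> 0" for l
    by (rule fps_nth_mult_X_power_low) (use tri_nat_ge[of l] that in simp)
  then show ?thesis by (subst fsum_nth[of "{0}"]) auto
qed

lemma psi_nth_0: "fps_nth psi 0 = 1"
  unfolding psi_def using fps_nth_0_theta[of "\<lambda>_. 1"] by simp

lemma jacobi_nth_0: "fps_nth jacobi_cube 0 = (1 :: rat)"
  unfolding jacobi_cube_def using fps_nth_0_theta[of "\<lambda>j. fps_const ((- 1) ^ j * of_nat (2 * j + 1))"] by simp

lemma int_coeffs_qD: "c \<in> \<int> \<Longrightarrow> int_coeffs F \<Longrightarrow> int_coeffs (qD c F)"
  by (auto simp: int_coeffs_def intro!: Ints_mult Ints_add)

definition kap :: "rat fps" where "kap = jacobi_cube * inverse psi"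
text \<open>Logarithmic derivatives for \<open>8 q d/dq\<close> of
  \<open>q^(1/8) jacobi_cube\<close> and, in \<open>eser\<close>, of \<open>q^(1/8) psi\<close>. The
  constant terms 1 keep the coefficients integral, on which the reduction modulo 7 relies.\<close>

definition pser :: "rat fps" where "pser = qD 1 jacobi_cube * inverse jacobi_cube"
definition eser :: "rat fps" where "eser = qD 1 psi * inverse psi"

lemma int_coeffs_kap_pser_eser: "int_coeffs kap" "int_coeffs pser" "int_coeffs eser"
  unfolding kap_def pser_def eser_def
  by (intro int_coeffs_mult int_coeffs_inverse int_coeffs_qD int_coeffs_psi int_coeffs_jacobi psi_nth_0 jacobi_nth_0; simp)+

lemma kap_th: "kap * th 0 = sth 1" and pser_sth: "pser * sth 1 = sth 3" and eser_th: "eser * th 0 = th 2"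
proof -
  have i: "inverse psi * psi = 1" "inverse jacobi_cube * jacobi_cube = (1 :: rat fps)"
    by (rule inverse_mult_eq_1; simp add: psi_nth_0 jacobi_nth_0)+
  show "kap * th 0 = sth 1" "eser * th 0 = th 2" "pser * sth 1 = sth 3"
    unfolding kap_def eser_def pser_def th_steps th_0 thetaM_sign_1 qD_numeral_mult mult.assoc mult.left_commute[of "inverse _" 2] i
    by (simp_all add: mult.commute)
qed

lemma th_0_nz: "th 0 \<noteq> 0" and sth_1_nz: "sth 1 \<noteq> 0"
proof -
  have "psi \<noteq> 0" "jacobi_cube \<noteq> (0 :: rat fps)" using psi_nth_0 jacobi_nth_0 by auto
  then show "th 0 \<noteq> 0" "sth 1 \<noteq> 0" by (simp_all add: th_0 thetaM_sign_1 del: One_nat_def)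
qed

lemma qD_kap: "qD 0 kap = kap * (pser - eser)"
proof -
  have "qD (0 + 1) (kap * th 0) = qD 0 kap * th 0 + kap * th 2" unfolding qD_mult th_steps ..
  then have "qD 0 kap * th 0 = sth 3 - kap * th 2" unfolding kap_th th_steps by (simp add: algebra_simps)
  also have "\<dots> = (kap * (pser - eser)) * th 0"
    unfolding pser_sth[symmetric] eser_th[symmetric] kap_th[symmetric] by (simp add: algebra_simps)
  finally show ?thesis using th_0_nz by simp
qed

lemma qD_pser: "(qD 0 pser + pser\<^sup>2) * sth 1 = sth 5"
proof -
  have "qD (0 + 1) (pser * sth 1) = qD 0 pser * sth 1 + pser * sth 3" unfolding qD_mult th_steps ..
  then show ?thesis unfolding pser_sth th_steps(5)
    by (simp add: distrib_right power2_eq_square mult.assoc pser_sth del: One_nat_def)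
qed

lemma qD_eser: "(qD 0 eser + eser\<^sup>2) * th 0 = th 4"
proof -
  have "qD (0 + 1) (eser * th 0) = qD 0 eser * th 0 + eser * th 2" unfolding qD_mult th_steps ..
  then show ?thesis unfolding eser_th th_steps(2)
    by (simp add: distrib_right power2_eq_square mult.assoc eser_th)
qed

text \<open>\<open>theta_identity_1\<close> divided by \<open>th 0 ^ 4\<close>, with
  \<open>kap = sth 1 / th 0\<close>. The term \<open>kap ^ 4\<close> is the source of
  \<open>kap ^ 7\<close> in the combination of moments.\<close>

lemma qD_eser': "qD 0 eser = 2 * eser\<^sup>2 - 2 * kap ^ 4"
proof -
  have "th 0 ^ 4 * (qD 0 eser + eser\<^sup>2) = th 0 ^ 4 * (3 * eser\<^sup>2 - 2 * kap ^ 4)"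
    using theta_identity_1 unfolding qD_eser[symmetric] eser_th[symmetric] kap_th[symmetric] by algebra
  then have "qD 0 eser + eser\<^sup>2 = 3 * eser\<^sup>2 - 2 * kap ^ 4"
    using th_0_nz by (simp only: mult_cancel_left power_eq_0_iff) simp
  then show ?thesis by (simp add: algebra_simps)
qed

lemma qD_pser': "qD 0 pser = 4 * pser * eser - qD 0 eser - 4 * eser\<^sup>2"
proof -
  have "(th 0 ^ 2 * sth 1 ^ 2) * qD 0 pser = (th 0 ^ 2 * sth 1 ^ 2) * (4 * pser * eser - qD 0 eser - 4 * eser\<^sup>2)"
    using theta_identity_2 unfolding qD_eser[symmetric] eser_th[symmetric] qD_pser[symmetric] pser_sth[symmetric] by algebra
  then show ?thesis using th_0_nz sth_1_nz by (simp del: One_nat_def)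
qed

text \<open>Odd moments of theta and even moments of the signed theta vanish, so
  \<open>moment_Rser_times_Theta\<close> determines each even moment from the lower even ones. The
  common factor \<open>kap ^ 3\<close> is \<open>sth 1 ^ 3 / th 0 ^ 3\<close>.\<close>

lemma moment_Rser:
  assumes "C * th 0 = 4 * moment 0 Appell_total"
  shows "moment 0 (Rser C) = 0" "moment 2 (Rser C) = 4 * kap ^ 3"
    "moment 4 (Rser C) = kap ^ 3 * (16 * pser - 24 * eser)"
    "moment 6 (Rser C) = kap ^ 3 * (24 * (qD 0 pser + pser\<^sup>2) + 40 * pser\<^sup>2 - 60 * (qD 0 eser + eser\<^sup>2) - 240 * pser * eser + 360 * eser\<^sup>2)"
proof -
  note eq = moment_Rser_times_Theta[OF assms]
  have "th 0 ^ 2 * (moment 0 (Rser C) * th 0) = 0"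
    using eq[of 0] by (simp add: moment_mult moment_Theta moment_square_0 moment_Theta_sign sth_even)
  then show r0: "moment 0 (Rser C) = 0" using th_0_nz by simp
  have "th 0 ^ 3 * moment 2 (Rser C) = th 0 ^ 3 * (4 * kap ^ 3)"
    using eq[of 2] unfolding power2_eq_square[of "Theta_tw _ _"] moment_mult_2 moment_Theta moment_Theta_sign th_odd sth_even r0 kap_th[symmetric] by algebra
  then show r2: "moment 2 (Rser C) = 4 * kap ^ 3" using th_0_nz by simp
  have "th 0 ^ 3 * moment 4 (Rser C) = th 0 ^ 3 * (kap ^ 3 * (16 * pser - 24 * eser))"
    using eq[of 4] unfolding power2_eq_square[of "Theta_tw _ _"] moment_mult_4 moment_Theta moment_Theta_sign th_odd sth_even r0 r2
      pser_sth[symmetric] eser_th[symmetric] kap_th[symmetric] by algebra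
  then show r4: "moment 4 (Rser C) = kap ^ 3 * (16 * pser - 24 * eser)" using th_0_nz by simp
  have "th 0 ^ 3 * moment 6 (Rser C) = th 0 ^ 3 * (kap ^ 3 * (24 * (qD 0 pser + pser\<^sup>2) + 40 * pser\<^sup>2 - 60 * (qD 0 eser + eser\<^sup>2) - 240 * pser * eser + 360 * eser\<^sup>2))"
    using eq[of 6] unfolding power2_eq_square[of "Theta_tw _ _"] moment_mult_6 moment_Theta moment_Theta_sign th_odd sth_even r0 r2 r4
      qD_eser[symmetric] qD_pser[symmetric] pser_sth[symmetric] eser_th[symmetric] kap_th[symmetric] by algebra
  then show "moment 6 (Rser C) = kap ^ 3 * (24 * (qD 0 pser + pser\<^sup>2) + 40 * pser\<^sup>2 - 60 * (qD 0 eser + eser\<^sup>2) - 240 * pser * eser + 360 * eser\<^sup>2)"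
    using th_0_nz by simp
qed

lemma qD_0_mult: "qD 0 (F * G) = qD 0 F * G + F * qD 0 G"
  using qD_mult[of 0 0 F G] by simp

lemma qD_kap3: "qD 0 (kap ^ 3 * F) = kap ^ 3 * (3 * (pser - eser) * F + qD 0 F)"
proof -
  have "qD 0 (kap ^ 3) = 3 * kap ^ 3 * (pser - eser)"
    by (simp add: power3_eq_cube qD_0_mult qD_kap)
  then show ?thesis unfolding qD_0_mult by algebra
qed

text \<open>
  The weights make the right-hand side a multiple of \<open>kap ^ 7\<close> modulo 7; the only exponents of a
  seventh power modulo 7 are the multiples of 7.
\<close>

lemma Rser_combination:
  assumes "C * th 0 = 4 * moment 0 Appell_total"
  shows "- 4 * qD 0 (qD 0 (moment 2 (Rser C))) + 6 * qD 0 (moment 4 (Rser C)) - 4 * moment 6 (Rser C)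
    = 7 * (- 16 * kap ^ 3 * (pser\<^sup>2 - 3 * pser * eser + 3 * eser\<^sup>2)) - 384 * kap ^ 7"
proof -
  have 2: "qD 0 (qD 0 (moment 2 (Rser C))) = 4 * (kap ^ 3 * (9 * (pser - eser)\<^sup>2 + 3 * (qD 0 pser - qD 0 eser)))"
  proof -
    have 1: "qD 0 (1 :: rat fps) = 0" by (rule fps_ext) simp
    have "qD 0 (moment 2 (Rser C)) = 4 * (kap ^ 3 * (3 * (pser - eser)))"
      using qD_kap3[of 1] by (simp add: moment_Rser(2)[OF assms] qD_numeral_mult 1)
    show ?thesis
      unfolding \<open>qD 0 (moment 2 (Rser C)) = _\<close> unfolding qD_numeral_mult qD_kap3 qD_diff
      by (simp add: power2_eq_square algebra_simps)
  qed
  have 4: "qD 0 (moment 4 (Rser C)) = kap ^ 3 * (3 * (pser - eser) * (16 * pser - 24 * eser) + (16 * qD 0 pser - 24 * qD 0 eser))"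
    unfolding moment_Rser[OF assms] qD_kap3 qD_diff qD_numeral_mult ..
  show ?thesis
    unfolding 2 4 moment_Rser(4)[OF assms] qD_pser' qD_eser' by algebra
qed

subsection \<open>Divisibility from moments\<close>

text \<open>The derivative of \<open>F ^ p\<close> is \<open>p F' F ^ (p - 1)\<close>, so
  \<open>p\<close> divides \<open>n\<close> times the coefficient at \<open>n\<close>, and
  \<open>n\<close> is prime to \<open>p\<close>.\<close>

lemma prime_power_coeff:
  assumes F: "int_coeffs F" and p: "prime (p::nat)" and n: "\<not> p dvd n"
  shows "\<exists>z. fps_nth (F ^ p) n = of_int (int p * z)"
proof -
  have "n > 0" using n by (cases n) auto
  have F': "int_coeffs (fps_deriv F * F ^ (p - 1))"
    by (intro int_coeffs_mult int_coeffs_power F) (use F in \<open>auto simp: int_coeffs_def intro!: Ints_mult Ints_add\<close>)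
  obtain c where c: "fps_nth (F ^ p) n = of_int c"
    using int_coeffs_power[OF F] unfolding int_coeffs_def by (meson Ints_cases)
  obtain d where d: "fps_nth (fps_deriv F * F ^ (p - 1)) (n - 1) = of_int d"
    using F' unfolding int_coeffs_def by (meson Ints_cases)
  have "of_nat n * fps_nth (F ^ p) n = fps_nth (fps_deriv (F ^ p)) (n - 1)"
    using \<open>n > 0\<close> by simp
  also have "\<dots> = of_nat p * of_int d"
    unfolding fps_deriv_power d[symmetric] by (simp add: mult.assoc fps_of_nat[symmetric])
  finally have "of_int (int n * c) = (of_int (int p * d) :: rat)" unfolding c by simp
  then have "int n * c = int p * d" by (simp only: of_int_eq_iff)
  then have "int p dvd int n * c" by simp
  moreover have "prime (int p)" using p by simp
  ultimately have "int p dvd c" using n by (simp add: prime_dvd_mult_iff)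
  then show ?thesis using c by (metis dvdE)
qed

lemma Cesaro_moments:
  "C * th k = 4 * moment k Appell_total + moment k (Rser C)"
  unfolding Rser_def moment_diff moment_cf_mult moment_Theta moment_numeral_mult by simp

lemma times_th_nth:
  "fps_nth (Abs_fps (\<lambda>n. of_int (a n)) * th k) N = of_int (\<Sum>l | tri l \<le> N. a (N - tri l) * (2 * l + 1) ^ k)"
proof -
  have fin: "finite {l. tri l \<le> N}" using finite_tri_le[of 0] by simp
  have "Abs_fps (\<lambda>n. of_int (a n)) * th k = fsum UNIV (\<lambda>l. Abs_fps (\<lambda>n. of_int (a n)) * (fps_const (of_int (2 * l + 1) ^ k) * fps_X ^ tri l))"
    unfolding thetaM_def fsum_mult_left[OF lfin_Theta] by simp
  also have "fps_nth \<dots> N = (\<Sum>l | tri l \<le> N. fps_nth (Abs_fps (\<lambda>n. of_int (a n)) * (fps_const (of_int (2 * l + 1) ^ k) * fps_X ^ tri l)) N)"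
    by (rule fsum_nth) (use fin in \<open>auto simp: fps_X_power_mult_right_nth simp flip: mult.assoc\<close>)
  also have "\<dots> = (\<Sum>l | tri l \<le> N. of_int (a (N - tri l) * (2 * l + 1) ^ k))"
    by (rule sum.cong) (auto simp: fps_X_power_mult_right_nth simp flip: mult.assoc)
  finally show ?thesis by simp
qed

text \<open>The exponent of \<open>q\<close> and the odd index of \<open>E\<close> in the terms of the Appell sum.\<close>

definition Pexp :: "nat \<times> nat \<Rightarrow> nat" where
  "Pexp = (\<lambda>(n, i). tri (int (Suc n)) + Suc n * i)"

definition Todd :: "nat \<times> nat \<Rightarrow> int" where
  "Todd = (\<lambda>(n, i). 2 * int (Suc n + i) + 1)"

text \<open>On the terms of the Appell sum \<open>8 N - t^2\<close> is minus a square, so a weight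
  that vanishes modulo \<open>p\<close> on negatives of squares removes the explicit
  moments.\<close>

lemma Pexp_Todd: "8 * int (Pexp (n, i)) - Todd (n, i) ^ 2 = - ((2 * int i + 1) ^ 2)"
  using two_tri[of "int (Suc n)"] by (simp add: Pexp_def Todd_def power2_eq_square algebra_simps)

text \<open>\<open>N > 0\<close> excludes the contribution of \<open>sechw\<close>, and for even
  \<open>k\<close> the two exponentials contribute equally.\<close>

lemma moment_Appell_total_nth:
  assumes "N > 0" "even k"
  shows "fps_nth (moment k Appell_total) N = of_int (\<Sum>x | Pexp x = N. (- 1) ^ snd x * (2 * Todd x ^ k))"
proof -
  have fin: "finite {x. Pexp x = N}"
    by (rule finite_subset[OF _ finite_Pmon_index[of N]]) (auto simp: Pexp_def)
  have "fps_nth (Appell expw) N = (\<Sum>x | Pexp x = N. fps_nth (case x of (n, i) \<Rightarrow> Pmon (Suc n) i *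
     fps_const (expw (2 * int (Suc n + i) + 1) + expw (- (2 * int (Suc n + i) + 1)))) N)"
    unfolding Appell_def
  proof (rule fsum_nth[OF fin])
    fix x assume x: "x \<notin> {x. Pexp x = N}"
    show "fps_nth (case x of (n, i) \<Rightarrow> Pmon (Suc n) i *
     fps_const (expw (2 * int (Suc n + i) + 1) + expw (- (2 * int (Suc n + i) + 1)))) N = 0"
      using x by (cases x) (auto simp: Pexp_def Pmon_def minus_one_power_iff)
  qed simp
  also have "\<dots> = (\<Sum>x | Pexp x = N. (- 1) ^ snd x * (expw (Todd x) + expw (- Todd x)))"
    by (rule sum.cong) (auto simp: Pexp_def Todd_def Pmon_def minus_one_power_iff)
  finally have A: "fps_nth Appell_total N = (\<Sum>x | Pexp x = N. (- 1) ^ snd x * (expw (Todd x) + expw (- Todd x)))"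
    using assms(1) by (simp add: Appell_total_def)
  have "fact k * fps_nth ((- 1) ^ j * (expw t + expw (- t))) k = of_int ((- 1) ^ j * (2 * t ^ k))" for j t
    using assms(2) by (simp add: expw_def minus_one_power_iff)
  then show ?thesis
    unfolding moment_def by (simp add: A fps_sum_nth sum_distrib_left)
qed

lemma fps_nth_numeral_mult: "fps_nth (numeral k * F) n = numeral k * fps_nth F n"
  and fps_nth_neg_numeral_mult: "fps_nth (- (numeral k * F)) n = - (numeral k * fps_nth F n)"
  by (simp_all add: numeral_fps_const)

lemma cong_power_7: "[t ^ 7 = t] (mod (7::int))"
proof -
  have "t mod 7 \<in> {0, 1, 2, 3, 4, 5, 6}" by auto
  then have "[(t mod 7) ^ 7 = t mod 7] (mod 7)" by (auto simp: cong_def)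
  then show ?thesis by (simp add: cong_def power_mod)
qed

lemma cong_power_3: "[t ^ 3 = t] (mod (3::int))"
proof -
  have "t mod 3 \<in> {0, 1, 2}" by auto
  then have "[(t mod 3) ^ 3 = t mod 3] (mod 3)" by (auto simp: cong_def)
  then show ?thesis by (simp add: cong_def power_mod)
qed

lemma neg_square_mod_7: "[(- (t ^ 2)) ^ 4 + (- (t ^ 2)) = 0] (mod (7::int))"
proof -
  have "[t ^ 7 * t - t * t = t * t - t * t] (mod 7)"
    by (intro cong_diff cong_mult cong_power_7) simp_all
  then show ?thesis by (simp add: eval_nat_numeral mult_ac)
qed

lemma neg_square_mod_3: "[(- (t ^ 2)) ^ 2 + (- (t ^ 2)) = 0] (mod (3::int))"
proof -
  have "[t ^ 3 * t - t * t = t * t - t * t] (mod 3)"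
    by (intro cong_diff cong_mult cong_power_3) simp_all
  then show ?thesis by (simp add: eval_nat_numeral mult_ac)
qed

text \<open>Division by the theta series, whose constant coefficient is 2.\<close>

lemma theta_quotient_dvd:
  fixes g :: "nat \<Rightarrow> int"
  assumes m: "coprime m 2" and S: "\<And>N. m dvd (\<Sum>l | tri l \<le> N. g (N - tri l))"
  shows "m dvd g N"
proof (induction N rule: less_induct)
  case (less N)
  have fin: "finite {l. tri l \<le> N}" using finite_tri_le[of 0] by simp
  have t: "tri l = 0 \<longleftrightarrow> l = 0 \<or> l = - 1" for l
    using two_tri[of l] by auto
  have t1: "tri (- 1) = 0" by (simp add: tri_def)
  have "{l. tri l \<le> N} = {0, - 1} \<union> ({l. tri l \<le> N} - {0, - 1})"
    using t1 by auto
  then have "(\<Sum>l | tri l \<le> N. g (N - tri l)) = (\<Sum>l\<in>{0, - 1} \<union> ({l. tri l \<le> N} - {0, - 1}). g (N - tri l))"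
    by simp
  also have "\<dots> = 2 * g N + (\<Sum>l\<in>{l. tri l \<le> N} - {0, - 1}. g (N - tri l))"
    using fin t1 by (subst sum.union_disjoint) (auto simp: t1)
  finally have "m dvd 2 * g N + (\<Sum>l\<in>{l. tri l \<le> N} - {0, - 1}. g (N - tri l))"
    using S[of N] by simp
  moreover have "m dvd (\<Sum>l\<in>{l. tri l \<le> N} - {0, - 1}. g (N - tri l))"
  proof (rule dvd_sum)
    fix l assume "l \<in> {l. tri l \<le> N} - {0, - 1}"
    then have "N - tri l < N" using t[of l] by auto
    then show "m dvd g (N - tri l)" by (rule less.IH)
  qed
  ultimately have "m dvd 2 * g N" by (simp add: dvd_add_left_iff)
  then show ?case using m by (simp add: coprime_dvd_mult_right_iff)
qed

context
  fixes C :: "rat fps" and a :: "nat \<Rightarrow> int"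
  assumes C: "C = Abs_fps (\<lambda>n. of_int (a n))" and C_th: "C * th 0 = 4 * moment 0 Appell_total"
begin

text \<open>Integer values at \<open>N\<close> of the \<open>k\<close>-th moments in
  \<open>Cesaro_moments\<close>: \<open>cm\<close> for \<open>C\<close> times theta,
  \<open>wm\<close> for the Appell sum, \<open>rm\<close> below for \<open>Rser C\<close>.\<close>

private definition "cm k N = (\<Sum>l | tri l \<le> N. a (N - tri l) * (2 * l + 1) ^ k)"
private definition "wm k N = (\<Sum>x | Pexp x = N. (- 1) ^ snd x * (2 * Todd x ^ k))"

private lemma cm: "of_int (cm k N) = fps_nth (C * th k) N"
  unfolding C times_th_nth cm_def ..

private lemma cm_eq:
  assumes "N > 0" "even k"
  shows "of_int (cm k N) = 4 * of_int (wm k N) + fps_nth (moment k (Rser C)) N"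
  unfolding cm wm_def Cesaro_moments[of C k] moment_Appell_total_nth[OF assms, symmetric]
  by (simp add: numeral_fps_const)

private lemma square_8: "tri l \<le> N \<Longrightarrow> 8 * int (N - tri l) - 1 = 8 * int N - (2 * l + 1) ^ 2"
  using two_tri[of l] by (simp add: of_nat_diff power2_eq_square algebra_simps)

private definition "rm k N = cm k N - 4 * wm k N"

private lemma rm: "N > 0 \<Longrightarrow> even k \<Longrightarrow> of_int (rm k N) = fps_nth (moment k (Rser C)) N"
  using cm_eq[of N k] by (simp add: rm_def)

text \<open>With \<open>M = 8 N\<close> and \<open>t = 2 l + 1\<close>, the point
  \<open>8 (N - tri l) - 1\<close> is \<open>M - t^2\<close>, so the sum over \<open>l\<close> is
  modulo \<open>m\<close> a combination of moments. The Appell share vanishes by \<open>sq\<close>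
  and \<open>Pexp_Todd\<close>, the share of \<open>Rser\<close> by \<open>r\<close>; theta is then
  divided out.\<close>

private lemma Cesaro_dvd:
  fixes y f0 f1 f2 f3 :: "int \<Rightarrow> int"
  assumes m: "coprime m 2"
    and y: "\<And>M t. [y (M - t ^ 2) = f0 M + f1 M * t ^ 2 + f2 M * t ^ 4 + f3 M * t ^ 6] (mod m)"
    and sq: "\<And>u. m dvd y (- (u ^ 2))"
    and 0: "f0 0 = 0" "f1 0 = 0" "f2 0 = 0" "f3 0 = 0"
    and r: "\<And>N M. N > 0 \<Longrightarrow> M = 8 * int N \<Longrightarrow> m dvd f0 M * rm 0 N + f1 M * rm 2 N + f2 M * rm 4 N + f3 M * rm 6 N"
  shows "m dvd a n * y (8 * int n - 1)"
proof (rule theta_quotient_dvd[OF m, where g = "\<lambda>n. a n * y (8 * int n - 1)"])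
  fix N :: nat
  define M where "M = 8 * int N"
  define P where "P t = f0 M + f1 M * t ^ 2 + f2 M * t ^ 4 + f3 M * t ^ 6" for t
  have "[(\<Sum>l | tri l \<le> N. a (N - tri l) * y (8 * int (N - tri l) - 1))
      = (\<Sum>l | tri l \<le> N. a (N - tri l) * P (2 * l + 1))] (mod m)"
  proof (intro cong_sum cong_mult cong_refl)
    fix l assume "l \<in> {l. tri l \<le> N}"
    then have e: "8 * int (N - tri l) - 1 = M - (2 * l + 1) ^ 2" unfolding M_def by (intro square_8) simp
    show "[y (8 * int (N - tri l) - 1) = P (2 * l + 1)] (mod m)" unfolding e P_def by (rule y)
  qed
  also have "(\<Sum>l | tri l \<le> N. a (N - tri l) * P (2 * l + 1))
     = f0 M * cm 0 N + f1 M * cm 2 N + f2 M * cm 4 N + f3 M * cm 6 N"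
    by (simp add: P_def cm_def sum_distrib_left distrib_left sum.distrib mult_ac)
  also have "[\<dots> = 0] (mod m)"
  \<comment> \<open>At \<open>N = 0\<close> all four weights vanish by hypothesis; the formula for
    the Appell moments holds only for \<open>N > 0\<close>.\<close>
  proof (cases "N = 0")
    case True
    then show ?thesis by (simp add: M_def 0)
  next
    case False
    have "m dvd (\<Sum>x | Pexp x = N. (- 1) ^ snd x * (2 * P (Todd x)))"
    proof (rule dvd_sum)
      fix x assume x: "x \<in> {x. Pexp x = N}"
      obtain n i where ni: "x = (n, i)" by (cases x)
      have "M - Todd x ^ 2 = - ((2 * int i + 1) ^ 2)" using Pexp_Todd[of n i] x by (simp add: M_def ni)
      then have "m dvd y (M - Todd x ^ 2)" using sq by simp
      then have "m dvd P (Todd x)" using y[of M "Todd x"] by (simp add: P_def cong_dvd_iff)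
      then show "m dvd (- 1) ^ snd x * (2 * P (Todd x))" by simp
    qed
    also have "(\<Sum>x | Pexp x = N. (- 1) ^ snd x * (2 * P (Todd x)))
      = f0 M * wm 0 N + f1 M * wm 2 N + f2 M * wm 4 N + f3 M * wm 6 N"
      by (simp add: P_def wm_def sum_distrib_left distrib_left sum.distrib mult_ac)
    finally have "m dvd 4 * (f0 M * wm 0 N + f1 M * wm 2 N + f2 M * wm 4 N + f3 M * wm 6 N)
        + (f0 M * rm 0 N + f1 M * rm 2 N + f2 M * rm 4 N + f3 M * rm 6 N)"
      using r[of N M] False by (intro dvd_add[OF dvd_mult]) (simp_all add: M_def)
    also have "\<dots> = f0 M * cm 0 N + f1 M * cm 2 N + f2 M * cm 4 N + f3 M * cm 6 N"
      by (simp add: rm_def algebra_simps)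
    finally show ?thesis by (simp add: cong_0_iff)
  qed
  finally show "m dvd (\<Sum>l | tri l \<le> N. a (N - tri l) * y (8 * int (N - tri l) - 1))"
    by (simp add: cong_0_iff)
qed

text \<open>Modulo 3 the terms \<open>t^4 - t^2\<close> disappear, which leaves the moments 0 and 2.
  For \<open>Rser\<close> the first is 0 and the second is 4 times a cube, whose coefficients at
  indices prime to 3 are divisible by 3; if \<open>3 dvd N\<close>, the weight
  \<open>- 2 * M\<close> is divisible instead.\<close>

lemma Cesaro_dvd_3: "3 dvd a n * ((8 * int n - 1) ^ 2 + (8 * int n - 1))"
proof (rule Cesaro_dvd[where y = "\<lambda>x. x ^ 2 + x" and ?f0.0 = "\<lambda>M. M ^ 2 + M" and ?f1.0 = "\<lambda>M. - 2 * M" and ?f2.0 = "\<lambda>_. 0" and ?f3.0 = "\<lambda>_. 0"])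
  fix M t :: int
  have "[M ^ 2 + M - 2 * M * t ^ 2 + (t ^ 3 * t - t * t) = M ^ 2 + M - 2 * M * t ^ 2 + (t * t - t * t)] (mod 3)"
    by (intro cong_add cong_diff cong_mult cong_power_3 cong_refl)
  moreover have "(M - t ^ 2) ^ 2 + (M - t ^ 2) = M ^ 2 + M - 2 * M * t ^ 2 + (t ^ 3 * t - t * t)"
    by algebra
  ultimately show "[(M - t ^ 2) ^ 2 + (M - t ^ 2) = M ^ 2 + M + - 2 * M * t ^ 2 + 0 * t ^ 4 + 0 * t ^ 6] (mod 3)"
    by (simp only:) simp
next
  fix N :: nat and M :: int assume N: "N > 0" and M: "M = 8 * int N"
  have r0: "rm 0 N = 0" using rm[OF N, of 0] moment_Rser(1)[OF C_th] by simp
  have "3 dvd M * rm 2 N"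
  proof (cases "3 dvd N")
    case True
    then have "3 dvd M" unfolding M using int_dvd_int_iff[of 3 N] by simp
    then show ?thesis by (rule dvd_mult2)
  next
    case False
    obtain z where z: "fps_nth (kap ^ 3) N = of_int (int 3 * z)"
      using prime_power_coeff[OF int_coeffs_kap_pser_eser(1), of 3 N] False by auto
    have "of_int (rm 2 N) = (of_int (3 * (4 * z)) :: rat)"
      using rm[OF N, of 2] z by (simp add: moment_Rser(2)[OF C_th] numeral_fps_const)
    then have "rm 2 N = 3 * (4 * z)" by (simp only: of_int_eq_iff)
    then show ?thesis by simp
  qed
  then show "3 dvd (M ^ 2 + M) * rm 0 N + - 2 * M * rm 2 N + 0 * rm 4 N + 0 * rm 6 N"
    by (simp add: r0 mult.assoc)
next
  show "3 dvd (- (u ^ 2)) ^ 2 + - (u ^ 2)" for u :: int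
    using neg_square_mod_3[of u] by (simp only: cong_0_iff)
qed simp_all

text \<open>The weights are the coefficients of \<open>(M - t^2)^4\<close>, with \<open>t^8\<close>
  replaced by \<open>t^2\<close> and cancelled against \<open>- t^2\<close>. Those of the moments 2,
  4, 6 share a factor \<open>M\<close>; since \<open>M\<close> acts as \<open>qD 0\<close>, what is
  left is the combination of \<open>Rser_combination\<close>.\<close>

lemma Cesaro_dvd_7: "7 dvd a n * ((8 * int n - 1) ^ 4 + (8 * int n - 1))"
proof (rule Cesaro_dvd[where y = "\<lambda>x. x ^ 4 + x" and ?f0.0 = "\<lambda>M. M ^ 4 + M" and ?f1.0 = "\<lambda>M. - 4 * M ^ 3" and ?f2.0 = "\<lambda>M. 6 * M ^ 2" and ?f3.0 = "\<lambda>M. - 4 * M"])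
  fix M t :: int
  have "[M ^ 4 + M - 4 * M ^ 3 * t ^ 2 + 6 * M ^ 2 * t ^ 4 - 4 * M * t ^ 6 + (t ^ 7 * t - t * t)
      = M ^ 4 + M - 4 * M ^ 3 * t ^ 2 + 6 * M ^ 2 * t ^ 4 - 4 * M * t ^ 6 + (t * t - t * t)] (mod 7)"
    by (intro cong_add cong_diff cong_mult cong_power_7 cong_refl)
  moreover have "(M - t ^ 2) ^ 4 + (M - t ^ 2) = M ^ 4 + M - 4 * M ^ 3 * t ^ 2 + 6 * M ^ 2 * t ^ 4 - 4 * M * t ^ 6 + (t ^ 7 * t - t * t)"
    by algebra
  ultimately show "[(M - t ^ 2) ^ 4 + (M - t ^ 2) = M ^ 4 + M + - 4 * M ^ 3 * t ^ 2 + 6 * M ^ 2 * t ^ 4 + - 4 * M * t ^ 6] (mod 7)"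
    by (simp only:) simp
next
  fix N :: nat and M :: int assume N: "N > 0" and M: "M = 8 * int N"
  have r0: "rm 0 N = 0" using rm[OF N, of 0] moment_Rser(1)[OF C_th] by simp
  define W where "W = kap ^ 3 * (pser\<^sup>2 - 3 * pser * eser + 3 * eser\<^sup>2)"
  have "int_coeffs W"
    unfolding W_def
    by (intro int_coeffs_mult int_coeffs_add int_coeffs_diff int_coeffs_power int_coeffs_kap_pser_eser int_coeffs_numeral)
  then obtain w where w: "fps_nth W N = of_int w" unfolding int_coeffs_def by (meson Ints_cases)
  obtain v where v: "fps_nth (kap ^ 7) N = of_int v"
    using int_coeffs_power[OF int_coeffs_kap_pser_eser(1), of 7] unfolding int_coeffs_def by (meson Ints_cases)
  have "- 4 * qD 0 (qD 0 (moment 2 (Rser C))) + 6 * qD 0 (moment 4 (Rser C)) - 4 * moment 6 (Rser C) = 7 * (- 16 * W) - 384 * kap ^ 7"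
    using Rser_combination[OF C_th] by (simp add: W_def mult.assoc)
  then have "fps_nth (- 4 * qD 0 (qD 0 (moment 2 (Rser C))) + 6 * qD 0 (moment 4 (Rser C)) - 4 * moment 6 (Rser C)) N = fps_nth (7 * (- 16 * W) - 384 * kap ^ 7) N"
    by simp
  then have "of_int (- 4 * M ^ 2 * rm 2 N + 6 * M * rm 4 N - 4 * rm 6 N) = (of_int (7 * (- 16 * w) - 384 * v) :: rat)"
    using rm[OF N, of 2] rm[OF N, of 4] rm[OF N, of 6] w v
    by (simp add: fps_nth_numeral_mult fps_nth_neg_numeral_mult power2_eq_square M mult.assoc)
  then have e: "- 4 * M ^ 2 * rm 2 N + 6 * M * rm 4 N - 4 * rm 6 N = 7 * (- 16 * w) - 384 * v"
    by (simp only: of_int_eq_iff)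
  have "7 dvd M * (- 4 * M ^ 2 * rm 2 N + 6 * M * rm 4 N - 4 * rm 6 N)"
  proof (cases "7 dvd N")
    case True
    then have "7 dvd M" unfolding M using int_dvd_int_iff[of 7 N] by simp
    then show ?thesis by (rule dvd_mult2)
  next
    case False
    then obtain z where z: "fps_nth (kap ^ 7) N = of_int (int 7 * z)"
      using prime_power_coeff[OF int_coeffs_kap_pser_eser(1), of 7 N] by auto
    have "(of_int v :: rat) = of_int (int 7 * z)" unfolding v[symmetric] z ..
    then have "v = 7 * z" by (simp only: of_int_eq_iff of_nat_numeral)
    then show ?thesis unfolding e by simp
  qed
  moreover have "(M ^ 4 + M) * rm 0 N + - 4 * M ^ 3 * rm 2 N + 6 * M ^ 2 * rm 4 N + - 4 * M * rm 6 N
      = M * (- 4 * M ^ 2 * rm 2 N + 6 * M * rm 4 N - 4 * rm 6 N)"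
    by (simp add: r0 power2_eq_square power3_eq_cube algebra_simps)
  ultimately show "7 dvd (M ^ 4 + M) * rm 0 N + - 4 * M ^ 3 * rm 2 N + 6 * M ^ 2 * rm 4 N + - 4 * M * rm 6 N"
    by (simp only:)
next
  show "7 dvd (- (u ^ 2)) ^ 4 + - (u ^ 2)" for u :: int
    using neg_square_mod_7[of u] by (simp only: cong_0_iff)
qed simp_all

end

subsection \<open>Infinite products and the triple product identity\<close>

lemma flim_reindex:
  assumes "flim F G" "\<And>M. \<exists>N0. \<forall>N\<ge>N0. M \<le> s N" shows "flim (\<lambda>N. F (s N)) G"
  unfolding flim_def
proof
  fix n
  obtain M where M: "\<forall>N\<ge>M. fps_nth (F N) n = fps_nth G n" using assms(1) unfolding flim_def by blast
  obtain N0 where "\<forall>N\<ge>N0. M \<le> s N" using assms(2) by blast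
  then show "\<exists>N0. \<forall>N\<ge>N0. fps_nth (F (s N)) n = fps_nth G n" using M by blast
qed

lemma flim_eventually:
  assumes "flim F G" "\<And>N. N \<ge> N0 \<Longrightarrow> F N = H N" shows "flim H G"
  unfolding flim_def
proof
  fix n
  obtain N1 where "\<forall>N\<ge>N1. fps_nth (F N) n = fps_nth G n" using assms(1) unfolding flim_def by blast
  then show "\<exists>N1. \<forall>N\<ge>N1. fps_nth (H N) n = fps_nth G n"
    using assms(2) by (intro exI[of _ "max N0 N1"]) auto
qed

lemma flim_compose_X_power:
  fixes F :: "nat \<Rightarrow> 'a::comm_ring_1 fps"
  assumes "flim F G" "m > 0" shows "flim (\<lambda>N. F N oo fps_X ^ m) (G oo fps_X ^ m)"
  unfolding flim_def
proof
  fix n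
  obtain N1 where "\<forall>N\<ge>N1. fps_nth (F N) (n div m) = fps_nth G (n div m)" using assms(1) unfolding flim_def by blast
  then show "\<exists>N1. \<forall>N\<ge>N1. fps_nth (F N oo fps_X ^ m) n = fps_nth (G oo fps_X ^ m) n"
    using assms(2) by (intro exI[of _ N1]) (auto simp: fps_nth_compose_X_power)
qed

text \<open>The coefficient at \<open>n\<close> is read off after \<open>n\<close> factors; this is the limit under \<open>iprod_ok\<close>.\<close>

definition iprod :: "(nat \<Rightarrow> 'a::comm_ring_1 fps) \<Rightarrow> 'a fps" where
  "iprod f = Abs_fps (\<lambda>n. fps_nth (\<Prod>i<n. f i) n)"

definition iprod_ok :: "(nat \<Rightarrow> 'a::comm_ring_1 fps) \<Rightarrow> bool" where
  "iprod_ok f \<longleftrightarrow> (\<forall>i k. k \<le> i \<longrightarrow> fps_nth (f i) k = (if k = 0 then 1 else 0))"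

lemma flim_iprod:
  assumes "iprod_ok f" shows "flim (\<lambda>N. \<Prod>i<N. f i) (iprod f)"
  unfolding flim_def
proof
  fix n
  have step: "fps_nth (F * f N) n = fps_nth F n" if "n \<le> N" for F N
  proof -
    have "fps_nth (F * f N) n = (\<Sum>j=0..n. if j = n then fps_nth F j else 0)"
      unfolding fps_mult_nth
    proof (rule sum.cong[OF refl])
      fix j assume "j \<in> {0..n}"
      then have "fps_nth (f N) (n - j) = (if n - j = 0 then 1 else 0)"
        by (intro assms[unfolded iprod_ok_def, rule_format]) (use that in linarith)
      then show "fps_nth F j * fps_nth (f N) (n - j) = (if j = n then fps_nth F j else 0)"
        using \<open>j \<in> {0..n}\<close> by auto
    qed
    then show ?thesis by simp
  qed
  have "fps_nth (\<Prod>i<N. f i) n = fps_nth (\<Prod>i<n. f i) n" if "n \<le> N" for N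
    using that
  proof (induction N rule: dec_induct)
    case (step N)
    then show ?case by (simp only: prod.lessThan_Suc \<open>\<And>F N. n \<le> N \<Longrightarrow> fps_nth (F * f N) n = fps_nth F n\<close>)
  qed simp
  then show "\<exists>N0. \<forall>N\<ge>N0. fps_nth (\<Prod>i<N. f i) n = fps_nth (iprod f) n"
    unfolding iprod_def fps_nth_Abs_fps by blast
qed

text \<open>In standard notation \<open>(- s q^c; q^b)_inf\<close>, so \<open>s = - 1\<close> gives
  the factors \<open>1 - q^(b i + c)\<close>.\<close>

definition qpoch :: "rat fps \<Rightarrow> nat \<Rightarrow> nat \<Rightarrow> rat fps" where
  "qpoch s b c = iprod (\<lambda>i. 1 + s * fps_X ^ (b * i + c))"

lemma iprod_ok_qpoch: "b > 0 \<Longrightarrow> c > 0 \<Longrightarrow> iprod_ok (\<lambda>i. 1 + s * fps_X ^ (b * i + c) :: rat fps)"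
proof -
  assume a: "b > 0" "c > 0"
  show ?thesis
    unfolding iprod_ok_def
  proof (intro allI impI)
    fix i k :: nat assume "k \<le> i"
    also have "i \<le> b * i" using a by simp
    also have "b * i < b * i + c" using a by simp
    finally show "fps_nth (1 + s * fps_X ^ (b * i + c)) k = (if k = 0 then 1 else 0)"
      by (simp add: fps_nth_mult_X_power_low)
  qed
qed

lemma flim_qpoch: "b > 0 \<Longrightarrow> c > 0 \<Longrightarrow> flim (\<lambda>N. \<Prod>i<N. 1 + s * fps_X ^ (b * i + c)) (qpoch s b c)"
  unfolding qpoch_def by (rule flim_iprod[OF iprod_ok_qpoch])

lemma qpoch_nth_0 [simp]: "fps_nth (qpoch s b c) 0 = 1"
  by (simp add: qpoch_def iprod_def)

lemma prod_double: "(\<Prod>i<2 * N. f i) = (\<Prod>i<N. f (2 * i) * f (2 * i + 1))" for f :: "nat \<Rightarrow> 'a::comm_ring_1"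
  by (induction N) (simp_all add: mult_ac)

lemma prod_triple: "(\<Prod>i<3 * N. f i) = (\<Prod>i<N. f (3 * i) * f (3 * i + 1) * f (3 * i + 2))" for f :: "nat \<Rightarrow> 'a::comm_ring_1"
proof (induction N)
  case (Suc N)
  have "3 * Suc N = Suc (Suc (Suc (3 * N)))" by simp
  then show ?case using Suc by (simp only: prod.lessThan_Suc) (simp add: mult_ac)
qed simp

lemma qpoch_split2:
  assumes "b > 0" "c > 0" shows "qpoch s b c = qpoch s (2 * b) c * qpoch s (2 * b) (b + c)"
proof (rule flim_unique)
  show "flim (\<lambda>N. \<Prod>i<2 * N. 1 + s * fps_X ^ (b * i + c)) (qpoch s b c)"
    by (rule flim_subseq[OF flim_qpoch[OF assms]]) simp
  have "(\<Prod>i<2 * N. 1 + s * fps_X ^ (b * i + c)) = (\<Prod>i<N. 1 + s * fps_X ^ (2 * b * i + c)) * (\<Prod>i<N. 1 + s * fps_X ^ (2 * b * i + (b + c)))" for N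
    unfolding prod_double prod.distrib by (simp add: algebra_simps)
  then show "flim (\<lambda>N. \<Prod>i<2 * N. 1 + s * fps_X ^ (b * i + c)) (qpoch s (2 * b) c * qpoch s (2 * b) (b + c))"
    using flim_mult[OF flim_qpoch[of "2 * b" c s] flim_qpoch[of "2 * b" "b + c" s]] assms by simp
qed

lemma qpoch_split3:
  assumes "b > 0" "c > 0" shows "qpoch s b c = qpoch s (3 * b) c * qpoch s (3 * b) (b + c) * qpoch s (3 * b) (2 * b + c)"
proof (rule flim_unique)
  show "flim (\<lambda>N. \<Prod>i<3 * N. 1 + s * fps_X ^ (b * i + c)) (qpoch s b c)"
    by (rule flim_subseq[OF flim_qpoch[OF assms]]) simp
  have "(\<Prod>i<3 * N. 1 + s * fps_X ^ (b * i + c)) = (\<Prod>i<N. 1 + s * fps_X ^ (3 * b * i + c)) * (\<Prod>i<N. 1 + s * fps_X ^ (3 * b * i + (b + c))) * (\<Prod>i<N. 1 + s * fps_X ^ (3 * b * i + (2 * b + c)))" for N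
    unfolding prod_triple prod.distrib by (simp add: algebra_simps)
  then show "flim (\<lambda>N. \<Prod>i<3 * N. 1 + s * fps_X ^ (b * i + c)) (qpoch s (3 * b) c * qpoch s (3 * b) (b + c) * qpoch s (3 * b) (2 * b + c))"
    using flim_mult[OF flim_mult[OF flim_qpoch[of "3 * b" c s] flim_qpoch[of "3 * b" "b + c" s]] flim_qpoch[of "3 * b" "2 * b + c" s]] assms by simp
qed

lemma qpoch_plus_minus:
  assumes "b > 0" "c > 0" shows "qpoch 1 b c * qpoch (- 1) b c = qpoch (- 1) (2 * b) (2 * c)"
proof (rule flim_unique)
  show "flim (\<lambda>N. (\<Prod>i<N. 1 + 1 * fps_X ^ (b * i + c)) * (\<Prod>i<N. 1 + (- 1) * fps_X ^ (b * i + c))) (qpoch 1 b c * qpoch (- 1) b c)"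
    by (rule flim_mult[OF flim_qpoch[OF assms] flim_qpoch[OF assms]])
  have e: "(1 + 1 * fps_X ^ (b * i + c)) * (1 + (- 1) * fps_X ^ (b * i + c)) = 1 + (- 1 :: rat fps) * fps_X ^ (2 * b * i + 2 * c)" for i
  proof -
    have "2 * b * i + 2 * c = (b * i + c) + (b * i + c)" by simp
    then show ?thesis by (simp only: power_add) (simp add: algebra_simps)
  qed
  show "flim (\<lambda>N. (\<Prod>i<N. 1 + 1 * fps_X ^ (b * i + c)) * (\<Prod>i<N. 1 + (- 1) * fps_X ^ (b * i + c))) (qpoch (- 1) (2 * b) (2 * c))"
    unfolding prod.distrib[symmetric] e by (rule flim_qpoch) (use assms in auto)
qed

lemma fps_X_power_compose_X_power:
  assumes "m > 0" shows "fps_X ^ e oo fps_X ^ m = (fps_X ^ (m * e) :: 'a::comm_ring_1 fps)"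
  using assms by (intro fps_ext) (auto simp: fps_nth_compose_X_power)

lemma qpoch_compose:
  assumes "b > 0" "c > 0" "m > 0" "s oo fps_X ^ m = s" shows "qpoch s b c oo fps_X ^ m = qpoch s (m * b) (m * c)"
proof (rule flim_unique)
  show "flim (\<lambda>N. (\<Prod>i<N. 1 + s * fps_X ^ (b * i + c)) oo fps_X ^ m) (qpoch s b c oo fps_X ^ m)"
    by (rule flim_compose_X_power[OF flim_qpoch]) (use assms in auto)
  have 0: "fps_nth (fps_X ^ m :: rat fps) 0 = 0" using assms(3) by simp
  have "(\<Prod>i<N. 1 + s * fps_X ^ (b * i + c)) oo fps_X ^ m = (\<Prod>i<N. 1 + s * fps_X ^ (m * b * i + m * c))" for N
    unfolding fps_compose_prod_distrib[OF 0]
  proof (rule prod.cong[OF refl])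
    fix i
    have "m * (b * i + c) = m * b * i + m * c" by (simp add: distrib_left)
    then show "(1 + s * fps_X ^ (b * i + c)) oo fps_X ^ m = 1 + s * fps_X ^ (m * b * i + m * c)"
      using assms(4)
      by (simp only: fps_compose_add_distrib fps_compose_mult_distrib[OF 0] fps_X_power_compose_X_power[OF assms(3)] fps_compose_1)
  qed
  then show "flim (\<lambda>N. (\<Prod>i<N. 1 + s * fps_X ^ (b * i + c)) oo fps_X ^ m) (qpoch s (m * b) (m * c))"
    using flim_qpoch[of "m * b" "m * c" s] assms by simp
qed

section \<open>Gaussian binomial coefficients and the Jacobi triple product\<close>

fun gauss_binomial :: "'a::comm_ring_1 \<Rightarrow> nat \<Rightarrow> nat \<Rightarrow> 'a" where
  "gauss_binomial x n 0 = 1"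
| "gauss_binomial x 0 (Suc k) = 0"
| "gauss_binomial x (Suc n) (Suc k) = gauss_binomial x n k + x ^ Suc k * gauss_binomial x n (Suc k)"

lemma gauss_binomial_eq_0: "n < k \<Longrightarrow> gauss_binomial x n k = 0"
  by (induction x n k rule: gauss_binomial.induct) auto

lemma choose_two_Suc: "Suc k choose 2 = (k choose 2) + k"
  by (simp add: numeral_2_eq_2)

text \<open>Peeling off the factor \<open>i = 0\<close> replaces \<open>z\<close> by
  \<open>z * x\<close>, hence the induction for all \<open>z\<close>. The homogeneous variable
  \<open>u\<close> becomes a power of \<open>q\<close> in the triple product.\<close>

theorem q_binomial:
  "(\<Prod>i<m. u + z * x ^ i) = (\<Sum>k\<le>m. x ^ (k choose 2) * z ^ k * u ^ (m - k) * gauss_binomial x m k)"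
proof (induction m arbitrary: z)
  case (Suc m)
  let ?g = "gauss_binomial x" and ?c = "\<lambda>k. x ^ (k choose 2) * z ^ k"
  have "(\<Prod>i<Suc m. u + z * x ^ i) = (u + z) * (\<Prod>i<m. u + (z * x) * x ^ i)"
    by (subst prod.lessThan_Suc_shift) (simp add: mult.assoc)
  also have "\<dots> = (u + z) * (\<Sum>k\<le>m. ?c k * x ^ k * u ^ (m - k) * ?g m k)"
    unfolding Suc.IH power_mult_distrib by (simp only: mult_ac)
  also have "\<dots> = (\<Sum>k\<le>m. ?c k * x ^ k * u ^ (Suc m - k) * ?g m k) + (\<Sum>k\<le>m. ?c (Suc k) * u ^ (m - k) * ?g m k)"
  proof -
    have "u * (\<Sum>k\<le>m. ?c k * x ^ k * u ^ (m - k) * ?g m k) = (\<Sum>k\<le>m. ?c k * x ^ k * u ^ (Suc m - k) * ?g m k)"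
      unfolding sum_distrib_left by (rule sum.cong) (auto simp: Suc_diff_le mult_ac)
    moreover have "z * (\<Sum>k\<le>m. ?c k * x ^ k * u ^ (m - k) * ?g m k) = (\<Sum>k\<le>m. ?c (Suc k) * u ^ (m - k) * ?g m k)"
      unfolding sum_distrib_left by (rule sum.cong) (auto simp: choose_two_Suc power_add mult_ac)
    ultimately show ?thesis by (simp add: distrib_right)
  qed
  also have "(\<Sum>k\<le>m. ?c k * x ^ k * u ^ (Suc m - k) * ?g m k) = (\<Sum>k\<le>Suc m. ?c k * x ^ k * u ^ (Suc m - k) * ?g m k)"
    by (simp add: gauss_binomial_eq_0)
  also have "\<dots> = u ^ Suc m + (\<Sum>k\<le>m. ?c (Suc k) * x ^ Suc k * u ^ (m - k) * ?g m (Suc k))"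
    by (subst sum.atMost_Suc_shift) (simp add: numeral_2_eq_2)
  also have "u ^ Suc m + (\<Sum>k\<le>m. ?c (Suc k) * x ^ Suc k * u ^ (m - k) * ?g m (Suc k)) + (\<Sum>k\<le>m. ?c (Suc k) * u ^ (m - k) * ?g m k)
      = u ^ Suc m + (\<Sum>k\<le>m. ?c (Suc k) * u ^ (m - k) * ?g (Suc m) (Suc k))"
    unfolding add.assoc sum.distrib[symmetric] gauss_binomial.simps(3)
    by (intro arg_cong2[of _ _ _ _ "(+)"] refl sum.cong) (simp only: distrib_left mult_ac add_ac)
  also have "\<dots> = (\<Sum>k\<le>Suc m. ?c k * u ^ (Suc m - k) * ?g (Suc m) k)"
    by (subst sum.atMost_Suc_shift) (simp add: numeral_2_eq_2)
  finally show ?case .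
qed (simp add: numeral_2_eq_2)

definition fpoch :: "'a::comm_ring_1 \<Rightarrow> nat \<Rightarrow> 'a" where
  "fpoch x n = (\<Prod>i<n. 1 - x ^ Suc i)"

lemma fpoch_simps [simp]: "fpoch x 0 = 1" "fpoch x (Suc n) = fpoch x n * (1 - x ^ Suc n)"
  by (simp_all add: fpoch_def)

text \<open>The two parts of Pascal's rule contribute \<open>1 - x^(k+1)\<close> and
  \<open>x^(k+1) (1 - x^(n-k))\<close>, which add up to \<open>1 - x^(n+1)\<close>.\<close>

lemma gauss_binomial_fpoch:
  "k \<le> n \<Longrightarrow> gauss_binomial x n k * (fpoch x k * fpoch x (n - k)) = fpoch x n"
proof (induction x n k rule: gauss_binomial.induct)
  case (3 x n k)
  let ?g = "gauss_binomial x"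
  have a: "?g n k * (fpoch x k * fpoch x (n - k)) = fpoch x n" using 3 by simp
  have b: "?g n (Suc k) * (fpoch x (Suc k) * fpoch x (n - k)) = fpoch x n * (1 - x ^ (n - k))"
  proof (cases "k = n")
    case True then show ?thesis by (simp add: gauss_binomial_eq_0)
  next
    case False
    then have "n - k = Suc (n - Suc k)" using 3 by simp
    then have "?g n (Suc k) * (fpoch x (Suc k) * fpoch x (n - k)) = (?g n (Suc k) * (fpoch x (Suc k) * fpoch x (n - Suc k))) * (1 - x ^ (n - k))"
      by (simp del: fpoch_simps(2) power_Suc add: fpoch_simps(2)[of x "n - Suc k"] mult.assoc)
    also have "?g n (Suc k) * (fpoch x (Suc k) * fpoch x (n - Suc k)) = fpoch x n" using 3 False by simp
    finally show ?thesis .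
  qed
  have p: "x ^ Suc k * x ^ (n - k) = x ^ Suc n"
  proof -
    have "Suc k + (n - k) = Suc n" using 3(3) by simp
    then show ?thesis by (simp only: power_add[symmetric])
  qed
  have "?g (Suc n) (Suc k) * (fpoch x (Suc k) * fpoch x (Suc n - Suc k))
      = (?g n k * (fpoch x k * fpoch x (n - k))) * (1 - x ^ Suc k) + x ^ Suc k * (?g n (Suc k) * (fpoch x (Suc k) * fpoch x (n - k)))"
    by (simp add: algebra_simps)
  also have "\<dots> = fpoch x n * ((1 - x ^ Suc k) + x ^ Suc k * (1 - x ^ (n - k)))"
    unfolding a b by (simp add: algebra_simps)
  also have "(1 - x ^ Suc k) + x ^ Suc k * (1 - x ^ (n - k)) = 1 - x ^ Suc n"
    unfolding right_diff_distrib p by simp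
  finally show ?case by simp
qed simp_all

abbreviation Euler :: "nat \<Rightarrow> rat fps" where "Euler b \<equiv> qpoch (- 1) b b"

lemma fpoch_X_power: "fpoch (fps_X ^ b :: rat fps) n = (\<Prod>i<n. 1 + (- 1) * fps_X ^ (b * i + b))"
  unfolding fpoch_def by (rule prod.cong) (simp_all add: add.commute flip: power_mult power_Suc)

lemma fpoch_nth_0: "b > 0 \<Longrightarrow> fps_nth (fpoch (fps_X ^ b :: rat fps) n) 0 = 1"
  unfolding fpoch_X_power by (simp add: fps_prod_nth_0 fps_X_power_mult_right_nth)

lemma flim_fpoch: "b > 0 \<Longrightarrow> flim (fpoch (fps_X ^ b)) (Euler b)"
  using flim_qpoch[of b b "- 1"] unfolding fpoch_X_power .

lemma gauss_binomial_eq: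
  assumes "k \<le> n" "b > 0"
  shows "gauss_binomial (fps_X ^ b :: rat fps) n k
    = fpoch (fps_X ^ b) n * (inverse (fpoch (fps_X ^ b) k) * inverse (fpoch (fps_X ^ b) (n - k)))"
proof -
  have i: "fpoch (fps_X ^ b :: rat fps) j * inverse (fpoch (fps_X ^ b) j) = 1" for j
    using inverse_mult_eq_1'[of "fpoch (fps_X ^ b :: rat fps) j"] fpoch_nth_0[OF assms(2)] by simp
  have "gauss_binomial (fps_X ^ b :: rat fps) n k = gauss_binomial (fps_X ^ b) n k *
      ((fpoch (fps_X ^ b) k * inverse (fpoch (fps_X ^ b) k)) * (fpoch (fps_X ^ b) (n - k) * inverse (fpoch (fps_X ^ b) (n - k))))"
    by (simp add: i)
  also have "\<dots> = (gauss_binomial (fps_X ^ b) n k * (fpoch (fps_X ^ b) k * fpoch (fps_X ^ b) (n - k))) *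
      (inverse (fpoch (fps_X ^ b) k) * inverse (fpoch (fps_X ^ b) (n - k)))"
    by (simp only: mult_ac)
  finally show ?thesis unfolding gauss_binomial_fpoch[OF assms(1)] .
qed

text \<open>The exponents of the triple product with factors \<open>q^(b i + c)\<close> and \<open>q^(b i + b - c)\<close>.\<close>

definition jexp :: "nat \<Rightarrow> nat \<Rightarrow> int \<Rightarrow> nat" where
  "jexp b c j = nat (int b * (j * (j - 1) div 2) + int c * j)"

lemma jexp:
  assumes "c < b"
  shows "2 * int (jexp b c j) = int b * (j * (j - 1)) + 2 * int c * j"
proof -
  have e: "2 * (j * (j - 1) div 2) = j * (j - 1)" by simp
  have "0 \<le> int b * (j * (j - 1) div 2) + int c * j"
  proof (cases "j \<ge> 0")
    case True
    then have "0 \<le> j * (j - 1)" by (cases "j = 0") auto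
    then show ?thesis using True by (intro add_nonneg_nonneg mult_nonneg_nonneg) auto
  next
    case False
    define m where "m = - j"
    have m: "m \<ge> 1" using False by (simp add: m_def)
    have "2 * m \<le> (m + 1) * m" using m by (intro mult_right_mono) auto
    also have "(m + 1) * m = j * (j - 1)" by (simp add: m_def algebra_simps)
    finally have "m \<le> j * (j - 1) div 2" by linarith
    then have "int b * m \<le> int b * (j * (j - 1) div 2)" by (intro mult_left_mono) auto
    moreover have "int c * m \<le> int b * m" using assms m by (intro mult_right_mono) auto
    ultimately show ?thesis by (simp add: m_def)
  qed
  then show ?thesis unfolding jexp_def using e by (simp add: algebra_simps)
qed

lemma jexp_ge:
  assumes "0 < c" "c < b" shows "\<bar>j\<bar> \<le> int (jexp b c j)"
proof -
  define B C where "B = int b" and "C = int c"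
  have BC: "C \<ge> 1" "C \<le> B - 1" using assms by (auto simp: B_def C_def)
  have j: "2 * int (jexp b c j) = B * (j * (j - 1)) + 2 * C * j" using jexp[OF assms(2)] by (simp add: B_def C_def)
  show ?thesis
  proof (cases "j \<ge> 0")
    case True
    then have "0 \<le> B * (j * (j - 1))" using BC by (cases "j = 0") auto
    moreover have "1 * j \<le> C * j" using BC True by (intro mult_right_mono) auto
    ultimately show ?thesis using True j by simp
  next
    case False
    define m where "m = - j"
    have m: "m \<ge> 1" using False by (simp add: m_def)
    have j': "2 * int (jexp b c j) = B * (m * (m + 1)) - 2 * C * m" unfolding j by (simp add: m_def algebra_simps)
    have "2 * m \<le> (m + 1) * m" using m by (intro mult_right_mono) auto
    then have "B * (2 * m) \<le> B * (m * (m + 1))" using BC by (intro mult_left_mono) (auto simp: mult.commute)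
    moreover have "C * m \<le> (B - 1) * m" using BC m by (intro mult_right_mono) auto
    ultimately have "2 * m \<le> 2 * int (jexp b c j)" using j' by (simp add: algebra_simps)
    then show ?thesis using False by (simp add: m_def)
  qed
qed

lemma power_sign_cong:
  fixes s :: "'a::comm_monoid_mult"
  assumes "s * s = 1" "even (m + n)" shows "s ^ m = s ^ n"
proof -
  have 2: "s ^ (2 * k) = 1" for k using assms(1) by (simp add: power_mult power2_eq_square)
  show ?thesis
  proof (cases "even m")
    case True then show ?thesis using assms(2) 2 by (auto elim!: evenE)
  next
    case False then show ?thesis using assms(2) 2 by (auto elim!: oddE evenE)
  qed
qed

lemma prod_lessThan_add: "(\<Prod>i<n + k. f i) = (\<Prod>i<n. f i) * (\<Prod>i<k. f (n + i))" for f :: "nat \<Rightarrow> 'a::comm_monoid_mult"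
  by (induction k) (simp_all add: mult_ac)

text \<open>The q-binomial theorem with \<open>2 n\<close> factors, \<open>x = q^b\<close>,
  \<open>z = s q^c\<close> and \<open>u = q^(b n)\<close>, which avoids negative powers. The first
  \<open>n\<close> factors, reversed, are monomials times \<open>1 + s q^(b i + b - c)\<close>; the
  last \<open>n\<close> are \<open>q^(b n)\<close> times \<open>1 + s q^(b i + c)\<close>. The
  monomials combine to \<open>s^n q^E\<close> and cancel.\<close>

lemma finite_triple_product:
  fixes s :: "rat fps"
  assumes c: "0 < c" "c < b" and s: "s * s = 1"
  shows "(\<Prod>i<n. 1 + s * fps_X ^ (b * i + (b - c))) * (\<Prod>i<n. 1 + s * fps_X ^ (b * i + c))
    = (\<Sum>k\<le>2 * n. s ^ (n + k) * fps_X ^ jexp b c (int k - int n) * gauss_binomial (fps_X ^ b) (2 * n) k)"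
proof -
  define S where "S = (\<Sum>i<n. c + b * i)"
  have S: "2 * int S = 2 * int c * int n + int b * (int n * (int n - 1))"
    unfolding S_def by (induction n) (simp_all add: algebra_simps)
  have s0: "s \<noteq> 0" using s by auto
  let ?f = "\<lambda>i. fps_X ^ (b * n) + (s * fps_X ^ c) * (fps_X ^ b) ^ i :: rat fps"
  have p1: "(\<Prod>i<n. ?f i) = s ^ n * fps_X ^ S * (\<Prod>i<n. 1 + s * fps_X ^ (b * i + (b - c)))"
  proof -
    have e: "?f (n - Suc i) = (s * fps_X ^ (c + b * (n - Suc i))) * (1 + s * fps_X ^ (b * i + (b - c)))" if "i < n" for i
    proof -
      have "b * n = b * (n - Suc i) + b * Suc i" using that by (subst distrib_left[symmetric]) simp
      then have bn: "b * n = (c + b * (n - Suc i)) + (b * i + (b - c))" using c by simp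
      have "(s * fps_X ^ (c + b * (n - Suc i))) * (1 + s * fps_X ^ (b * i + (b - c)))
          = s * fps_X ^ (c + b * (n - Suc i)) + (s * s) * fps_X ^ ((c + b * (n - Suc i)) + (b * i + (b - c)))"
        by (simp only: power_add distrib_left mult_1_right mult_1_left mult_ac)
      also have "\<dots> = fps_X ^ (b * n) + (s * fps_X ^ c) * (fps_X ^ b) ^ (n - Suc i)"
        unfolding bn[symmetric] s by (simp add: power_add mult_ac flip: power_mult)
      finally show ?thesis by simp
    qed
    have "(\<Prod>i<n. ?f i) = (\<Prod>i<n. ?f (n - Suc i))" by (rule prod.nat_diff_reindex[symmetric])
    also have "\<dots> = (\<Prod>i<n. (s * fps_X ^ (c + b * (n - Suc i))) * (1 + s * fps_X ^ (b * i + (b - c))))"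
      by (rule prod.cong) (use e in auto)
    also have "\<dots> = (\<Prod>i<n. s * fps_X ^ (c + b * (n - Suc i))) * (\<Prod>i<n. 1 + s * fps_X ^ (b * i + (b - c)))"
      by (rule prod.distrib)
    also have "(\<Prod>i<n. s * fps_X ^ (c + b * (n - Suc i))) = (\<Prod>i<n. s * fps_X ^ (c + b * i))"
      by (rule prod.nat_diff_reindex)
    also have "\<dots> = s ^ n * fps_X ^ S"
      unfolding S_def prod.distrib by (simp add: power_sum)
    finally show ?thesis .
  qed
  have p2: "(\<Prod>i<n. ?f (n + i)) = fps_X ^ (b * n * n) * (\<Prod>i<n. 1 + s * fps_X ^ (b * i + c))"
  proof -
    have "?f (n + i) = fps_X ^ (b * n) * (1 + s * fps_X ^ (b * i + c))" for i
      by (simp add: power_add power_mult algebra_simps)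
    then have "(\<Prod>i<n. ?f (n + i)) = (\<Prod>i<n. fps_X ^ (b * n) * (1 + s * fps_X ^ (b * i + c)))" by simp
    then show ?thesis unfolding prod.distrib by (simp add: power_mult)
  qed
  define E where "E = S + b * n * n"
  have "s ^ n * fps_X ^ E * ((\<Prod>i<n. 1 + s * fps_X ^ (b * i + (b - c))) * (\<Prod>i<n. 1 + s * fps_X ^ (b * i + c))) = (\<Prod>i<n + n. ?f i)"
    unfolding prod_lessThan_add p1 p2 E_def by (simp only: power_add mult_ac)
  also have "\<dots> = (\<Sum>k\<le>2 * n. (fps_X ^ b) ^ (k choose 2) * (s * fps_X ^ c) ^ k * (fps_X ^ (b * n)) ^ (2 * n - k) * gauss_binomial (fps_X ^ b) (2 * n) k)"
    unfolding mult_2[symmetric] by (rule q_binomial)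
  also have "\<dots> = (\<Sum>k\<le>2 * n. s ^ n * fps_X ^ E * (s ^ (n + k) * fps_X ^ jexp b c (int k - int n) * gauss_binomial (fps_X ^ b) (2 * n) k))"
  proof (rule sum.cong[OF refl])
    fix k assume "k \<in> {..2 * n}"
    then have k: "k \<le> 2 * n" by simp
    have ch: "2 * int (k choose 2) = int k * (int k - 1)"
      by (induction k) (simp_all add: choose_two_Suc algebra_simps)
    have "2 * int (b * (k choose 2) + c * k + b * n * (2 * n - k)) = int b * (2 * int (k choose 2)) + 2 * int c * int k + 2 * int b * int n * (2 * int n - int k)"
    proof -
      have d: "int (2 * n - k) = 2 * int n - int k" using k by simp
      show ?thesis unfolding of_nat_add of_nat_mult d by (simp add: algebra_simps)
    qed
    also have "\<dots> = 2 * int (E + jexp b c (int k - int n))"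
      unfolding ch E_def using S jexp[OF c(2), of "int k - int n"] by (simp add: algebra_simps)
    finally have e: "b * (k choose 2) + c * k + b * n * (2 * n - k) = E + jexp b c (int k - int n)"
      by (simp only: mult_cancel_left of_nat_eq_iff) simp
    have "s ^ n * s ^ (n + k) = s ^ k"
      unfolding power_add[symmetric] by (rule power_sign_cong[OF s]) presburger
    then have "s ^ n * fps_X ^ E * (s ^ (n + k) * fps_X ^ jexp b c (int k - int n)) = s ^ k * fps_X ^ (E + jexp b c (int k - int n))"
      by (simp add: power_add mult_ac)
    also have "\<dots> = (fps_X ^ b) ^ (k choose 2) * (s * fps_X ^ c) ^ k * (fps_X ^ (b * n)) ^ (2 * n - k)"
      unfolding e[symmetric] by (simp only: power_mult_distrib power_add power_mult mult_ac)
    finally have f: "s ^ n * fps_X ^ E * (s ^ (n + k) * fps_X ^ jexp b c (int k - int n)) = (fps_X ^ b) ^ (k choose 2) * (s * fps_X ^ c) ^ k * (fps_X ^ (b * n)) ^ (2 * n - k)" .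
    show "(fps_X ^ b) ^ (k choose 2) * (s * fps_X ^ c) ^ k * (fps_X ^ (b * n)) ^ (2 * n - k) * gauss_binomial (fps_X ^ b) (2 * n) k
      = s ^ n * fps_X ^ E * (s ^ (n + k) * fps_X ^ jexp b c (int k - int n) * gauss_binomial (fps_X ^ b) (2 * n) k)"
      unfolding f[symmetric] by (simp only: mult_ac)
  qed
  finally show ?thesis
    unfolding sum_distrib_left[symmetric] using s0 by (simp only: mult_cancel_left mult_eq_0_iff power_eq_0_iff fps_X_neq_zero simp_thms)
qed

text \<open>Limit of \<open>finite_triple_product\<close> with the index centred at
  \<open>j = k - n\<close>: the Gaussian binomial tends to the inverse of Euler's product, and
  \<open>jexp\<close> supplies the bound on orders for \<open>flim_fsum\<close>.\<close>

theorem triple_product: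
  fixes s :: "rat fps"
  assumes c: "0 < c" "c < b" and s: "s * s = 1"
  shows "fsum UNIV (\<lambda>j. s ^ nat \<bar>j\<bar> * fps_X ^ jexp b c j) = qpoch s b c * qpoch s b (b - c) * Euler b"
proof -
  define F where "F N j = (if \<bar>j\<bar> \<le> int N then s ^ nat \<bar>j\<bar> * fps_X ^ jexp b c j * gauss_binomial (fps_X ^ b) (2 * N) (nat (int N + j)) else 0)" for N j
  have fin: "finite {j \<in> UNIV. jexp b c j \<le> n}" for n
  proof (rule finite_subset)
    show "{j \<in> UNIV. jexp b c j \<le> n} \<subseteq> {- int n..int n}"
    proof
      fix j assume "j \<in> {j \<in> UNIV. jexp b c j \<le> n}"
      then show "j \<in> {- int n..int n}" using jexp_ge[OF c, of j] by auto
    qed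
  qed simp
  have F: "fsum UNIV (F N) = (\<Prod>i<N. 1 + s * fps_X ^ (b * i + (b - c))) * (\<Prod>i<N. 1 + s * fps_X ^ (b * i + c))" for N
  proof -
    have b': "bij_betw (\<lambda>k. int k - int N) {..2 * N} {- int N..int N}"
      by (rule bij_betwI[of _ _ _ "\<lambda>j. nat (j + int N)"]) auto
    have "fsum UNIV (F N) = fsum {- int N..int N} (F N)"
      unfolding fsum_def by (intro arg_cong[of _ _ Abs_fps] ext sum.cong) (auto simp: F_def)
    also have "\<dots> = sum (F N) {- int N..int N}" by (rule fsum_finite) simp
    also have "\<dots> = (\<Sum>k\<le>2 * N. F N (int k - int N))" by (rule sum.reindex_bij_betw[OF b', symmetric])
    also have "\<dots> = (\<Sum>k\<le>2 * N. s ^ (N + k) * fps_X ^ jexp b c (int k - int N) * gauss_binomial (fps_X ^ b) (2 * N) k)"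
    proof (rule sum.cong[OF refl])
      fix k assume k: "k \<in> {..2 * N}"
      have "even (nat \<bar>int k - int N\<bar> + (N + k))"
        by (cases "k \<ge> N") (auto simp: nat_diff_distrib' abs_if)
      then have "s ^ nat \<bar>int k - int N\<bar> = s ^ (N + k)" by (rule power_sign_cong[OF s])
      then show "F N (int k - int N) = s ^ (N + k) * fps_X ^ jexp b c (int k - int N) * gauss_binomial (fps_X ^ b) (2 * N) k"
        using k by (simp add: F_def)
    qed
    finally show ?thesis unfolding finite_triple_product[OF c s] .
  qed
  have lim: "flim (\<lambda>N. F N j) ((s ^ nat \<bar>j\<bar> * fps_X ^ jexp b c j) * (Euler b * (inverse (Euler b) * inverse (Euler b))))" for j
  proof -
    have E: "flim (fpoch (fps_X ^ b)) (Euler b)" using c by (intro flim_fpoch) simp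
    have i: "flim (\<lambda>N. inverse (fpoch (fps_X ^ b) (t N))) (inverse (Euler b))" if "\<And>M. \<exists>N0. \<forall>N\<ge>N0. M \<le> t N" for t
      by (rule flim_inverse[OF flim_reindex[OF E that]]) (use c fpoch_nth_0[of b] in auto)
    have t: "\<exists>N0. \<forall>N\<ge>N0. M \<le> 2 * N" "\<exists>N0. \<forall>N\<ge>N0. M \<le> nat (int N + j)" "\<exists>N0. \<forall>N\<ge>N0. M \<le> nat (int N - j)" for M :: nat
      by (rule exI[of _ "M + nat \<bar>j\<bar>"]; auto)+
    have "flim (\<lambda>N. (s ^ nat \<bar>j\<bar> * fps_X ^ jexp b c j) * (fpoch (fps_X ^ b) (2 * N) * (inverse (fpoch (fps_X ^ b) (nat (int N + j))) * inverse (fpoch (fps_X ^ b) (nat (int N - j))))))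
       ((s ^ nat \<bar>j\<bar> * fps_X ^ jexp b c j) * (Euler b * (inverse (Euler b) * inverse (Euler b))))"
      by (intro flim_mult flim_const i flim_reindex[OF E] t)
    then show ?thesis
    proof (rule flim_eventually[where ?N0.0 = "nat \<bar>j\<bar>"])
      fix N assume N: "nat \<bar>j\<bar> \<le> N"
      then have "2 * N - nat (int N + j) = nat (int N - j)" "nat (int N + j) \<le> 2 * N" by auto
      then show "(s ^ nat \<bar>j\<bar> * fps_X ^ jexp b c j) * (fpoch (fps_X ^ b) (2 * N) * (inverse (fpoch (fps_X ^ b) (nat (int N + j))) * inverse (fpoch (fps_X ^ b) (nat (int N - j))))) = F N j"
        using N c gauss_binomial_eq[of "nat (int N + j)" "2 * N" b] by (simp add: F_def)
    qed
  qed
  have L: "flim (\<lambda>N. fsum UNIV (F N)) (fsum UNIV (\<lambda>j. (s ^ nat \<bar>j\<bar> * fps_X ^ jexp b c j) * (Euler b * (inverse (Euler b) * inverse (Euler b)))))"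
  proof (rule flim_fsum[OF lim _ fin])
    fix N j k assume "k < jexp b c j"
    then show "fps_nth (F N j) k = 0"
      by (auto simp: F_def mult.assoc mult.left_commute[of _ "fps_X ^ _"] fps_X_power_mult_nth)
  qed
  have R: "flim (\<lambda>N. fsum UNIV (F N)) (qpoch s b (b - c) * qpoch s b c)"
    unfolding F by (rule flim_mult[OF flim_qpoch flim_qpoch]) (use c in auto)
  have l: "lfin UNIV (\<lambda>j. s ^ nat \<bar>j\<bar> * fps_X ^ jexp b c j)"
    by (rule lfin_X_power) (use fin in simp)
  have i: "Euler b * inverse (Euler b) = 1" by (rule inverse_mult_eq_1') simp
  have "fsum UNIV (\<lambda>j. s ^ nat \<bar>j\<bar> * fps_X ^ jexp b c j) * (Euler b * (inverse (Euler b) * inverse (Euler b))) = qpoch s b (b - c) * qpoch s b c"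
    using flim_unique[OF L R] fsum_mult_left[OF l, of "Euler b * (inverse (Euler b) * inverse (Euler b))"] by (simp add: mult.commute)
  then have "fsum UNIV (\<lambda>j. s ^ nat \<bar>j\<bar> * fps_X ^ jexp b c j) * (Euler b * inverse (Euler b)) * (Euler b * inverse (Euler b)) = qpoch s b (b - c) * qpoch s b c * Euler b"
    by (simp only: mult_ac)
  then show ?thesis by (simp add: i mult_ac)
qed

subsection \<open>The congruences for the Cesaro function\<close>

lemma qpoch_1_2_1: "qpoch s 2 1 = qpoch s 4 1 * qpoch s 4 3"
  using qpoch_split2[of 2 1 s] by (simp add: numeral_3_eq_3)

lemma Euler_2: "Euler 2 = qpoch (- 1) 4 2 * Euler 4"
  using qpoch_split2[of 2 2 "- 1"] by simp

lemma Euler_1: "Euler 1 = qpoch (- 1) 2 1 * Euler 2"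
  using qpoch_split2[of 1 1 "- 1"] by (simp add: numeral_2_eq_2)

lemma psi_product: "psi = qpoch 1 2 1 * Euler 4"
proof -
  \<comment> \<open>\<open>jexp 4 1 j = j (2 j - 1)\<close> is the triangular number of
    \<open>2 j - 1\<close> and of \<open>- 2 j\<close>; \<open>h\<close> picks the nonnegative one
    and so hits every natural number once.\<close>
  define h where "h j = nat (if j > 0 then 2 * j - 1 else - 2 * j)" for j :: int
  have b: "bij_betw h UNIV UNIV"
  proof (rule bij_betwI[of _ _ _ "\<lambda>l. if odd l then (int l + 1) div 2 else - (int l div 2)"])
    fix j show "(if odd (h j) then (int (h j) + 1) div 2 else - (int (h j) div 2)) = j"
      by (cases "j > 0") (auto simp: h_def even_nat_iff)
  next
    fix l show "h (if odd l then (int l + 1) div 2 else - (int l div 2)) = l"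
      by (cases "odd l") (auto simp: h_def elim!: oddE evenE)
  qed auto
  have e: "tri (int (h j)) = jexp 4 1 j" for j
  proof -
    have "2 * int (tri (int (h j))) = 2 * int (jexp 4 1 j)"
      using two_tri[of "int (h j)"] jexp[of 1 4 j] by (auto simp: h_def algebra_simps)
    then show ?thesis by simp
  qed
  have "psi = fsum UNIV (\<lambda>j. 1 ^ nat \<bar>j\<bar> * fps_X ^ jexp 4 1 j)"
    unfolding psi_def by (rule fsum_reindex_bij[OF b]) (simp add: e)
  also have "\<dots> = qpoch 1 4 1 * qpoch 1 4 3 * Euler 4"
    by (subst triple_product) simp_all
  finally show ?thesis unfolding qpoch_1_2_1 .
qed

lemma phi_product: "theta_even (\<lambda>_. 1) = qpoch 1 2 1 ^ 2 * Euler 2"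
proof -
  have e: "jexp 2 1 j = nat (j\<^sup>2)" for j
    by (simp add: jexp_def power2_eq_square algebra_simps)
  show ?thesis
    using triple_product[of 1 2 1, unfolded e] by (simp add: theta_even_def power2_eq_square)
qed

lemma Euler_1_pentagonal: "Euler 1 = fsum UNIV (\<lambda>j. (- 1) ^ nat \<bar>j\<bar> * fps_X ^ jexp 3 1 j)"
proof -
  have "Euler 1 = qpoch (- 1) 3 1 * qpoch (- 1) 3 2 * Euler 3"
    using qpoch_split3[of 1 1 "- 1"] by (simp add: eval_nat_numeral)
  then show ?thesis using triple_product[of 1 3 "- 1"] by simp
qed

lemma Euler_1_nth_eq_0:
  assumes "n mod 5 = 3 \<or> n mod 5 = 4" shows "fps_nth (Euler 1) n = 0"
proof -
  have "jexp 3 1 j \<noteq> n" for j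
  proof
    assume n: "jexp 3 1 j = n"
    have e: "2 * int n = 3 * (j * (j - 1)) + 2 * j" using jexp[of 1 3 j] n by simp
    \<comment> \<open>With \<open>j = 5 q + r\<close>, \<open>2 n = 3 j^2 - j\<close> is 0, 2 or 4
      modulo 5, so \<open>n\<close> is 0, 1 or 2.\<close>
    define q r where "q = j div 5" and "r = j mod 5"
    have j: "j = 5 * q + r" by (simp add: q_def r_def)
    have "2 * int n = 5 * (15 * q * q + 6 * q * r - q) + (3 * r * r - r)"
      unfolding e j by (simp add: algebra_simps)
    moreover have "r \<in> {0, 1, 2, 3, 4}" unfolding r_def by auto
    moreover define K where "K = 15 * q * q + 6 * q * r - q"
    ultimately have "2 * int n = 5 * K \<or> 2 * int n = 5 * K + 2 \<or> 2 * int n = 5 * K + 10 \<or> 2 * int n = 5 * K + 24 \<or> 2 * int n = 5 * K + 44"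
      by auto
    then show False using assms by presburger
  qed
  then show ?thesis
    unfolding Euler_1_pentagonal by (subst fsum_nth[of "{}"]) (auto simp: minus_one_power_iff)
qed

lemma flim_imp_LIMSEQ: "flim F G \<Longrightarrow> F \<longlonglongrightarrow> G"
  unfolding flim_def by (rule tendsto_fpsI) (simp add: eventually_sequentially)

lemma cesaro_prod_eq: "cesaro_prod = qpoch (- 1) 2 1 * inverse (Euler 2)"
proof (rule LIMSEQ_unique[OF cesaro_prod_LIMSEQ flim_imp_LIMSEQ])
  have "flim (\<lambda>N. (\<Prod>i<Suc N. 1 + (- 1) * fps_X ^ (2 * i + 1)) * inverse (\<Prod>i<Suc N. 1 + (- 1) * fps_X ^ (2 * i + 2)) :: rat fps) (qpoch (- 1) 2 1 * inverse (Euler 2))"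
    by (intro flim_mult flim_inverse flim_subseq[OF flim_qpoch]) (simp_all add: fps_prod_nth_0 fps_X_power_mult_right_nth)
  moreover have "(\<Prod>m\<le>N. (1 - fps_X ^ (2 * m + 1)) / (1 - fps_X ^ (2 * m + 2))) = (\<Prod>i<Suc N. 1 + (- 1) * fps_X ^ (2 * i + 1)) * inverse (\<Prod>i<Suc N. 1 + (- 1) * fps_X ^ (2 * i + 2) :: rat fps)" for N
    unfolding lessThan_Suc_atMost
    by (induction N) (simp_all add: fps_divide_unit fps_inverse_mult mult_ac)
  ultimately show "flim (\<lambda>N. \<Prod>m\<le>N. (1 - fps_X ^ (2 * m + 1)) / (1 - fps_X ^ (2 * m + 2))) (qpoch (- 1) 2 1 * inverse (Euler 2))"
    by simp
qed

text \<open>Gauss's product for psi is inverse to the product in the Cesaro function, so that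
  product is a division by theta at \<open>w = 0\<close>, up to the factor 2.\<close>

lemma cesaro_prod_psi: "cesaro_prod * psi = 1"
proof -
  have "Euler 2 * inverse (Euler 2) = 1" by (rule inverse_mult_eq_1') simp
  moreover have "qpoch (- 1) 2 1 * qpoch 1 2 1 * Euler 4 = Euler 2"
    using qpoch_plus_minus[of 2 1] by (simp add: Euler_2 mult.commute)
  moreover have "cesaro_prod * psi = (qpoch (- 1) 2 1 * qpoch 1 2 1 * Euler 4) * inverse (Euler 2)"
    unfolding cesaro_prod_eq psi_product by (simp only: mult_ac)
  ultimately show ?thesis by simp
qed

lemma lfin_Pmon_row: "lfin UNIV (\<lambda>i. Pmon (Suc n) i :: rat fps)"
  unfolding Pmon_def
proof (rule lfin_X_power)
  fix m
  have "{i. tri (int (Suc n)) + Suc n * i \<le> m} \<subseteq> {..m}"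
  proof
    fix i assume "i \<in> {i. tri (int (Suc n)) + Suc n * i \<le> m}"
    moreover have "i \<le> Suc n * i" by simp
    ultimately show "i \<in> {..m}" by (simp only: mem_Collect_eq atMost_iff)
  qed
  then show "finite {i \<in> UNIV. tri (int (Suc n)) + Suc n * i \<le> m}" by (simp add: finite_subset)
qed

text \<open>Geometric series, obtained from the functional equation
  \<open>S = Pmon (Suc n) 0 - q^(n+1) S\<close>.\<close>

lemma cesaro_term_Suc: "cesaro_term (Suc n) = fsum UNIV (Pmon (Suc n))"
proof -
  define S :: "rat fps" where "S = fsum UNIV (Pmon (Suc n))"
  have t: "tri (int (Suc n)) = Suc n * (Suc n + 1) div 2"
  proof -
    have "2 * int (tri (int (Suc n))) = int (Suc n * (Suc n + 1))" using two_tri[of "int (Suc n)"] by (simp only: of_nat_mult of_nat_add of_nat_1)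
    then show ?thesis by linarith
  qed
  have "S = Pmon (Suc n) 0 + fsum UNIV (\<lambda>i. Pmon (Suc n) (Suc i))"
    unfolding S_def by (rule fsum_nat_shift) (use lfin_Pmon_row in simp)
  also have "fsum UNIV (\<lambda>i. Pmon (Suc n) (Suc i)) = fsum UNIV (\<lambda>i. (- (fps_X ^ Suc n)) * Pmon (Suc n) i)"
    by (rule fsum_cong[OF refl]) (simp add: Pmon_def power_add mult_ac)
  also have "\<dots> = (- (fps_X ^ Suc n)) * S"
    unfolding S_def by (rule fsum_mult_left) (use lfin_Pmon_row in simp)
  finally have S: "S = Pmon (Suc n) 0 + (- (fps_X ^ Suc n)) * S" .
  have "S * (1 + fps_X ^ Suc n) = S + fps_X ^ Suc n * S" by (simp only: distrib_left mult_1_right mult.commute[of S "fps_X ^ Suc n"])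
  also have "\<dots> = Pmon (Suc n) 0" by (subst (1) S) (simp only: add.assoc mult_minus_left, simp)
  also have "\<dots> = fps_X ^ (Suc n * (Suc n + 1) div 2)" unfolding Pmon_def t by simp
  finally have SU: "S * (1 + fps_X ^ Suc n) = fps_X ^ (Suc n * (Suc n + 1) div 2)" .
  have "fps_X ^ (Suc n * (Suc n + 1) div 2) * inverse (1 + fps_X ^ Suc n) = S * ((1 + fps_X ^ Suc n) * inverse (1 + fps_X ^ Suc n))"
    unfolding SU[symmetric] by (rule mult.assoc)
  also have "(1 + fps_X ^ Suc n) * inverse (1 + fps_X ^ Suc n) = (1 :: rat fps)"
    by (rule inverse_mult_eq_1') simp
  finally show ?thesis
    unfolding cesaro_term_def S_def by (subst fps_divide_unit) simp_all
qed

lemma sum_symmetric_interval: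
  "(\<Sum>n\<in>{- int k..int k}. f (nat \<bar>n\<bar>)) = f 0 + (\<Sum>n<k. 2 * f (Suc n) :: rat)"
proof (induction k)
  case (Suc m)
  have "{- int (Suc m)..int (Suc m)} = insert (int (Suc m)) (insert (- int (Suc m)) {- int m..int m})" by auto
  then show ?case using Suc by (simp add: nat_add_distrib)
qed simp

text \<open>At \<open>w = 0\<close> the two exponentials of a term add up to 2, matching the indices
  \<open>n\<close> and \<open>- n\<close>, and \<open>sechw\<close> gives the 1/2 of index 0.
  Indices up to \<open>k\<close> suffice at the coefficient \<open>k\<close>, because
  \<open>cesaro_term m\<close> starts at \<open>q^m\<close> or later.\<close>

lemma cesaro_sum_eq: "cesaro_sum = moment 0 Appell_total"
proof (rule fps_ext)
  fix k
  have "Appell expw = fsum UNIV (\<lambda>(n, i). Pmon (Suc n) i * fps_const (expw (2 * int (Suc n + i) + 1) + expw (- (2 * int (Suc n + i) + 1))))"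
    by (simp add: Appell_def)
  then have "wcoeff 0 (Appell expw) = fsum UNIV (\<lambda>x. wcoeff 0 (case x of (n, i) \<Rightarrow> Pmon (Suc n) i * fps_const (expw (2 * int (Suc n + i) + 1) + expw (- (2 * int (Suc n + i) + 1)))))"
    by (simp only: wcoeff_fsum[OF lfin_Pmon])
  also have "\<dots> = fsum (UNIV \<times> UNIV) (\<lambda>(n, i). Pmon (Suc n) i * 2)"
    by (rule fsum_cong) (auto simp: fps_eq_iff Pmon_def minus_one_power_iff expw_def numeral_fps_const)
  also have "\<dots> = fsum UNIV (\<lambda>n. fsum UNIV (\<lambda>i. Pmon (Suc n) i * 2))"
    by (rule fsum_Sigma(1)) (use lfin_Pmon[of "\<lambda>_ _. 2"] in simp)
  also have "\<dots> = fsum UNIV (\<lambda>n. 2 * cesaro_term (Suc n))"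
    unfolding cesaro_term_Suc using fsum_mult_left[OF lfin_Pmon_row, of 2] by (simp add: mult.commute)
  finally have "fps_nth (wcoeff 0 (Appell expw)) k = (\<Sum>n<k. 2 * fps_nth (cesaro_term (Suc n)) k)"
    by (simp only:) (subst fsum_nth[of "{..<k}"], simp_all only: fps_nth_numeral_mult, simp_all add: cesaro_term_nth_eq_0)
  moreover have "(\<Sum>n\<in>{- int k..int k}. fps_nth (cesaro_term (nat \<bar>n\<bar>)) k) = fps_nth (cesaro_term 0) k + (\<Sum>n<k. 2 * fps_nth (cesaro_term (Suc n)) k)"
    by (rule sum_symmetric_interval)
  moreover have "cesaro_term 0 = wcoeff 0 (fps_const sechw)"
  proof -
    have "wcoeff 0 (fps_const sechw) = fps_const (1 / 2)"
      by (rule fps_ext) (simp add: sechw_def expw_def)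
    then show ?thesis
      by (simp add: cesaro_term_def fps_divide_unit numeral_fps_const fps_const_inverse inverse_eq_divide)
  qed
  ultimately show "fps_nth cesaro_sum k = fps_nth (moment 0 Appell_total) k"
    by (simp add: cesaro_sum_def fps_sum_nth moment_def Appell_total_def wcoeff_add)
qed

theorem a_cesaro_th: "Abs_fps (\<lambda>n. of_int (a_cesaro n)) * th 0 = 4 * moment 0 Appell_total"
proof -
  have "Abs_fps (\<lambda>n. of_int (a_cesaro n)) = 2 * cesaro_prod * cesaro_sum"
    using cesaro_fun_eq unfolding cesaro_fun_eq_fps fps_to_fls_eq_iff by simp
  then have "Abs_fps (\<lambda>n. of_int (a_cesaro n)) * th 0 = 4 * (cesaro_prod * psi) * cesaro_sum"
    unfolding th_0 by simp
  then show ?thesis by (simp add: cesaro_prod_psi cesaro_sum_eq)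
qed

lemma a_cesaro_3: "3 dvd a_cesaro (3 * n + 1)"
proof -
  have "3 dvd a_cesaro (3 * n + 1) * ((8 * int (3 * n + 1) - 1) ^ 2 + (8 * int (3 * n + 1) - 1))"
    by (rule Cesaro_dvd_3[OF refl a_cesaro_th])
  also have "(8 * int (3 * n + 1) - 1) ^ 2 + (8 * int (3 * n + 1) - 1) = 3 * (192 * int n ^ 2 + 120 * int n + 18) + 2"
    by (simp add: power2_eq_square algebra_simps)
  finally have "3 dvd a_cesaro (3 * n + 1) * 2 + 3 * (a_cesaro (3 * n + 1) * (192 * int n ^ 2 + 120 * int n + 18))"
    by (simp only: distrib_left mult_ac add.commute)
  then have "3 dvd a_cesaro (3 * n + 1) * 2" by (simp add: dvd_add_left_iff)
  then show ?thesis by (simp add: coprime_dvd_mult_left_iff)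
qed

text \<open>\<open>8 (7 n + r) - 1\<close> is congruent to \<open>r - 1\<close>, that is to 1, 2 or
  4, the nonzero squares modulo 7. As \<open>- 1\<close> is not a square, these are not negatives of
  squares, and \<open>x^4 + x\<close> is invertible there.\<close>

lemma a_cesaro_7:
  assumes "r \<in> {2, 3, 5}" shows "7 dvd a_cesaro (7 * n + r)"
proof -
  define x where "x = 8 * int (7 * n + r) - 1"
  have x: "x mod 7 = (int r - 1) mod 7"
  proof -
    have "x = (int r - 1) + 7 * (8 * int n + int r)" by (simp add: x_def)
    then show ?thesis by (simp only: mod_mult_self2)
  qed
  have "(x ^ 4 + x) mod 7 = ((x mod 7) ^ 4 + x mod 7) mod 7"
  proof -
    have "[x = x mod 7] (mod 7)" by (simp add: cong_def)
    then have "[x ^ 4 + x = (x mod 7) ^ 4 + x mod 7] (mod 7)" by (intro cong_add cong_pow)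
    then show ?thesis by (simp only: cong_def)
  qed
  also have "\<dots> \<in> {1, 2, 4}" unfolding x using assms by auto
  finally have c: "coprime 7 (x ^ 4 + x)"
    using prime_imp_coprime[of 7 "x ^ 4 + x"] by (auto simp: dvd_eq_mod_eq_0)
  have "7 dvd a_cesaro (7 * n + r) * (x ^ 4 + x)"
    unfolding x_def by (rule Cesaro_dvd_7[OF refl a_cesaro_th])
  then show ?thesis using c by (simp add: coprime_dvd_mult_left_iff)
qed

subsection \<open>Partitions of unity from Lagrange interpolation\<close>

lemma lagrange_one:
  fixes u :: "'i \<Rightarrow> 'a::field"
  assumes "finite K" "K \<noteq> {}" "inj_on u K"
  shows "(\<Sum>k\<in>K. \<Prod>l\<in>K - {k}. (y - u l) / (u k - u l)) = 1"
proof -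
  define p where "p = (\<Sum>k\<in>K. smult (\<Prod>l\<in>K - {k}. 1 / (u k - u l)) (\<Prod>l\<in>K - {k}. [:- u l, 1:]))"
  have ev: "poly p x = (\<Sum>k\<in>K. \<Prod>l\<in>K - {k}. (x - u l) / (u k - u l))" for x
    unfolding p_def poly_sum poly_smult poly_prod prod.distrib[symmetric] by simp
  have "p = 1"
  proof (rule poly_eqI_degree[of "u ` K"])
    fix x assume "x \<in> u ` K"
    then obtain j where j: "j \<in> K" "x = u j" by auto
    have "(\<Prod>l\<in>K - {k}. (x - u l) / (u k - u l)) = (if k = j then 1 else 0)" if "k \<in> K" for k
    proof (cases "k = j")
      case True
      have "(\<Prod>l\<in>K - {j}. (u j - u l) / (u j - u l)) = 1"
        by (rule prod.neutral) (use j assms(3) in \<open>auto simp: inj_on_eq_iff\<close>)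
      then show ?thesis using True j by simp
    next
      case False
      then show ?thesis using j assms(1) by (auto intro!: prod_zero bexI[of _ j])
    qed
    then show "poly p x = poly 1 x" unfolding ev using j assms(1) by simp
  next
    have "degree p \<le> card K - 1"
      unfolding p_def
    proof (rule degree_sum_le[OF assms(1)])
      fix k assume "k \<in> K"
      have "degree (\<Prod>l\<in>K - {k}. [:- u l, 1:]) \<le> (\<Sum>l\<in>K - {k}. 1)"
        by (rule order_trans[OF degree_prod_sum_le]) (use assms(1) in auto)
      also have "\<dots> = card K - 1" using \<open>k \<in> K\<close> assms(1) by simp
      finally show "degree (smult (\<Prod>l\<in>K - {k}. 1 / (u k - u l)) (\<Prod>l\<in>K - {k}. [:- u l, 1:])) \<le> card K - 1"
        using degree_smult_le order_trans by blast
    qed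
    moreover have "card K > 0" using assms by (simp add: card_gt_0_iff)
    ultimately show "degree p < card (u ` K)" "degree 1 < card (u ` K)"
      using card_image[OF assms(3)] by auto
  qed
  then show ?thesis using ev[of y] by simp
qed

text \<open>
  Interpolation points \<open>u l = - s l (x^l + x^(-l))\<close> with signs \<open>s l\<close> and the argument 2: the quotient
  \<open>(2 - u l) / (u k - u l)\<close> is \<open>(1 + s l x^l)^2 * node_exp s l k / node_den s l k\<close>, where
  \<open>node_exp\<close> collects the factor that clears the negative power of \<open>x\<close>.
\<close>

definition node_exp :: "(nat \<Rightarrow> rat fps) \<Rightarrow> nat \<Rightarrow> nat \<Rightarrow> rat fps" where
  "node_exp s l k = (if k \<le> l then 1 else - (s l * s k) * fps_X ^ (k - l))"

definition node_den :: "(nat \<Rightarrow> rat fps) \<Rightarrow> nat \<Rightarrow> nat \<Rightarrow> rat fps" where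
  "node_den s l k = (1 - s l * s k * fps_X ^ (if k \<le> l then l - k else k - l)) * (1 - s l * s k * fps_X ^ (l + k))"

lemma node_den_nth_0: "l \<noteq> k \<Longrightarrow> fps_nth (node_den s l k) 0 = 1"
  unfolding node_den_def by (auto simp: fps_nth_mult_X_power_low)

text \<open>The negative powers force the computation into Laurent series, but the quotients are
  power series again. The nodes are distinct because \<open>u k - u l\<close> comes out
  nonzero.\<close>

lemma partition_of_unity:
  assumes "finite L" "L \<noteq> {}" and s: "\<And>l. s l = 1 \<or> s l = - 1"
  shows "(\<Sum>k\<in>L. \<Prod>l\<in>L - {k}. (1 + s l * fps_X ^ l)\<^sup>2 * node_exp s l k * inverse (node_den s l k)) = 1"
proof -
  define T :: "rat fls" where "T = fls_X"
  define S where "S l = fps_to_fls (s l)" for l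
  define u where "u l = - S l * (T ^ l + inverse T ^ l)" for l
  have T: "T \<noteq> 0" "\<And>l. T ^ l * inverse T ^ l = 1"
    by (simp_all add: T_def power_mult_distrib[symmetric])
  have SS: "S l * S l = 1" for l
    using s[of l] by (auto simp: S_def)
  define N where "N l = fps_to_fls ((1 + s l * fps_X ^ l)\<^sup>2)" for l
  \<comment> \<open>Inverse powers are abstracted to \<open>i\<close> with \<open>t * i = 1\<close>,
    which makes every identity polynomial.\<close>
  have ring:
    "t * i = 1 \<Longrightarrow> a * a = 1 \<Longrightarrow> 2 - - a * (t + i) = a * i * (1 + a * t)\<^sup>2"
    "t * i = 1 \<Longrightarrow> t' * i' = 1 \<Longrightarrow> a * a = 1 \<Longrightarrow> b * b = 1
      \<Longrightarrow> - b * (t' + i') - - a * (t + i) = a * i * ((1 - a * b * (t * t')) * (1 - a * b * (t * i')))"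
    "t * i = 1 \<Longrightarrow> 1 - c * (t * m * i) = 1 - c * m"
    "t * i = 1 \<Longrightarrow> 1 - c * (t * (i * m)) = 1 - c * m"
    "t * i = 1 \<Longrightarrow> c * c = 1 \<Longrightarrow> - c * t * (1 - c * i) = 1 - c * t"
    for t i t' i' a b c m :: "rat fls"
    by algebra+
  have num: "2 - u l = S l * inverse T ^ l * N l" for l
  proof -
    have "N l = (1 + S l * T ^ l)\<^sup>2"
      by (simp add: N_def fps_to_fls_power fps_to_fls_plus fls_times_fps_to_fls S_def T_def)
    then show ?thesis using ring(1)[OF T(2) SS, of l l] unfolding u_def by simp
  qed
  have key: "u k - u l \<noteq> 0 \<and> (2 - u l) / (u k - u l)
      = fps_to_fls ((1 + s l * fps_X ^ l)\<^sup>2 * node_exp s l k * inverse (node_den s l k))"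
    if "l \<noteq> k" for l k
  proof -
    define c where "c = S l * S k"
    have cc: "c * c = 1" using SS[of l] SS[of k] unfolding c_def by algebra
    define W where "W = 1 - c * (T ^ l * inverse T ^ k)"
    define D1 where "D1 = fps_to_fls (1 - s l * s k * fps_X ^ (if k \<le> l then l - k else k - l))"
    define D2 where "D2 = fps_to_fls (1 - s l * s k * fps_X ^ (l + k))"
    define E where "E = fps_to_fls (node_exp s l k)"
    have D2: "D2 = 1 - c * (T ^ l * T ^ k)"
      by (simp add: D2_def fps_to_fls_minus fls_times_fps_to_fls fps_to_fls_power S_def T_def c_def power_add)
    have den: "u k - u l = S l * inverse T ^ l * (D2 * W)"
      unfolding u_def D2 W_def c_def by (rule ring(2)[OF T(2) T(2) SS SS])
    have D1: "E * W = D1" and E: "E \<noteq> 0"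
    proof -
      have "E * W = D1 \<and> E \<noteq> 0"
      proof (cases "k \<le> l")
        case True
        then obtain m where m: "l = k + m" using le_Suc_ex by blast
        have "D1 = 1 - c * T ^ m"
          by (simp add: D1_def m fps_to_fls_minus fls_times_fps_to_fls fps_to_fls_power S_def T_def c_def)
        moreover have "W = 1 - c * T ^ m"
          unfolding W_def m power_add by (rule ring(3)[OF T(2)])
        ultimately show ?thesis using True by (simp add: E_def node_exp_def)
      next
        case False
        then have "k = l + (k - l)" by simp
        then obtain m where m: "k = l + m" by blast
        have m0: "m > 0" using False m by simp
        have d: "D1 = 1 - c * T ^ m"
          using m0 by (simp add: D1_def m fps_to_fls_minus fls_times_fps_to_fls fps_to_fls_power S_def T_def c_def)
        have w: "W = 1 - c * inverse T ^ m"
          unfolding W_def m power_add by (rule ring(4)[OF T(2)])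
        have e: "E = - c * T ^ m"
          using m0 by (simp add: E_def node_exp_def m fls_times_fps_to_fls fps_to_fls_power S_def T_def c_def)
        have "E * W = D1"
          unfolding d w e by (rule ring(5)[OF T(2) cc])
        moreover have "c \<noteq> 0" using cc by auto
        ultimately show ?thesis using e T(1) by simp
      qed
      then show "E * W = D1" "E \<noteq> 0" by auto
    qed
    have n0: "fps_nth (node_den s l k) 0 \<noteq> 0" using node_den_nth_0[OF that] by simp
    have dd: "fps_to_fls (node_den s l k) = D1 * D2"
      by (simp add: node_den_def D1_def D2_def fls_times_fps_to_fls)
    have nz: "D1 * D2 \<noteq> 0"
      unfolding dd[symmetric] using n0 by (metis fps_to_fls_eq_0_iff fps_zero_nth)
    have i: "fps_to_fls (inverse (node_den s l k)) * (D1 * D2) = 1"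
      unfolding dd[symmetric] fls_times_fps_to_fls[symmetric] using inverse_mult_eq_1[OF n0] by simp
    have nz2: "u k - u l \<noteq> 0"
      unfolding den using nz T(1) SS[of l] D1 by auto
    have "fps_to_fls ((1 + s l * fps_X ^ l)\<^sup>2 * node_exp s l k * inverse (node_den s l k)) * (u k - u l)
        = N l * E * fps_to_fls (inverse (node_den s l k)) * (S l * inverse T ^ l * (D2 * W))"
      unfolding den fls_times_fps_to_fls N_def E_def by simp
    also have "\<dots> = (S l * inverse T ^ l * N l) * (fps_to_fls (inverse (node_den s l k)) * ((E * W) * D2))"
      by algebra
    also have "\<dots> = 2 - u l" unfolding D1 i num by simp
    finally show ?thesis using nz2 by (simp add: nonzero_divide_eq_eq)
  qed
  have inj: "inj_on u L"
    by (rule inj_onI) (use key in force)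
  have "fps_to_fls (\<Sum>k\<in>L. \<Prod>l\<in>L - {k}. (1 + s l * fps_X ^ l)\<^sup>2 * node_exp s l k * inverse (node_den s l k))
      = (\<Sum>k\<in>L. \<Prod>l\<in>L - {k}. (2 - u l) / (u k - u l))"
    unfolding fps_to_fls_sum fps_to_fls_prod
    by (intro sum.cong prod.cong refl) (use key in auto)
  also have "\<dots> = fps_to_fls 1"
    using lagrange_one[OF assms(1,2) inj, of 2] by simp
  finally show ?thesis unfolding fps_to_fls_eq_iff .
qed

lemma prod_skip:
  fixes f :: "nat \<Rightarrow> 'a::comm_monoid_mult"
  assumes "k < N"
  shows "(\<Prod>i\<in>{..<N} - {k}. f i) = (\<Prod>i<k. f i) * (\<Prod>i<N - Suc k. f (Suc k + i))"
proof -
  have e: "{..<N} - {k} = {..<k} \<union> {Suc k..<N}" using assms by auto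
  have "(\<Prod>i\<in>{..<N} - {k}. f i) = (\<Prod>i<k. f i) * (\<Prod>i\<in>{Suc k..<N}. f i)"
    unfolding e by (rule prod.union_disjoint) auto
  also have "(\<Prod>i\<in>{Suc k..<N}. f i) = (\<Prod>i<N - Suc k. f (Suc k + i))"
    by (rule prod.reindex_bij_witness[of _ "\<lambda>i. Suc k + i" "\<lambda>i. i - Suc k"]) auto
  finally show ?thesis .
qed

lemma prod_lessThan_rev: "(\<Prod>i<n. f (n - i)) = (\<Prod>i<n. f (Suc i))" for f :: "nat \<Rightarrow> 'a::comm_monoid_mult"
proof -
  have "(\<Prod>i<n. f (n - i)) = (\<Prod>i<n. (\<lambda>i. f (Suc i)) (n - Suc i))"
    by (rule prod.cong) (auto simp: Suc_diff_Suc)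
  also have "\<dots> = (\<Prod>i<n. f (Suc i))" by (rule prod.nat_diff_reindex)
  finally show ?thesis .
qed

lemma fpoch_add: "fpoch x (m + n) = fpoch x m * (\<Prod>i<n. 1 - x ^ (Suc (m + i)))"
  unfolding fpoch_def by (rule prod_lessThan_add)

lemma fps_inverse_prod: "inverse (prod f A) = (\<Prod>i\<in>A. inverse (f i))" for f :: "'i \<Rightarrow> 'a::field fps"
  by (induction A rule: infinite_finite_induct) (auto simp: fps_inverse_mult)

lemma prod_minus_power: "(\<Prod>i<k. - (x ^ (2 * Suc i))) = (- 1) ^ k * x ^ (k * (k + 1))" for x :: "'a::comm_ring_1"
proof (induction k)
  case (Suc k)
  have "Suc k * (Suc k + 1) = k * (k + 1) + 2 * Suc k" by simp
  then show ?case unfolding prod.lessThan_Suc Suc by (simp only: power_add) (simp del: mult_Suc_right)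
qed simp

lemma fps_inverse_unit: "fps_nth F 0 = 1 \<Longrightarrow> F * inverse F = 1" for F :: "'a::field fps"
  by (rule inverse_mult_eq_1') simp

section \<open>Interpolation at the odd numbers\<close>

definition odd_block :: "nat \<Rightarrow> nat \<Rightarrow> rat fps" where
  "odd_block N n = (\<Prod>i\<in>{..<N} - {n}. (1 + (- 1) * fps_X ^ (2 * i + 1))\<^sup>2
      * node_exp (\<lambda>_. - 1) (2 * i + 1) (2 * n + 1) * inverse (node_den (\<lambda>_. - 1) (2 * i + 1) (2 * n + 1)))"

text \<open>The nodes below \<open>2 n + 1\<close> give the sign and
  \<open>q^(2 + 4 + ... + 2 n)\<close>. In base \<open>q^2\<close> the differences and sums of nodes
  fill \<open>fpoch\<close> up to \<open>N - Suc n\<close> and \<open>N + n\<close>, except for the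
  exponent \<open>2 n + 1\<close>, which would belong to the omitted node. This missing factor, over
  the square of the omitted \<open>1 - q^(2n+1)\<close>, gives the quotient in the middle.\<close>

lemma odd_block_eq:
  assumes "n < N"
  shows "odd_block N n = (\<Prod>i<N. 1 - fps_X ^ (2 * i + 1))\<^sup>2 * ((- 1) ^ n * fps_X ^ (n * (n + 1)))
      * ((1 + fps_X ^ (2 * n + 1)) * inverse (1 - fps_X ^ (2 * n + 1)))
      * (inverse (fpoch (fps_X\<^sup>2) (N - Suc n)) * inverse (fpoch (fps_X\<^sup>2) (N + n)))"
proof -
  let ?p = "fps_X\<^sup>2 :: rat fps"
  define j where "j = 2 * n + 1"
  define Q :: "rat fps" where "Q = (\<Prod>i<N. 1 - fps_X ^ (2 * i + 1))"
  define Q' :: "rat fps" where "Q' = (\<Prod>i\<in>{..<N} - {n}. 1 - fps_X ^ (2 * i + 1))"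
  define d :: "rat fps" where "d = (\<Prod>i\<in>{..<N} - {n}. node_den (\<lambda>_. - 1) (2 * i + 1) j)"
  define e :: "rat fps" where "e = (\<Prod>i\<in>{..<N} - {n}. node_exp (\<lambda>_. - 1) (2 * i + 1) j)"
  have Q: "Q = (1 - fps_X ^ j) * Q'"
    unfolding Q_def Q'_def j_def by (rule prod.remove) (use assms in auto)
  have e: "e = (- 1) ^ n * fps_X ^ (n * (n + 1))"
  proof -
    have "e = (\<Prod>i<n. - (fps_X ^ (2 * (n - i))))"
    proof -
      have "node_exp (\<lambda>_. - 1) (2 * i + 1) j = - (fps_X ^ (2 * (n - i)))" if "i < n" for i
      proof -
        have "j - (2 * i + 1) = 2 * (n - i)" by (simp add: j_def)
        then show ?thesis using that by (simp add: node_exp_def j_def)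
      qed
      moreover have "node_exp (\<lambda>_. - 1) (2 * (Suc n + i) + 1) j = 1" for i
        by (simp add: node_exp_def j_def)
      ultimately show ?thesis
        unfolding e_def prod_skip[OF assms] by simp
    qed
    also have "\<dots> = (- 1) ^ n * fps_X ^ (n * (n + 1))"
      using prod_lessThan_rev[of "\<lambda>i. - (fps_X ^ (2 * i)) :: rat fps" n] prod_minus_power[of "fps_X :: rat fps" n] by simp
    finally show ?thesis .
  qed
  have d: "d * (1 - ?p ^ j) = fpoch ?p (N - Suc n) * fpoch ?p (N + n)"
  proof -
    have d1: "node_den (\<lambda>_. - 1) (2 * i + 1) j = (1 - ?p ^ (n - i)) * (1 - ?p ^ (Suc (n + i)))" if "i < n" for i
    proof -
      have e: "j - (2 * i + 1) = 2 * (n - i)" "2 * i + 1 + j = 2 * Suc (n + i)" using that by (auto simp: j_def)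
      show ?thesis unfolding node_den_def e using that by (simp add: j_def power_mult del: power_Suc mult_Suc_right)
    qed
    have d2: "node_den (\<lambda>_. - 1) (2 * (Suc n + i) + 1) j = (1 - ?p ^ (Suc i)) * (1 - ?p ^ (Suc (j + i)))" for i
    proof -
      have e: "2 * (Suc n + i) + 1 - j = 2 * Suc i" "2 * (Suc n + i) + 1 + j = 2 * Suc (j + i)" by (auto simp: j_def)
      show ?thesis unfolding node_den_def e by (simp add: j_def power_mult del: power_Suc mult_Suc_right)
    qed
    have d1': "(\<Prod>i<n. node_den (\<lambda>_. - 1) (2 * i + 1) j) = (\<Prod>i<n. (1 - ?p ^ (n - i)) * (1 - ?p ^ (Suc (n + i))))"
      by (rule prod.cong[OF refl], rule d1) simp
    have "d = ((\<Prod>i<n. 1 - ?p ^ (n - i)) * (\<Prod>i<n. 1 - ?p ^ (Suc (n + i))))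
        * ((\<Prod>i<N - Suc n. 1 - ?p ^ (Suc i)) * (\<Prod>i<N - Suc n. 1 - ?p ^ (Suc (j + i))))"
      unfolding d_def prod_skip[OF assms] d2 prod.distrib[symmetric] d1' ..
    also have "(\<Prod>i<n. 1 - ?p ^ (n - i)) = fpoch ?p n"
      unfolding fpoch_def by (rule prod_lessThan_rev)
    also have "fpoch ?p n * (\<Prod>i<n. 1 - ?p ^ (Suc (n + i))) = fpoch ?p (n + n)" by (rule fpoch_add[symmetric])
    also have "(\<Prod>i<N - Suc n. 1 - ?p ^ (Suc i)) = fpoch ?p (N - Suc n)" by (simp add: fpoch_def)
    finally have "d * (1 - ?p ^ j) = (fpoch ?p (n + n) * (1 - ?p ^ j)) * fpoch ?p (N - Suc n) * (\<Prod>i<N - Suc n. 1 - ?p ^ (Suc (j + i)))"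
      by (simp only: mult_ac)
    also have "fpoch ?p (n + n) * (1 - ?p ^ j) = fpoch ?p j"
      using fpoch_simps(2)[of ?p "n + n"] by (simp add: j_def mult_2)
    also have "fpoch ?p j * fpoch ?p (N - Suc n) * (\<Prod>i<N - Suc n. 1 - ?p ^ (Suc (j + i)))
        = fpoch ?p (N - Suc n) * fpoch ?p (j + (N - Suc n))"
      unfolding fpoch_add by (simp only: mult_ac)
    also have "j + (N - Suc n) = N + n" using assms by (simp add: j_def)
    finally show ?thesis .
  qed
  have main: "odd_block N n = Q'\<^sup>2 * e * inverse d"
    unfolding odd_block_def Q'_def e_def d_def fps_inverse_prod prod_power_distrib prod.distrib j_def by simp
  define a b :: "rat fps" where "a = inverse (fpoch ?p (N - Suc n))" and "b = inverse (fpoch ?p (N + n))"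
  have ab: "a * fpoch ?p (N - Suc n) = 1" "b * fpoch ?p (N + n) = 1"
    unfolding a_def b_def by (simp_all add: inverse_mult_eq_1 fpoch_nth_0)
  define y :: "rat fps" where "y = fps_X ^ j"
  have py: "?p ^ j = y\<^sup>2" by (simp add: y_def mult.commute flip: power_mult)
  have y: "(1 - y) * inverse (1 - y) = 1" unfolding y_def by (rule fps_inverse_unit) (simp add: j_def)
  have "fps_nth d 0 = 1"
    unfolding d_def fps_prod_nth_0 by (rule prod.neutral) (auto simp: j_def node_den_nth_0)
  then have d': "d * inverse d = 1" by (rule fps_inverse_unit)
  have "inverse d = (1 - y\<^sup>2) * (a * b)" using d' ab d[unfolded py] by algebra
  then have "odd_block N n = Q\<^sup>2 * e * ((1 + y) * inverse (1 - y)) * (a * b)"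
    unfolding main Q[folded y_def] using y by algebra
  then show ?thesis unfolding e Q_def y_def a_def b_def j_def .
qed

section \<open>Partitions sorted by Durfee rectangles\<close>

context
  fixes p :: "rat fps" and b :: nat
  assumes b: "b > 0" and p: "p = fps_X ^ b"
begin

private definition "D a r = p ^ (r * (r + a)) * (inverse (fpoch p r) * inverse (fpoch p (r + a)))"

private lemma fp: "fps_nth (fpoch p r) 0 = 1"
  unfolding p by (rule fpoch_nth_0[OF b])

private lemma inv_Suc: "inverse (fpoch p r) = (1 - p ^ Suc r) * inverse (fpoch p (Suc r))"
proof -
  have "f * i = 1 \<Longrightarrow> (f * g) * h = 1 \<Longrightarrow> i = g * h" for f i g h :: "rat fps" by algebra
  from this[OF fps_inverse_unit[OF fp, of r] fps_inverse_unit[OF fp, of "Suc r", unfolded fpoch_simps]]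
  show ?thesis unfolding fpoch_simps .
qed

private lemma p_low: "k < m \<Longrightarrow> fps_nth (p ^ m * F) k = 0"
proof -
  assume "k < m"
  also have "m \<le> b * m" using b by simp
  finally show ?thesis by (simp add: p fps_X_power_mult_nth flip: power_mult)
qed

private lemma D_low: "k < r \<Longrightarrow> fps_nth (D a r) k = 0"
  unfolding D_def by (rule p_low) (simp add: less_le_trans)

private lemma lfin_D: "lfin UNIV (D a)"
  by (rule lfinI[of _ "\<lambda>r. r"]) (auto simp: D_low)

private definition "S a = fsum UNIV (D a)"

text \<open>Iterating this gives \<open>S a - S (Suc a)\<close> divisible by every power of \<open>p\<close>, so \<open>S\<close> is constant.\<close>

private lemma S_diff: "S a - S (Suc a) = - (p ^ Suc a * (S (Suc a) - S (Suc (Suc a))))"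
proof -
  \<comment> \<open>\<open>D a r - D (Suc a) r\<close> equals
    \<open>G r - p ^ Suc a * D (Suc a) r\<close>, while \<open>G (Suc r)\<close> equals
    \<open>p ^ Suc a * D (Suc (Suc a)) r\<close> and \<open>G 0 = 0\<close>.\<close>
  define G where "G r = p ^ (r * (r + a)) * inverse (fpoch p r) * inverse (fpoch p (Suc (r + a))) * (1 - p ^ r)" for r
  have 1: "D a r + (- D (Suc a) r) = G r + (- (p ^ Suc a * D (Suc a) r))" for r
  proof -
    have i: "inverse (fpoch p (r + a)) = (1 - p ^ Suc a * p ^ r) * inverse (fpoch p (Suc (r + a)))"
      using inv_Suc[of "r + a"] by (simp add: power_add mult_ac)
    show ?thesis
    proof -
      have e: "p ^ (r * Suc (r + a)) = p ^ (r * (r + a)) * p ^ r" by (simp add: power_add mult_ac)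
      have "P * (I * ((1 - y * R) * J)) + - (P * R * (I * J)) = P * I * J * (1 - R) + - (y * (P * R * (I * J)))"
        for P I y R J :: "rat fps" by algebra
      then show ?thesis unfolding D_def G_def add_Suc_right e i .
    qed  qed
  have 2: "G (Suc r) = p ^ Suc a * D (Suc (Suc a)) r" for r
  proof -
    have e: "Suc r * (Suc r + a) = Suc a + r * (r + Suc (Suc a))" by simp
    show ?thesis
      unfolding D_def G_def inv_Suc[of r] e power_add by (simp add: mult_ac)
  qed
  have G0: "G 0 = 0" by (simp add: G_def)
  have lG: "lfin UNIV G"
  proof (rule lfin_cong[THEN iffD1])
    show "lfin UNIV (\<lambda>r. (D a r + (- D (Suc a) r)) + p ^ Suc a * D (Suc a) r)"
      by (intro lfin_add lfin_uminus lfin_mult_left lfin_D)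
  qed (use 1 in auto)
  have "S a - S (Suc a) = fsum UNIV (\<lambda>r. D a r + (- D (Suc a) r))"
    unfolding S_def by (subst fsum_add) (simp_all add: lfin_D lfin_uminus fsum_uminus)
  also have "\<dots> = fsum UNIV G + (- (p ^ Suc a * S (Suc a)))"
    unfolding 1 S_def by (simp only: fsum_add lG lfin_D lfin_uminus lfin_mult_left fsum_uminus fsum_mult_left)
  also have "fsum UNIV G = p ^ Suc a * S (Suc (Suc a))"
    unfolding fsum_nat_shift[OF lG] G0 2 S_def by (simp add: fsum_mult_left lfin_D)
  finally show ?thesis by (simp add: algebra_simps)
qed

private lemma S_Suc: "S (Suc a) = S a"
proof -
  have "fps_nth (S a - S (Suc a)) n = 0" for n
  proof (induction n arbitrary: a rule: less_induct)
    case (less n)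
    have e: "p ^ Suc a * F = fps_X ^ (b * Suc a) * F" for F by (simp only: p power_mult)
    show ?case
      unfolding S_diff[of a] e using less[of "n - b * Suc a" "Suc a"] b by (auto simp: fps_X_power_mult_nth)
  qed
  then show ?thesis by (simp add: fps_eq_iff)
qed

text \<open>The sum does not depend on \<open>a\<close>, and for growing \<open>a\<close> all terms
  except \<open>r = 0\<close> disappear, which leaves the inverse of Euler's product.
  Combinatorially, partitions are sorted by their largest rectangle of shape \<open>r\<close> by
  \<open>r + a\<close>.\<close>

lemma durfee_rectangle:
  "fsum UNIV (\<lambda>r. p ^ (r * (r + a)) * (inverse (fpoch p r) * inverse (fpoch p (r + a)))) = inverse (Euler b)"
proof -
  have S0: "S m = S 0" for m by (induction m) (simp_all add: S_Suc)
  have c: "flim S (S a)"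
    unfolding flim_def
    by (intro allI exI[of _ 0] impI arg_cong2[where f = fps_nth] refl trans[OF S0 S0[symmetric]])
  have "flim (\<lambda>m. fsum UNIV (D m)) (fsum UNIV (\<lambda>r::nat. if r = 0 then inverse (Euler b) else 0))"
  proof (rule flim_fsum[where e = "\<lambda>r. r"])
    fix r :: nat
    show "flim (\<lambda>m. D m r) (if r = 0 then inverse (Euler b) else 0)"
    proof (cases "r = 0")
      case True
      have "flim (\<lambda>m. inverse (fpoch p m)) (inverse (Euler b))"
        using flim_fpoch[OF b] unfolding p[symmetric] by (rule flim_inverse) (simp_all add: fp)
      then show ?thesis using True by (simp add: D_def[abs_def])
    next
      case False
      have low: "fps_nth (D m r) n = 0" if "m \<ge> Suc n" for m n
      proof -
        have "n < m" using that by simp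
        also have "m \<le> r * (r + m)" using False by (cases r) auto
        finally show ?thesis unfolding D_def by (rule p_low)
      qed
      have "flim (\<lambda>m. D m r) 0"
        unfolding flim_def fps_zero_nth by (intro allI exI[of _ "Suc n" for n] impI, rule low)
      then show ?thesis using False by simp
    qed
  qed (auto simp: D_low)
  moreover have "fsum UNIV (\<lambda>r::nat. if r = 0 then inverse (Euler b) else 0) = inverse (Euler b)"
    by (rule fps_ext, subst fsum_nth[of "{0}"]) auto
  ultimately have "flim S (inverse (Euler b))" by (simp add: S_def[abs_def])
  then have "S a = inverse (Euler b)" by (rule flim_unique[OF c])
  then show ?thesis unfolding S_def D_def[abs_def] .
qed

end

subsection \<open>Watson's formula for the mock theta function\<close>

definition fps_section :: "nat \<Rightarrow> nat \<Rightarrow> 'a fps \<Rightarrow> 'a::zero fps" where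
  "fps_section m r F = Abs_fps (\<lambda>n. fps_nth F (m * n + r))"

lemma fps_section_nth [simp]: "fps_nth (fps_section m r F) n = fps_nth F (m * n + r)"
  by (simp add: fps_section_def)

lemma fps_section_fsum: "fps_section m r (fsum I F) = fsum I (\<lambda>i. fps_section m r (F i))"
  by (rule fps_ext) (simp add: fsum_def)

lemma fps_section_mult:
  fixes G H :: "'a::comm_ring_1 fps"
  assumes "r < m"
  shows "fps_section m r ((G oo fps_X ^ m) * H) = G * fps_section m r H"
proof (rule fps_ext)
  fix n
  have m: "m > 0" using assms by simp
  have "(\<Sum>i\<in>{0..m * n + r}. fps_nth (G oo fps_X ^ m) i * fps_nth H (m * n + r - i))
      = (\<Sum>i\<in>(\<lambda>i. m * i) ` {0..n}. fps_nth (G oo fps_X ^ m) i * fps_nth H (m * n + r - i))"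
  proof (rule sum.mono_neutral_right)
    show "(\<lambda>i. m * i) ` {0..n} \<subseteq> {0..m * n + r}" by (auto intro!: trans_le_add1)
    show "\<forall>i\<in>{0..m * n + r} - (\<lambda>i. m * i) ` {0..n}. fps_nth (G oo fps_X ^ m) i * fps_nth H (m * n + r - i) = 0"
    proof
      fix i assume i: "i \<in> {0..m * n + r} - (\<lambda>i. m * i) ` {0..n}"
      have "\<not> m dvd i"
      proof
        assume "m dvd i"
        then obtain k where k: "i = m * k" by blast
        have "m * k < m * Suc n" using i k assms by auto
        then have "k < Suc n" unfolding mult_less_cancel1 by simp
        then have "k \<le> n" by simp
        then show False using i k by auto
      qed
      then show "fps_nth (G oo fps_X ^ m) i * fps_nth H (m * n + r - i) = 0"
        using m by (simp add: fps_nth_compose_X_power)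
    qed
  qed simp
  also have "\<dots> = (\<Sum>i\<in>{0..n}. fps_nth G i * fps_nth H (m * (n - i) + r))"
    using m by (subst sum.reindex) (auto simp: inj_on_def fps_nth_compose_X_power diff_mult_distrib2 intro!: sum.cong)
  finally show "fps_nth (fps_section m r ((G oo fps_X ^ m) * H)) n = fps_nth (G * fps_section m r H) n"
    by (simp add: fps_mult_nth)
qed

lemma flim_partial_sums:
  fixes F :: "nat \<Rightarrow> 'a::comm_monoid_add fps"
  assumes "\<And>n k. k < n \<Longrightarrow> fps_nth (F n) k = 0"
  shows "flim (\<lambda>N. \<Sum>n<N. F n) (fsum UNIV F)"
  unfolding flim_def
proof
  fix m
  have "fps_nth (\<Sum>n<N. F n) m = fps_nth (fsum UNIV F) m" if "Suc m \<le> N" for N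
    by (subst fsum_nth[of "{..<N}"]) (use that assms in \<open>auto simp: fps_sum_nth\<close>)
  then show "\<exists>N0. \<forall>N\<ge>N0. fps_nth (\<Sum>n<N. F n) m = fps_nth (fsum UNIV F) m" by blast
qed

lemma sum_odd_block:
  assumes "N > 0" shows "(\<Sum>n<N. odd_block N n) = 1"
proof -
  let ?h = "\<lambda>i::nat. 2 * i + 1"
  have inj: "inj_on ?h A" for A by (auto simp: inj_on_def)
  define L where "L = ?h ` {..<N}"
  have "1 = (\<Sum>k\<in>L. \<Prod>l\<in>L - {k}. (1 + (- 1) * fps_X ^ l)\<^sup>2 * node_exp (\<lambda>_. - 1) l k * inverse (node_den (\<lambda>_. - 1) l k))"
    by (rule partition_of_unity[symmetric]) (use assms in \<open>auto simp: L_def\<close>)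
  also have "\<dots> = (\<Sum>n<N. odd_block N n)"
    unfolding L_def sum.reindex[OF inj] o_def
  proof (rule sum.cong[OF refl])
    fix n assume "n \<in> {..<N}"
    have "?h ` {..<N} - {?h n} = ?h ` ({..<N} - {n})" by auto
    then show "(\<Prod>l\<in>?h ` {..<N} - {?h n}. (1 + (- 1) * fps_X ^ l)\<^sup>2 * node_exp (\<lambda>_. - 1) l (?h n) * inverse (node_den (\<lambda>_. - 1) l (?h n))) = odd_block N n"
      unfolding odd_block_def by (simp only: prod.reindex[OF inj] o_def)
  qed
  finally show ?thesis by simp
qed

definition omega_coeff :: "nat \<Rightarrow> rat fps" where
  "omega_coeff k = (- 1) ^ k * ((1 + fps_X ^ (2 * k + 1)) * inverse (1 - fps_X ^ (2 * k + 1)))"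

text \<open>The partition of unity divided by the squared product of odd factors: a partial fraction
  expansion in the form of a Bailey pair with base \<open>q^2\<close>.\<close>

lemma inverse_odd_product:
  "inverse ((\<Prod>k\<le>n. (1 - fps_X ^ (1 + 2 * k))\<^sup>2)) = (\<Sum>k\<le>n. omega_coeff k * fps_X ^ (k * (k + 1))
      * (inverse (fpoch (fps_X\<^sup>2) (n - k)) * inverse (fpoch (fps_X\<^sup>2) (n + k + 1))) :: rat fps)"
proof -
  define Q :: "rat fps" where "Q = (\<Prod>i<Suc n. 1 - fps_X ^ (2 * i + 1))"
  define S :: "rat fps" where "S = (\<Sum>k\<le>n. omega_coeff k * fps_X ^ (k * (k + 1))
      * (inverse (fpoch (fps_X\<^sup>2) (n - k)) * inverse (fpoch (fps_X\<^sup>2) (n + k + 1))))"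
  have Q2: "(\<Prod>k\<le>n. (1 - fps_X ^ (1 + 2 * k))\<^sup>2) = Q\<^sup>2"
    unfolding Q_def prod_power_distrib[symmetric] by (simp only: lessThan_Suc_atMost add.commute)
  have "1 = (\<Sum>k<Suc n. odd_block (Suc n) k)" by (rule sum_odd_block[symmetric]) simp
  also have "\<dots> = (\<Sum>k<Suc n. Q\<^sup>2 * (omega_coeff k * fps_X ^ (k * (k + 1))
      * (inverse (fpoch (fps_X\<^sup>2) (n - k)) * inverse (fpoch (fps_X\<^sup>2) (n + k + 1)))))"
  proof (rule sum.cong[OF refl])
    fix k assume "k \<in> {..<Suc n}"
    then have k: "k < Suc n" by simp
    show "odd_block (Suc n) k = Q\<^sup>2 * (omega_coeff k * fps_X ^ (k * (k + 1))
      * (inverse (fpoch (fps_X\<^sup>2) (n - k)) * inverse (fpoch (fps_X\<^sup>2) (n + k + 1))))"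
      unfolding odd_block_eq[OF k] Q_def omega_coeff_def by (simp add: mult_ac)
  qed
  also have "\<dots> = Q\<^sup>2 * S" unfolding S_def sum_distrib_left lessThan_Suc_atMost ..
  finally have 1: "Q\<^sup>2 * S = 1" by simp
  have "fps_nth (Q\<^sup>2) 0 = 1" by (simp add: Q_def fps_prod_nth_0 power2_eq_square)
  then have "Q\<^sup>2 * inverse (Q\<^sup>2) = 1" by (rule fps_inverse_unit)
  moreover have "a * b = 1 \<Longrightarrow> a * c = 1 \<Longrightarrow> b = c" for a b c :: "rat fps" by algebra
  ultimately have "inverse (Q\<^sup>2) = S" using 1 by blast
  then show ?thesis unfolding Q2 S_def .
qed

lemma mock_omega_fsum:
  "mock_omega = fsum UNIV (\<lambda>n. fps_X ^ (2 * n\<^sup>2 + 2 * n) * inverse (\<Prod>k\<le>n. (1 - fps_X ^ (1 + 2 * k))\<^sup>2))"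
proof -
  have D: "fps_nth (\<Prod>k\<le>n. (1 - fps_X ^ (1 + 2 * k) :: rat fps)\<^sup>2) 0 \<noteq> 0" for n
    by (simp add: fps_prod_nth_0 fps_power_zeroth)
  have "(\<lambda>N. \<Sum>n<N. fps_X ^ (2 * n\<^sup>2 + 2 * n) * inverse (\<Prod>k\<le>n. (1 - fps_X ^ (1 + 2 * k))\<^sup>2)) \<longlonglongrightarrow> mock_omega"
    using mock_omega_sums unfolding sums_def fps_divide_unit[OF D] .
  moreover have "(\<lambda>N. \<Sum>n<N. fps_X ^ (2 * n\<^sup>2 + 2 * n) * inverse (\<Prod>k\<le>n. (1 - fps_X ^ (1 + 2 * k))\<^sup>2 :: rat fps))
      \<longlonglongrightarrow> fsum UNIV (\<lambda>n. fps_X ^ (2 * n\<^sup>2 + 2 * n) * inverse (\<Prod>k\<le>n. (1 - fps_X ^ (1 + 2 * k))\<^sup>2))"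
    by (rule flim_imp_LIMSEQ[OF flim_partial_sums]) (simp add: fps_X_power_mult_nth)
  ultimately show ?thesis by (rule LIMSEQ_unique)
qed

text \<open>With \<open>n = k + r\<close> the exponent splits as
  \<open>2 n^2 + 2 n + k (k + 1) = 3 k (k + 1) + 2 r (r + 2 k + 1)\<close>, and the sum over
  \<open>r\<close> is \<open>durfee_rectangle\<close> for \<open>p = q^2\<close> and
  \<open>a = 2 k + 1\<close>.\<close>

theorem mock_omega_appell:
  "Euler 2 * mock_omega = fsum UNIV (\<lambda>k. fps_X ^ (3 * (k * (k + 1))) * omega_coeff k)"
proof -
  let ?c = "\<lambda>n. inverse (fpoch (fps_X\<^sup>2 :: rat fps) n)"
  define T where "T n k = fps_X ^ (2 * n\<^sup>2 + 2 * n) * (omega_coeff k * fps_X ^ (k * (k + 1)) * (?c (n - k) * ?c (n + k + 1)))" for n k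
  have T: "T (k + r) k = fps_X ^ (3 * (k * (k + 1))) * omega_coeff k * ((fps_X\<^sup>2) ^ (r * (r + (2 * k + 1))) * (?c r * ?c (r + (2 * k + 1))))" for k r
  proof -
    have "2 * (k + r)\<^sup>2 + 2 * (k + r) + k * (k + 1) = 3 * (k * (k + 1)) + 2 * (r * (r + (2 * k + 1)))"
      by (simp add: power2_eq_square algebra_simps)
    then have e: "fps_X ^ (2 * (k + r)\<^sup>2 + 2 * (k + r)) * fps_X ^ (k * (k + 1)) = (fps_X ^ (3 * (k * (k + 1))) * (fps_X\<^sup>2) ^ (r * (r + (2 * k + 1))) :: rat fps)"
      by (simp only: power_add[symmetric] power_mult[symmetric])
    have i: "k + r - k = r" "k + r + k + 1 = r + (2 * k + 1)" by auto
    have "T (k + r) k = (fps_X ^ (2 * (k + r)\<^sup>2 + 2 * (k + r)) * fps_X ^ (k * (k + 1))) * (omega_coeff k * (?c r * ?c (r + (2 * k + 1))))"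
      unfolding T_def i by (simp only: mult_ac)
    then show ?thesis unfolding e by (simp only: mult_ac)
  qed
  define I where "I = Sigma UNIV (\<lambda>n::nat. {..n})"
  have b: "bij_betw (\<lambda>(k, r). (k + r, k)) (UNIV \<times> UNIV) I"
    by (rule bij_betwI[where g = "\<lambda>(n, k). (k, n - k)"]) (auto simp: I_def)
  have l: "lfin I (\<lambda>(n, k). T n k)"
  proof (rule lfinI[of _ "\<lambda>(n, k). n"])
    fix n :: nat
    have "{i \<in> I. (case i of (n, k) \<Rightarrow> n) \<le> n} \<subseteq> {..n} \<times> {..n}" by (auto simp: I_def)
    then show "finite {i \<in> I. (case i of (n, k) \<Rightarrow> n) \<le> n}" by (rule finite_subset) simp
  qed (auto simp: T_def fps_X_power_mult_nth)
  have "mock_omega = fsum UNIV (\<lambda>n. fsum {..n} (T n))"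
    unfolding mock_omega_fsum inverse_odd_product by (simp add: fsum_finite T_def sum_distrib_left)
  also have "\<dots> = fsum I (\<lambda>(n, k). T n k)"
    unfolding I_def by (rule fsum_Sigma(1)[symmetric]) (use l in \<open>simp add: I_def\<close>)
  also have "\<dots> = fsum (UNIV \<times> UNIV) (\<lambda>(k, r). T (k + r) k)"
    by (rule fsum_reindex_bij[OF b]) auto
  also have l2: "lfin (UNIV \<times> UNIV) (\<lambda>(k, r). T (k + r) k)"
    using lfin_reindex_bij[OF b, of "\<lambda>(n, k). T n k" "\<lambda>(k, r). T (k + r) k"] l by auto
  note fsum_Sigma(1)[OF l2]
  also have "fsum UNIV (\<lambda>k. fsum UNIV (\<lambda>r. T (k + r) k)) = fsum UNIV (\<lambda>k. inverse (Euler 2) * (fps_X ^ (3 * (k * (k + 1))) * omega_coeff k))"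
  proof (rule fsum_cong[OF refl])
    fix k
    have "lfin UNIV (\<lambda>r. (fps_X\<^sup>2) ^ (r * (r + (2 * k + 1))) * (?c r * ?c (r + (2 * k + 1))))"
    proof (rule lfinI[of _ "\<lambda>r. r"])
      fix r m :: nat assume "m < r"
      also have "r \<le> 2 * (r * (r + (2 * k + 1)))" by simp
      finally show "fps_nth ((fps_X\<^sup>2) ^ (r * (r + (2 * k + 1))) * (?c r * ?c (r + (2 * k + 1)))) m = 0"
        by (simp only: power_mult[symmetric] fps_X_power_mult_nth if_True)
    qed simp
    then show "fsum UNIV (\<lambda>r. T (k + r) k) = inverse (Euler 2) * (fps_X ^ (3 * (k * (k + 1))) * omega_coeff k)"
      unfolding T by (simp only: fsum_mult_left durfee_rectangle[of 2, OF _ refl] zero_less_numeral mult.commute)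
  qed
  also have "\<dots> = inverse (Euler 2) * fsum UNIV (\<lambda>k. fps_X ^ (3 * (k * (k + 1))) * omega_coeff k)"
  proof (rule fsum_mult_left, rule lfinI[of _ "\<lambda>k. k"])
    fix k m :: nat assume "m < k"
    also have "k \<le> 3 * (k * (k + 1))" by simp
    finally show "fps_nth (fps_X ^ (3 * (k * (k + 1))) * omega_coeff k) m = 0"
      by (simp only: fps_X_power_mult_nth if_True)
  qed simp
  finally have "mock_omega = inverse (Euler 2) * fsum UNIV (\<lambda>k. fps_X ^ (3 * (k * (k + 1))) * omega_coeff k)" .
  then have "Euler 2 * mock_omega = (Euler 2 * inverse (Euler 2)) * fsum UNIV (\<lambda>k. fps_X ^ (3 * (k * (k + 1))) * omega_coeff k)"
    by (simp only: mult.assoc)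
  then show ?thesis unfolding fps_inverse_unit[OF qpoch_nth_0] mult_1_left .
qed

text \<open>\<open>Euler 2\<close> is a series in \<open>q^2\<close> and passes through the section.
  With \<open>j = 2 n + 1\<close>, \<open>(1 + q^j) / (1 - q^j)\<close> is
  \<open>(1 + q^j)^2 / (1 - q^(2j))\<close>, whose numerator has odd part \<open>2 q^j\<close>. The
  extra \<open>fps_X\<close> produces the exponents that reappear in the second partition of
  unity.\<close>

lemma mock_omega_odd_section:
  "Euler 1 * (fps_X * fps_section 2 1 mock_omega)
    = 2 * fsum UNIV (\<lambda>n. (- 1) ^ n * fps_X ^ ((n + 1) * (3 * n + 2) div 2) * inverse (1 - fps_X ^ (2 * n + 1)))"
proof -
  have E: "Euler 2 = Euler 1 oo fps_X ^ 2"
    using qpoch_compose[of 1 1 2 "- 1"] by (simp add: fps_compose_uminus)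
  have "Euler 1 * fps_section 2 1 mock_omega = fps_section 2 1 (Euler 2 * mock_omega)"
    unfolding E by (rule fps_section_mult[symmetric]) simp
  also have "\<dots> = fsum UNIV (\<lambda>n. fps_section 2 1 (fps_X ^ (3 * (n * (n + 1))) * omega_coeff n))"
    unfolding mock_omega_appell fps_section_fsum ..
  also have "\<dots> = fsum UNIV (\<lambda>n. 2 * ((- 1) ^ n * fps_X ^ (3 * (n * (n + 1)) div 2 + n) * inverse (1 - fps_X ^ (2 * n + 1))))"
  proof (rule fsum_cong[OF refl])
    fix n :: nat
    define j where "j = 2 * n + 1"
    define G :: "rat fps" where "G = (- 1) ^ n * (fps_X ^ (3 * (n * (n + 1)) div 2) * inverse (1 - fps_X ^ j))"
    have ev: "2 * (3 * (n * (n + 1)) div 2) = 3 * (n * (n + 1))" by simp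
    have 0: "fps_nth (fps_X ^ 2 :: rat fps) 0 = 0" by simp
    have Gc: "G oo fps_X ^ 2 = (- 1) ^ n * (fps_X ^ (3 * (n * (n + 1))) * inverse (1 - fps_X ^ (2 * j)))"
      unfolding G_def fps_compose_mult_distrib[OF 0]
    proof -
      have "fps_nth (1 - fps_X ^ j :: rat fps) 0 \<noteq> 0" by (simp add: j_def)
      then have "inverse (1 - fps_X ^ j) oo fps_X ^ 2 = (inverse (1 - fps_X ^ (2 * j)) :: rat fps)"
        using fps_inverse_compose[OF 0, of "1 - fps_X ^ j"]
        by (simp only: fps_compose_sub_distrib fps_compose_1 fps_X_power_compose_X_power zero_less_numeral not_False_eq_True simp_thms)
      moreover have "(- 1) ^ n oo fps_X ^ 2 = ((- 1) ^ n :: rat fps)"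
        by (simp add: minus_one_power_iff fps_compose_uminus)
      ultimately show "((- 1) ^ n oo fps_X ^ 2) * ((fps_X ^ (3 * (n * (n + 1)) div 2) oo fps_X ^ 2) * (inverse (1 - fps_X ^ j) oo fps_X ^ 2))
          = (- 1) ^ n * (fps_X ^ (3 * (n * (n + 1))) * inverse (1 - fps_X ^ (2 * j)) :: rat fps)"
        by (simp only: fps_X_power_compose_X_power ev zero_less_numeral)
    qed
    have inv: "inverse (1 - fps_X ^ j) = (1 + fps_X ^ j) * inverse (1 - fps_X ^ (2 * j) :: rat fps)"
    proof -
      have "(1 - y) * a = 1 \<Longrightarrow> (1 - y * y) * b = 1 \<Longrightarrow> a = (1 + y) * b" for y a b :: "rat fps" by algebra
      moreover have "fps_X ^ (2 * j) = (fps_X ^ j * fps_X ^ j :: rat fps)" by (simp add: mult_2 power_add)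
      moreover have "(1 - fps_X ^ j) * inverse (1 - fps_X ^ j :: rat fps) = 1"
        "(1 - fps_X ^ (2 * j)) * inverse (1 - fps_X ^ (2 * j) :: rat fps) = 1"
        by (rule fps_inverse_unit, simp add: j_def)+
      ultimately show ?thesis by simp
    qed
    have "fps_X ^ (3 * (n * (n + 1))) * omega_coeff n = (G oo fps_X ^ 2) * (1 + fps_X ^ j)\<^sup>2"
      unfolding Gc omega_coeff_def j_def[symmetric] inv by (simp add: power2_eq_square mult_ac)
    then have "fps_section 2 1 (fps_X ^ (3 * (n * (n + 1))) * omega_coeff n) = G * fps_section 2 1 ((1 + fps_X ^ j)\<^sup>2)"
      using fps_section_mult[of 1 2 G "(1 + fps_X ^ j)\<^sup>2"] by simp
    also have "fps_section 2 1 ((1 + fps_X ^ j)\<^sup>2 :: rat fps) = 2 * fps_X ^ n"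
    proof (rule fps_ext)
      fix m :: nat
      have s: "(1 + fps_X ^ j)\<^sup>2 = 1 + fps_X ^ j + fps_X ^ j + (fps_X ^ (2 * j) :: rat fps)"
      proof -
        have "(1 + y)\<^sup>2 = 1 + y + y + y * y" for y :: "rat fps" by algebra
        then show ?thesis by (simp only: mult_2[of j] power_add)
      qed
      have "odd (2 * m + 1)" by simp
      then have "2 * m + 1 \<noteq> 2 * j" by presburger
      moreover have "(2 * m + 1 = j) = (m = n)" by (auto simp: j_def)
      ultimately show "fps_nth (fps_section 2 1 ((1 + fps_X ^ j)\<^sup>2)) m = fps_nth (2 * fps_X ^ n :: rat fps) m"
        unfolding fps_section_nth s by (simp add: fps_nth_numeral_mult)
    qed
    finally show "fps_section 2 1 (fps_X ^ (3 * (n * (n + 1))) * omega_coeff n)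
        = 2 * ((- 1) ^ n * fps_X ^ (3 * (n * (n + 1)) div 2 + n) * inverse (1 - fps_X ^ (2 * n + 1)))"
      by (simp add: G_def j_def power_add mult_ac)
  qed
  finally have 1: "Euler 1 * fps_section 2 1 mock_omega = fsum UNIV (\<lambda>n. 2 * ((- 1) ^ n * fps_X ^ (3 * (n * (n + 1)) div 2 + n) * inverse (1 - fps_X ^ (2 * n + 1))))" .
  have l: "lfin UNIV (\<lambda>n. (- 1) ^ n * fps_X ^ (3 * (n * (n + 1)) div 2 + n) * inverse (1 - fps_X ^ (2 * n + 1)) :: rat fps)"
  proof (rule lfinI[of _ "\<lambda>n. n"])
    fix n k :: nat assume k: "k < n"
    have "(- 1) ^ n * fps_X ^ (3 * (n * (n + 1)) div 2 + n) * inverse (1 - fps_X ^ (2 * n + 1))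
        = ((- 1) ^ n * inverse (1 - fps_X ^ (2 * n + 1))) * (fps_X ^ (3 * (n * (n + 1)) div 2 + n) :: rat fps)"
      by (simp only: mult_ac)
    then show "fps_nth ((- 1) ^ n * fps_X ^ (3 * (n * (n + 1)) div 2 + n) * inverse (1 - fps_X ^ (2 * n + 1)) :: rat fps) k = 0"
      using k by (simp only: fps_nth_mult_X_power_low trans_less_add2)
  qed simp
  have e: "Suc (3 * (n * (n + 1)) div 2 + n) = (n + 1) * (3 * n + 2) div 2" for n :: nat
  proof -
    have "(n + 1) * (3 * n + 2) = 3 * (n * (n + 1)) + 2 * (n + 1)" by (simp add: algebra_simps)
    then show ?thesis by simp
  qed
  define F where "F n = (- 1) ^ n * fps_X ^ (3 * (n * (n + 1)) div 2 + n) * inverse (1 - fps_X ^ (2 * n + 1) :: rat fps)" for n :: nat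
  have "Euler 1 * fps_section 2 1 mock_omega = 2 * fsum UNIV F"
    unfolding 1 F_def[abs_def] by (rule fsum_mult_left[OF l])
  then have "Euler 1 * (fps_X * fps_section 2 1 mock_omega) = 2 * (fps_X * fsum UNIV F)"
    by (simp add: mult.left_commute)
  also have "fps_X * fsum UNIV F = fsum UNIV (\<lambda>n. fps_X * F n)"
    using fsum_mult_left[OF l, of fps_X] unfolding F_def[abs_def] by simp
  also have "\<dots> = fsum UNIV (\<lambda>n. (- 1) ^ n * fps_X ^ ((n + 1) * (3 * n + 2) div 2) * inverse (1 - fps_X ^ (2 * n + 1)))"
  proof (rule fsum_cong[OF refl])
    fix n :: nat
    show "fps_X * F n = (- 1) ^ n * fps_X ^ ((n + 1) * (3 * n + 2) div 2) * inverse (1 - fps_X ^ (2 * n + 1))"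
      unfolding F_def e[of n, symmetric] power_Suc[of fps_X "3 * (n * (n + 1)) div 2 + n"] by (simp only: mult_ac)
  qed
  finally show ?thesis .
qed

subsection \<open>A second partition of unity\<close>

lemma flim_prod_shift:
  fixes g :: "nat \<Rightarrow> 'a::comm_ring_1 fps"
  assumes "flim (\<lambda>N. \<Prod>i<N. g (n + i)) G"
  shows "flim (\<lambda>N. \<Prod>i<N. g i) ((\<Prod>i<n. g i) * G)"
proof -
  have 1: "flim (\<lambda>N. (\<Prod>i<n. g i) * (\<Prod>i<N - n. g (n + i))) ((\<Prod>i<n. g i) * G)"
    by (rule flim_mult[OF flim_const flim_reindex[OF assms]]) (metis add_diff_cancel_right' diff_le_mono)
  show ?thesis
  proof (rule flim_eventually[OF 1, of n])
    fix N assume "n \<le> N"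
    then have "N = n + (N - n)" by simp
    then show "(\<Prod>i<n. g i) * (\<Prod>i<N - n. g (n + i)) = (\<Prod>i<N. g i)"
      using prod_lessThan_add[of g n "N - n"] by simp
  qed
qed

lemma flim_prod_skip:
  fixes g :: "nat \<Rightarrow> 'a::comm_ring_1 fps"
  assumes "flim (\<lambda>N. \<Prod>i<N. g (Suc n + i)) G"
  shows "flim (\<lambda>N. \<Prod>i\<in>{..<N} - {n}. g i) ((\<Prod>i<n. g i) * G)"
proof -
  have 1: "flim (\<lambda>N. (\<Prod>i<n. g i) * (\<Prod>i<N - Suc n. g (Suc n + i))) ((\<Prod>i<n. g i) * G)"
    by (rule flim_mult[OF flim_const flim_reindex[OF assms]]) (metis add_diff_cancel_right' diff_le_mono)
  show ?thesis
    by (rule flim_eventually[OF 1, of "Suc n"]) (simp add: prod_skip)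
qed

lemma qpoch_shift:
  assumes "b > 0" "c > 0"
  shows "qpoch s b c = (\<Prod>i<n. 1 + s * fps_X ^ (b * i + c)) * qpoch s b (c + b * n)"
proof (rule flim_unique[OF flim_qpoch[OF assms] flim_prod_shift])
  have "b * (n + i) + c = b * i + (c + b * n)" for i by (simp add: algebra_simps)
  then show "flim (\<lambda>N. \<Prod>i<N. 1 + s * fps_X ^ (b * (n + i) + c)) (qpoch s b (c + b * n))"
    using flim_qpoch[of b "c + b * n" s] assms by (simp only: add_pos_pos add_gr_0 simp_thms)
qed

lemma flim_node_product:
  assumes "b > 0" "c > 0" "d > 0" "e > 0"
  shows "flim (\<lambda>N. \<Prod>i<N. (1 + s * fps_X ^ (b * i + c))\<^sup>2 * inverse ((1 + t * fps_X ^ (b * i + d)) * (1 + t * fps_X ^ (b * i + e))))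
    ((qpoch s b c)\<^sup>2 * inverse (qpoch t b d * qpoch t b e))"
proof -
  have n0: "fps_nth (\<Prod>i<N. 1 + t * fps_X ^ (b * i + k)) 0 = 1" if "k > 0" for N k
    unfolding fps_prod_nth_0 using that by (simp add: fps_nth_mult_X_power_low)
  have "flim (\<lambda>N. ((\<Prod>i<N. 1 + s * fps_X ^ (b * i + c)) * (\<Prod>i<N. 1 + s * fps_X ^ (b * i + c)))
      * inverse ((\<Prod>i<N. 1 + t * fps_X ^ (b * i + d)) * (\<Prod>i<N. 1 + t * fps_X ^ (b * i + e))))
    ((qpoch s b c * qpoch s b c) * inverse (qpoch t b d * qpoch t b e))"
    by (intro flim_mult flim_inverse flim_qpoch) (use assms n0 in auto)
  then show ?thesis
    unfolding power2_eq_square prod.distrib fps_inverse_prod[symmetric] .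
qed

text \<open>The points used below are the odd numbers, with sign \<open>- 1\<close>, and the multiples of 4, with sign 1.\<close>

definition node_sign :: "nat \<Rightarrow> rat fps" where
  "node_sign l = (if odd l then - 1 else 1)"

definition node :: "nat \<Rightarrow> nat \<Rightarrow> rat fps" where
  "node l k = (1 + node_sign l * fps_X ^ l)\<^sup>2 * node_exp node_sign l k * inverse (node_den node_sign l k)"

lemma node_odd_odd:
  "node (2 * i + 1) (2 * n + 1) = (1 + (- 1) * fps_X ^ (2 * i + 1))\<^sup>2
      * node_exp (\<lambda>_. - 1) (2 * i + 1) (2 * n + 1) * inverse (node_den (\<lambda>_. - 1) (2 * i + 1) (2 * n + 1))"
  by (simp add: node_def node_sign_def node_exp_def node_den_def)

lemma node_mixed:
  assumes "odd (l + k)"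
  shows "node l k = (1 + node_sign l * fps_X ^ l)\<^sup>2 * (if k \<le> l then 1 else fps_X ^ (k - l))
    * inverse ((1 + 1 * fps_X ^ (if k \<le> l then l - k else k - l)) * (1 + 1 * fps_X ^ (l + k)))"
proof -
  have "node_sign l * node_sign k = - 1" using assms by (auto simp: node_sign_def)
  then show ?thesis by (simp add: node_def node_exp_def node_den_def)
qed

lemma prod_X_power_arith: "(\<Prod>i<n. fps_X ^ (2 * c * i + r)) = (fps_X ^ (c * n * (n - 1) + r * n) :: 'a::comm_ring_1 fps)"
proof (induction n)
  case (Suc n)
  have "c * n * (n - 1) + r * n + (2 * c * n + r) = c * Suc n * (Suc n - 1) + r * Suc n"
    by (cases n) (simp_all add: algebra_simps)
  then show ?case unfolding prod.lessThan_Suc Suc power_add[symmetric] by (rule arg_cong)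
qed simp

text \<open>The nodes \<open>4 i < j\<close> give \<open>q\<close> to the sum of
  \<open>j - 4 i\<close> over \<open>i <= a\<close>, which is \<open>(a + 1) (2 a + r)\<close>.
  Finite heads and infinite tails then fit together. The node 0 contributes
  \<open>(1 + 1)^2 = 4\<close>, and as its sum and difference with \<open>j\<close> agree,
  \<open>1 + q^j\<close> occurs once more in the denominator.\<close>

lemma flim_cross_odd:
  assumes j: "j = 4 * a + r" and r: "r = 1 \<or> r = 3"
  shows "flim (\<lambda>N. \<Prod>i<N. node (4 * i) j)
    (4 * (qpoch 1 4 4)\<^sup>2 * fps_X ^ ((a + 1) * (2 * a + r)) * inverse ((1 + fps_X ^ j) * qpoch 1 2 1))"
proof -
  define P where "P = (\<lambda>i::nat. 1 + 1 * fps_X ^ (4 * i) :: rat fps)"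
  define U where "U = (\<lambda>i::nat. 1 + 1 * fps_X ^ (4 * i + r) :: rat fps)"
  define V where "V = (\<lambda>i::nat. 1 + 1 * fps_X ^ (4 * i + j) :: rat fps)"
  have r0: "r > 0" "4 - r > 0" "j > 0" using r j by auto
  have hi: "node (4 * (Suc a + i)) j = (1 + 1 * fps_X ^ (4 * i + (4 * a + 4)))\<^sup>2
      * inverse ((1 + 1 * fps_X ^ (4 * i + (4 - r))) * (1 + 1 * fps_X ^ (4 * i + (j + 4 * Suc a))))" for i
  proof -
    have e: "4 * (Suc a + i) = 4 * i + (4 * a + 4)" "4 * (Suc a + i) - j = 4 * i + (4 - r)"
      "4 * (Suc a + i) + j = 4 * i + (j + 4 * Suc a)" "j \<le> 4 * (Suc a + i)" "odd (4 * (Suc a + i) + j)"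
      using r j by auto
    have s: "node_sign (4 * (Suc a + i)) = 1" by (simp add: node_sign_def)
    show ?thesis
      unfolding node_mixed[OF e(5)] if_P[OF e(4)] unfolding e(2,3) s unfolding e(1) by (simp only: mult_1_right)
  qed
  have lo: "node (4 * i) j = (P i)\<^sup>2 * fps_X ^ (4 * (Suc a - Suc i) + r) * inverse (U (Suc a - Suc i) * V i)" if "i < Suc a" for i
  proof -
    have e: "j - 4 * i = 4 * (Suc a - Suc i) + r" "\<not> j \<le> 4 * i" "odd (4 * i + j)"
      using that r j by auto
    show ?thesis
      unfolding node_mixed[OF e(3)] if_not_P[OF e(2)] e(1) P_def U_def V_def by (simp add: node_sign_def)
  qed
  have L: "flim (\<lambda>N. \<Prod>i<N. node (4 * i) j) ((\<Prod>i<Suc a. node (4 * i) j)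
      * ((qpoch 1 4 (4 * a + 4))\<^sup>2 * inverse (qpoch 1 4 (4 - r) * qpoch 1 4 (j + 4 * Suc a))))"
    by (rule flim_prod_shift, unfold hi, rule flim_node_product) (use r0 in auto)
  have X: "(\<Prod>i<Suc a. fps_X ^ (4 * (Suc a - Suc i) + r)) = (fps_X ^ ((a + 1) * (2 * a + r)) :: rat fps)"
  proof -
    have "(\<Prod>i<Suc a. fps_X ^ (4 * (Suc a - Suc i) + r)) = (\<Prod>i<Suc a. fps_X ^ (4 * i + r) :: rat fps)"
      by (rule prod.nat_diff_reindex)
    also have "\<dots> = fps_X ^ (2 * Suc a * (Suc a - 1) + r * Suc a)"
      using prod_X_power_arith[of 2 r "Suc a"] by simp
    also have "2 * Suc a * (Suc a - 1) + r * Suc a = (a + 1) * (2 * a + r)" by (simp add: algebra_simps)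
    finally show ?thesis .
  qed
  have U: "(\<Prod>i<Suc a. U (Suc a - Suc i)) = prod U {..<Suc a}" by (rule prod.nat_diff_reindex)
  have fin: "(\<Prod>i<Suc a. node (4 * i) j) = (prod P {..<Suc a})\<^sup>2 * fps_X ^ ((a + 1) * (2 * a + r)) * inverse (prod U {..<Suc a} * prod V {..<Suc a})"
  proof -
    have "(\<Prod>i<Suc a. node (4 * i) j) = (\<Prod>i<Suc a. (P i)\<^sup>2 * fps_X ^ (4 * (Suc a - Suc i) + r) * inverse (U (Suc a - Suc i) * V i))"
      by (rule prod.cong[OF refl]) (simp only: lessThan_iff lo)
    also have "\<dots> = (prod P {..<Suc a})\<^sup>2 * (\<Prod>i<Suc a. fps_X ^ (4 * (Suc a - Suc i) + r)) * inverse ((\<Prod>i<Suc a. U (Suc a - Suc i)) * prod V {..<Suc a})"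
      by (simp only: prod.distrib fps_inverse_prod prod_power_distrib fps_inverse_mult)
    finally show ?thesis unfolding X U .
  qed
  have 1: "prod P {..<Suc a} * qpoch 1 4 (4 * a + 4) = 2 * qpoch 1 4 4"
  proof -
    have e: "4 * Suc i = 4 * i + 4" "4 * i + 4 = 4 + 4 * i" for i :: nat by auto
    have "prod P {..<Suc a} = 2 * (\<Prod>i<a. 1 + 1 * fps_X ^ (4 * i + 4))"
      unfolding P_def prod.lessThan_Suc_shift o_def e(1) by simp
    then show ?thesis using qpoch_shift[of 4 4 1 a] by (simp add: e(2)[of a] mult.assoc)
  qed
  have 2: "prod V {..<Suc a} * qpoch 1 4 (j + 4 * Suc a) = qpoch 1 4 j"
    unfolding V_def by (rule qpoch_shift[symmetric]) (use r0 in auto)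
  have 3: "prod U {..<Suc a} * qpoch 1 4 j = (1 + fps_X ^ j) * qpoch 1 4 r"
  proof -
    have e: "r + 4 * a = j" by (simp add: j)
    have "prod U {..<Suc a} = prod U {..<a} * (1 + fps_X ^ j)" by (simp add: U_def j)
    then show ?thesis using qpoch_shift[of 4 r 1 a] r0 unfolding e U_def by (simp add: mult_ac)
  qed
  have 4: "qpoch 1 4 r * qpoch 1 4 (4 - r) = qpoch 1 2 1"
  proof -
    have "qpoch 1 4 r * qpoch 1 4 (4 - r) = qpoch 1 4 1 * qpoch 1 4 3"
      using r by (elim disjE) (simp_all add: mult.commute)
    then show ?thesis by (simp only: qpoch_1_2_1)
  qed
  define u v w where "u = prod U {..<Suc a} * prod V {..<Suc a}"
    and "v = qpoch 1 4 (4 - r) * qpoch 1 4 (j + 4 * Suc a)" and "w = (1 + fps_X ^ j) * qpoch 1 2 1"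
  have n0: "fps_nth u 0 = 1" "fps_nth v 0 = 1" "fps_nth w 0 = 1"
    using r0 by (simp_all add: u_def v_def w_def U_def V_def fps_prod_nth_0 fps_nth_mult_X_power_low fps_X_power_nth)
  have uv: "u * v = w"
  proof -
    have ring: "(a * b) * (t' * x) = z * (t * t')" if "b * x = y" "a * y = z * t" for a b x y z t t' :: "rat fps"
    proof -
      have "(a * b) * (t' * x) = a * (b * x) * t'" by (simp only: mult_ac)
      then show ?thesis unfolding that by (simp only: mult.assoc)
    qed
    from ring[OF 2 3] show ?thesis unfolding u_def v_def w_def 4[symmetric] .
  qed
  have uv': "inverse u * inverse v = inverse w" unfolding uv[symmetric] by (simp add: fps_inverse_mult)
  have ring: "(p * p' :: rat fps) = 2 * q \<Longrightarrow> i * k = l \<Longrightarrow> (p\<^sup>2 * x * i) * (p'\<^sup>2 * k) = 4 * q\<^sup>2 * x * l" for p p' q i k l x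
    by algebra
  show ?thesis
    using L unfolding fin u_def[symmetric] v_def[symmetric] w_def[symmetric] ring[OF 1 uv'] .
qed

text \<open>The nodes below \<open>2 m\<close> give \<open>q^(1 + 3 + ... + (2 m - 1))\<close>.
  Their differences with \<open>2 m\<close>, continued by the sums, form one product
  \<open>(- q; q^2)_inf\<close>, the differences above \<open>2 m\<close> another.\<close>

lemma flim_cross_even:
  assumes m: "even m"
  shows "flim (\<lambda>N. \<Prod>i<N. node (2 * i + 1) (2 * m))
    ((qpoch (- 1) 2 1)\<^sup>2 * fps_X ^ (m * m) * inverse ((qpoch 1 2 1)\<^sup>2))"
proof -
  define P where "P = (\<lambda>i::nat. 1 + (- 1) * fps_X ^ (2 * i + 1) :: rat fps)"
  define U where "U = (\<lambda>i::nat. 1 + 1 * fps_X ^ (2 * i + 1) :: rat fps)"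
  define V where "V = (\<lambda>i::nat. 1 + 1 * fps_X ^ (2 * i + (1 + 2 * m)) :: rat fps)"
  have hi: "node (2 * (m + i) + 1) (2 * m) = (1 + (- 1) * fps_X ^ (2 * i + (1 + 2 * m)))\<^sup>2
      * inverse ((1 + 1 * fps_X ^ (2 * i + 1)) * (1 + 1 * fps_X ^ (2 * i + (1 + 2 * m + 2 * m))))" for i
  proof -
    have e: "2 * (m + i) + 1 = 2 * i + (1 + 2 * m)" "2 * (m + i) + 1 - 2 * m = 2 * i + 1"
      "2 * (m + i) + 1 + 2 * m = 2 * i + (1 + 2 * m + 2 * m)" "2 * m \<le> 2 * (m + i) + 1" "odd (2 * (m + i) + 1 + 2 * m)"
      by auto
    have s: "node_sign (2 * (m + i) + 1) = - 1" by (simp add: node_sign_def)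
    show ?thesis
      unfolding node_mixed[OF e(5)] if_P[OF e(4)] unfolding e(2,3) s unfolding e(1) by (simp only: mult_1_right)
  qed
  have lo: "node (2 * i + 1) (2 * m) = (P i)\<^sup>2 * fps_X ^ (2 * (m - Suc i) + 1) * inverse (U (m - Suc i) * V i)" if "i < m" for i
  proof -
    have e: "2 * m - (2 * i + 1) = 2 * (m - Suc i) + 1" "\<not> 2 * m \<le> 2 * i + 1" "odd (2 * i + 1 + 2 * m)"
      "2 * i + 1 + 2 * m = 2 * i + (1 + 2 * m)"
      using that by auto
    show ?thesis
      unfolding node_mixed[OF e(3)] if_not_P[OF e(2)] e(1) P_def U_def V_def e(4) by (simp add: node_sign_def)
  qed
  have L: "flim (\<lambda>N. \<Prod>i<N. node (2 * i + 1) (2 * m)) ((\<Prod>i<m. node (2 * i + 1) (2 * m))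
      * ((qpoch (- 1) 2 (1 + 2 * m))\<^sup>2 * inverse (qpoch 1 2 1 * qpoch 1 2 (1 + 2 * m + 2 * m))))"
    by (rule flim_prod_shift, unfold hi, rule flim_node_product) auto
  have X: "(\<Prod>i<m. fps_X ^ (2 * (m - Suc i) + 1)) = (fps_X ^ (m * m) :: rat fps)"
  proof -
    have "(\<Prod>i<m. fps_X ^ (2 * (m - Suc i) + 1)) = (\<Prod>i<m. fps_X ^ (2 * i + 1) :: rat fps)"
      by (rule prod.nat_diff_reindex)
    also have "\<dots> = fps_X ^ (m * (m - 1) + m)"
      using prod_X_power_arith[of 1 1 m] by simp
    also have "m * (m - 1) + m = m * m" by (cases m) auto
    finally show ?thesis .
  qed
  have U: "(\<Prod>i<m. U (m - Suc i)) = prod U {..<m}" by (rule prod.nat_diff_reindex)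
  have fin: "(\<Prod>i<m. node (2 * i + 1) (2 * m)) = (prod P {..<m})\<^sup>2 * fps_X ^ (m * m) * inverse (prod U {..<m} * prod V {..<m})"
  proof -
    have "(\<Prod>i<m. node (2 * i + 1) (2 * m)) = (\<Prod>i<m. (P i)\<^sup>2 * fps_X ^ (2 * (m - Suc i) + 1) * inverse (U (m - Suc i) * V i))"
      by (rule prod.cong[OF refl]) (simp only: lessThan_iff lo)
    also have "\<dots> = (prod P {..<m})\<^sup>2 * (\<Prod>i<m. fps_X ^ (2 * (m - Suc i) + 1)) * inverse ((\<Prod>i<m. U (m - Suc i)) * prod V {..<m})"
      by (simp only: prod.distrib fps_inverse_prod prod_power_distrib fps_inverse_mult)
    finally show ?thesis unfolding X U .
  qed
  have 1: "prod P {..<m} * qpoch (- 1) 2 (1 + 2 * m) = qpoch (- 1) 2 1"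
    unfolding P_def by (rule qpoch_shift[symmetric]) auto
  have 2: "prod V {..<m} * qpoch 1 2 (1 + 2 * m + 2 * m) = qpoch 1 2 (1 + 2 * m)"
    unfolding V_def by (rule qpoch_shift[symmetric]) auto
  have 3: "prod U {..<m} * qpoch 1 2 (1 + 2 * m) = qpoch 1 2 1"
    unfolding U_def by (rule qpoch_shift[symmetric]) auto
  define u v where "u = prod U {..<m} * prod V {..<m}"
    and "v = qpoch 1 2 1 * qpoch 1 2 (1 + 2 * m + 2 * m)"
  have uv: "u * v = (qpoch 1 2 1)\<^sup>2"
  proof -
    have ring: "(a * b) * (z * x) = z\<^sup>2" if "b * x = y" "a * y = z" for a b x y z :: "rat fps"
    proof -
      have "(a * b) * (z * x) = a * (b * x) * z" by (simp only: mult_ac)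
      then show ?thesis unfolding that by (simp only: power2_eq_square)
    qed
    from ring[OF 2 3] show ?thesis unfolding u_def v_def .
  qed
  have uv': "inverse u * inverse v = inverse ((qpoch 1 2 1)\<^sup>2)" unfolding uv[symmetric] by (simp add: fps_inverse_mult)
  have ring: "(p * p' :: rat fps) = q \<Longrightarrow> i * k = l \<Longrightarrow> (p\<^sup>2 * x * i) * (p'\<^sup>2 * k) = q\<^sup>2 * x * l" for p p' q i k l x
    by (auto simp: power_mult_distrib mult_ac)
  show ?thesis
    using L unfolding fin u_def[symmetric] v_def[symmetric] ring[OF 1 uv'] .
qed

definition even_block :: "nat \<Rightarrow> nat \<Rightarrow> rat fps" where
  "even_block N k = (\<Prod>i\<in>{..<N} - {k}. node (4 * i) (4 * k))"

lemma fps_compose_inverse_X_power: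
  fixes F :: "'a::field fps"
  assumes "fps_nth F 0 \<noteq> 0" "m > 0"
  shows "inverse F oo fps_X ^ m = inverse (F oo fps_X ^ m)"
  using assms by (intro fps_inverse_compose) auto

text \<open>The value of the limit is irrelevant: only the terms that are not series in \<open>q^4\<close> are used.\<close>

lemma flim_even_block: "\<exists>G. flim (\<lambda>N. even_block N k) (G oo fps_X ^ 4)"
proof -
  define g where "g i = (1 + 1 * fps_X ^ i)\<^sup>2 * node_exp (\<lambda>_. 1) i k * inverse (node_den (\<lambda>_. 1) i k)" for i
  have 0: "fps_nth (fps_X ^ 4 :: rat fps) 0 = 0" by simp
  have g: "g i oo fps_X ^ 4 = node (4 * i) (4 * k)" if "i \<noteq> k" for i
  proof -
    have e: "node_exp (\<lambda>_. 1) i k oo fps_X ^ 4 = node_exp node_sign (4 * i) (4 * k)"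
      by (auto simp: node_exp_def node_sign_def fps_compose_uminus fps_X_power_compose_X_power diff_mult_distrib2)
    have d: "node_den (\<lambda>_. 1) i k oo fps_X ^ 4 = node_den node_sign (4 * i) (4 * k)"
      unfolding node_den_def fps_compose_mult_distrib[OF 0]
      by (auto simp: node_sign_def fps_compose_sub_distrib fps_X_power_compose_X_power diff_mult_distrib2 distrib_left)
    have p: "(1 + 1 * fps_X ^ i)\<^sup>2 oo fps_X ^ 4 = (1 + node_sign (4 * i) * fps_X ^ (4 * i))\<^sup>2"
      by (simp add: node_sign_def power2_eq_square fps_compose_mult_distrib[OF 0] fps_compose_add_distrib fps_X_power_compose_X_power)
    have "inverse (node_den (\<lambda>_. 1) i k) oo fps_X ^ 4 = inverse (node_den (\<lambda>_. 1) i k oo fps_X ^ 4)"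
      by (rule fps_compose_inverse_X_power) (simp_all add: node_den_nth_0 that)
    then show ?thesis
      unfolding g_def fps_compose_mult_distrib[OF 0] e p d[symmetric] by (simp add: node_def d)
  qed
  have hi: "g (Suc k + i) = (1 + 1 * fps_X ^ (1 * i + Suc k))\<^sup>2
      * inverse ((1 + (- 1) * fps_X ^ (1 * i + 1)) * (1 + (- 1) * fps_X ^ (1 * i + (k + Suc k))))" for i
  proof -
    have e: "Suc k + i = 1 * i + Suc k" "Suc k + i - k = 1 * i + 1" "Suc k + i + k = 1 * i + (k + Suc k)" "k \<le> Suc k + i" by auto
    show ?thesis
      unfolding g_def node_exp_def node_den_def if_P[OF e(4)] unfolding e(2,3) unfolding e(1) by simp
  qed
  define G where "G = (\<Prod>i<k. g i) * ((qpoch 1 1 (Suc k))\<^sup>2 * inverse (qpoch (- 1) 1 1 * qpoch (- 1) 1 (k + Suc k)))"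
  have "flim (\<lambda>N. \<Prod>i\<in>{..<N} - {k}. g i) G"
    unfolding G_def by (rule flim_prod_skip, unfold hi, rule flim_node_product) auto
  then have "flim (\<lambda>N. (\<Prod>i\<in>{..<N} - {k}. g i) oo fps_X ^ 4) (G oo fps_X ^ 4)"
    by (rule flim_compose_X_power) simp
  moreover have "(\<Prod>i\<in>{..<N} - {k}. g i) oo fps_X ^ 4 = even_block N k" for N
    unfolding fps_compose_prod_distrib[OF 0] even_block_def by (rule prod.cong[OF refl]) (simp add: g)
  ultimately show ?thesis by auto
qed

lemma sum_nodes:
  assumes "N > 0"
  shows "(\<Sum>n<N. odd_block N n * (\<Prod>i<N. node (4 * i) (2 * n + 1)))
    + (\<Sum>k<N. (\<Prod>i<N. node (2 * i + 1) (4 * k)) * even_block N k) = 1"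
proof -
  let ?o = "\<lambda>i::nat. 2 * i + 1" and ?e = "\<lambda>i::nat. 4 * i"
  have inj: "inj_on ?o S" "inj_on ?e S" for S by (auto simp: inj_on_def)
  have oe: "?o i \<noteq> ?e k" "?e k \<noteq> ?o i" for i k
    by presburger+
  define A B where "A = ?o ` {..<N}" and "B = ?e ` {..<N}"
  have AB: "A \<inter> B = {}" "finite A" "finite B" unfolding A_def B_def using oe by auto
  have prod_A: "prod f A = (\<Prod>i<N. f (?o i))" and prod_B: "prod f B = (\<Prod>i<N. f (?e i))"
    for f :: "nat \<Rightarrow> rat fps"
    unfolding A_def B_def by (simp_all only: prod.reindex[OF inj(1)] prod.reindex[OF inj(2)] o_def)
  have sum_A: "sum f A = (\<Sum>i<N. f (?o i))" and sum_B: "sum f B = (\<Sum>i<N. f (?e i))"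
    for f :: "nat \<Rightarrow> rat fps"
    unfolding A_def B_def by (simp_all only: sum.reindex[OF inj(1)] sum.reindex[OF inj(2)] o_def)
  have "1 = (\<Sum>k\<in>A \<union> B. \<Prod>l\<in>A \<union> B - {k}. node l k)"
    unfolding node_def by (rule partition_of_unity[symmetric]) (use assms AB in \<open>auto simp: A_def B_def node_sign_def\<close>)
  also have "\<dots> = (\<Sum>k\<in>A. \<Prod>l\<in>A \<union> B - {k}. node l k) + (\<Sum>k\<in>B. \<Prod>l\<in>A \<union> B - {k}. node l k)"
    by (rule sum.union_disjoint) (use AB in auto)
  also have "(\<Sum>k\<in>A. \<Prod>l\<in>A \<union> B - {k}. node l k) = (\<Sum>n<N. odd_block N n * (\<Prod>i<N. node (4 * i) (2 * n + 1)))"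
    unfolding sum_A
  proof (rule sum.cong[OF refl])
    fix n
    have e: "A \<union> B - {?o n} = ?o ` ({..<N} - {n}) \<union> B" "?o ` ({..<N} - {n}) \<inter> B = {}"
    proof -
      have "A - {?o n} = ?o ` ({..<N} - {n})" unfolding A_def by auto
      moreover have "?o n \<notin> B" unfolding B_def using oe by blast
      ultimately show "A \<union> B - {?o n} = ?o ` ({..<N} - {n}) \<union> B" by blast
      show "?o ` ({..<N} - {n}) \<inter> B = {}" using AB(1) unfolding A_def by blast
    qed
    have "(\<Prod>l\<in>A \<union> B - {?o n}. node l (?o n)) = (\<Prod>l\<in>?o ` ({..<N} - {n}). node l (?o n)) * (\<Prod>l\<in>B. node l (?o n))"
      unfolding e(1) by (rule prod.union_disjoint) (use e(2) AB in auto)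
    then show "(\<Prod>l\<in>A \<union> B - {?o n}. node l (?o n)) = odd_block N n * (\<Prod>i<N. node (4 * i) (2 * n + 1))"
      unfolding prod_B odd_block_def node_odd_odd[symmetric] by (simp only: prod.reindex[OF inj(1)] o_def)
  qed
  also have "(\<Sum>k\<in>B. \<Prod>l\<in>A \<union> B - {k}. node l k) = (\<Sum>k<N. (\<Prod>i<N. node (2 * i + 1) (4 * k)) * even_block N k)"
    unfolding sum_B
  proof (rule sum.cong[OF refl])
    fix k
    have e: "A \<union> B - {?e k} = A \<union> ?e ` ({..<N} - {k})" "A \<inter> ?e ` ({..<N} - {k}) = {}"
    proof -
      have "B - {?e k} = ?e ` ({..<N} - {k})" unfolding B_def by auto
      moreover have "?e k \<notin> A" unfolding A_def using oe by blast
      ultimately show "A \<union> B - {?e k} = A \<union> ?e ` ({..<N} - {k})" by blast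
      show "A \<inter> ?e ` ({..<N} - {k}) = {}" using AB(1) unfolding B_def by blast
    qed
    have "(\<Prod>l\<in>A \<union> B - {?e k}. node l (?e k)) = (\<Prod>l\<in>A. node l (?e k)) * (\<Prod>l\<in>?e ` ({..<N} - {k}). node l (?e k))"
      unfolding e(1) by (rule prod.union_disjoint) (use e(2) AB in auto)
    then show "(\<Prod>l\<in>A \<union> B - {?e k}. node l (?e k)) = (\<Prod>i<N. node (2 * i + 1) (4 * k)) * even_block N k"
      unfolding prod_A even_block_def by (simp only: prod.reindex[OF inj(2)] o_def)
  qed
  finally show ?thesis by simp
qed

lemma flim_odd_block:
  "flim (\<lambda>N. odd_block N n) ((qpoch (- 1) 2 1)\<^sup>2 * ((- 1) ^ n * fps_X ^ (n * (n + 1)))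
      * ((1 + fps_X ^ (2 * n + 1)) * inverse (1 - fps_X ^ (2 * n + 1))) * (inverse (Euler 2) * inverse (Euler 2)))"
proof (rule flim_eventually)
  have i: "flim (\<lambda>N. inverse (fpoch (fps_X\<^sup>2) N)) (inverse (Euler 2))"
    by (rule flim_inverse[OF flim_fpoch]) (simp_all add: fpoch_nth_0)
  have "flim (\<lambda>N. \<Prod>i<N. 1 - fps_X ^ (2 * i + 1)) (qpoch (- 1) 2 1)"
    using flim_qpoch[of 2 1 "- 1"] by simp
  then show "flim (\<lambda>N. (\<Prod>i<N. 1 - fps_X ^ (2 * i + 1))\<^sup>2 * ((- 1) ^ n * fps_X ^ (n * (n + 1)))
      * ((1 + fps_X ^ (2 * n + 1)) * inverse (1 - fps_X ^ (2 * n + 1)))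
      * (inverse (fpoch (fps_X\<^sup>2) (N - Suc n)) * inverse (fpoch (fps_X\<^sup>2) (N + n))))
    ((qpoch (- 1) 2 1)\<^sup>2 * ((- 1) ^ n * fps_X ^ (n * (n + 1)))
      * ((1 + fps_X ^ (2 * n + 1)) * inverse (1 - fps_X ^ (2 * n + 1))) * (inverse (Euler 2) * inverse (Euler 2)))"
    unfolding power2_eq_square[of "qpoch _ _ _"] power2_eq_square[of "prod _ _"]
  proof (intro flim_mult flim_const flim_reindex[OF i])
    show "\<exists>N0. \<forall>N\<ge>N0. M \<le> N - Suc n" "\<exists>N0. \<forall>N\<ge>N0. M \<le> N + n" for M
      by (intro exI[of _ "M + Suc n"] allI impI; linarith)+
  qed
next
  fix N assume "Suc n \<le> N"
  then have n: "n < N" by simp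
  show "(\<Prod>i<N. 1 - fps_X ^ (2 * i + 1))\<^sup>2 * ((- 1) ^ n * fps_X ^ (n * (n + 1)))
      * ((1 + fps_X ^ (2 * n + 1)) * inverse (1 - fps_X ^ (2 * n + 1)))
      * (inverse (fpoch (fps_X\<^sup>2) (N - Suc n)) * inverse (fpoch (fps_X\<^sup>2) (N + n))) = odd_block N n"
    by (rule odd_block_eq[OF n, symmetric])
qed

definition mock_term :: "nat \<Rightarrow> rat fps" where
  "mock_term n = (- 1) ^ n * fps_X ^ ((n + 1) * (3 * n + 2) div 2) * inverse (1 - fps_X ^ (2 * n + 1))"

lemma flim_odd_term:
  "flim (\<lambda>N. odd_block N n * (\<Prod>i<N. node (4 * i) (2 * n + 1)))
    (4 * (qpoch (- 1) 2 1)\<^sup>2 * (qpoch 1 4 4)\<^sup>2 * (inverse (Euler 2))\<^sup>2 * inverse (qpoch 1 2 1) * mock_term n)"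
proof -
  define a r where "a = (2 * n + 1) div 4" and "r = (2 * n + 1) mod 4"
  have j: "2 * n + 1 = 4 * a + r" by (simp add: a_def r_def)
  have r: "r = 1 \<or> r = 3" unfolding r_def by presburger
  \<comment> \<open>The exponents of the odd block and of the cross product add up to that of
    \<open>mock_term\<close>; the spacing 4 of the additional nodes is chosen for this.\<close>
  have h: "n * (n + 1) + (a + 1) * (2 * a + r) = (n + 1) * (3 * n + 2) div 2"
  proof -
    have n: "n = 2 * a + (r - 1) div 2" using j r by auto
    have "2 * (n * (n + 1) + (a + 1) * (2 * a + r)) = (n + 1) * (3 * n + 2)"
      using r unfolding n by (auto simp: algebra_simps)
    then show ?thesis by simp
  qed
  define y :: "rat fps" where "y = fps_X ^ (2 * n + 1)"
  have y: "(1 + y) * inverse (1 + y) = 1" by (rule fps_inverse_unit) (simp add: y_def)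
  define U where "U = ((qpoch (- 1) 2 1)\<^sup>2 * ((- 1) ^ n * fps_X ^ (n * (n + 1))) * ((1 + y) * inverse (1 - y)) * (inverse (Euler 2) * inverse (Euler 2)))
      * (4 * (qpoch 1 4 4)\<^sup>2 * fps_X ^ ((a + 1) * (2 * a + r)) * inverse ((1 + y) * qpoch 1 2 1))"
  have L: "flim (\<lambda>N. odd_block N n * (\<Prod>i<N. node (4 * i) (2 * n + 1))) U"
    unfolding U_def y_def by (rule flim_mult[OF flim_odd_block flim_cross_odd[OF j r]])
  have "U = 4 * (qpoch (- 1) 2 1)\<^sup>2 * (qpoch 1 4 4)\<^sup>2 * (inverse (Euler 2))\<^sup>2 * inverse (qpoch 1 2 1) * mock_term n * ((1 + y) * inverse (1 + y))"
    unfolding U_def mock_term_def h[symmetric] y_def[symmetric] power_add[of fps_X "n * (n + 1)"] fps_inverse_mult power2_eq_square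
    by (simp only: mult_ac)
  then show ?thesis using L unfolding y mult_1_right by simp
qed

lemma fsum_if_less: "fsum UNIV (\<lambda>n. if n < N then f n else 0) = (\<Sum>n<N. f n)" for f :: "nat \<Rightarrow> 'a::comm_monoid_add fps"
  by (rule fps_ext, subst fsum_nth[of "{..<N}"]) (auto simp: fps_sum_nth)

lemma flim_fsum_triangle:
  fixes f :: "nat \<Rightarrow> nat \<Rightarrow> 'a::comm_monoid_add fps"
  assumes lim: "\<And>n. flim (\<lambda>N. f N n) (g n)"
    and low: "\<And>N n k. n < N \<Longrightarrow> k < n \<Longrightarrow> fps_nth (f N n) k = 0"
  shows "flim (\<lambda>N. \<Sum>n<N. f N n) (fsum UNIV g)"
  unfolding fsum_if_less[symmetric]
proof (rule flim_fsum[where e = "\<lambda>n. n"])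
  show "flim (\<lambda>N. if n < N then f N n else 0) (g n)" for n
    by (rule flim_eventually[OF lim, of "Suc n"]) simp
qed (use low in auto)

text \<open>Limit of \<open>sum_nodes\<close>. In the second sum everything apart from one common
  quotient of products is a series in \<open>q^4\<close>, because the cross product contributes
  \<open>q^(m^2)\<close> with \<open>m = 2 k\<close>.\<close>

theorem mock_theta_identity:
  obtains G :: "nat \<Rightarrow> rat fps" where
    "1 = fsum UNIV (\<lambda>n. 4 * (qpoch (- 1) 2 1)\<^sup>2 * (qpoch 1 4 4)\<^sup>2 * (inverse (Euler 2))\<^sup>2 * inverse (qpoch 1 2 1) * mock_term n)
      + fsum UNIV (\<lambda>k. (qpoch (- 1) 2 1)\<^sup>2 * inverse ((qpoch 1 2 1)\<^sup>2) * (fps_X ^ (4 * k\<^sup>2) * (G k oo fps_X ^ 4)))"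
proof -
  obtain G where G: "\<And>k. flim (\<lambda>N. even_block N k) (G k oo fps_X ^ 4)"
    using flim_even_block by metis
  have c: "flim (\<lambda>N. (\<Prod>i<N. node (2 * i + 1) (4 * k)) * even_block N k)
      ((qpoch (- 1) 2 1)\<^sup>2 * inverse ((qpoch 1 2 1)\<^sup>2) * (fps_X ^ (4 * k\<^sup>2) * (G k oo fps_X ^ 4)))" for k
  proof -
    have e: "2 * (2 * k) = 4 * k" "2 * k * (2 * k) = 4 * k\<^sup>2" by (simp_all add: power2_eq_square)
    have "even (2 * k)" by simp
    from flim_mult[OF flim_cross_even[OF this] G[of k], unfolded e] show ?thesis
      by (simp only: mult_ac)
  qed
  have "flim (\<lambda>N. (\<Sum>n<N. odd_block N n * (\<Prod>i<N. node (4 * i) (2 * n + 1)))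
    + (\<Sum>k<N. (\<Prod>i<N. node (2 * i + 1) (4 * k)) * even_block N k))
     (fsum UNIV (\<lambda>n. 4 * (qpoch (- 1) 2 1)\<^sup>2 * (qpoch 1 4 4)\<^sup>2 * (inverse (Euler 2))\<^sup>2 * inverse (qpoch 1 2 1) * mock_term n)
      + fsum UNIV (\<lambda>k. (qpoch (- 1) 2 1)\<^sup>2 * inverse ((qpoch 1 2 1)\<^sup>2) * (fps_X ^ (4 * k\<^sup>2) * (G k oo fps_X ^ 4))))"
  proof (rule flim_add[OF flim_fsum_triangle flim_fsum_triangle], rule flim_odd_term)
    fix N n k :: nat assume n: "n < N" and "k < n"
    then have k: "k < n * (n + 1)" by (simp add: less_le_trans)
    have "odd_block N n * (\<Prod>i<N. node (4 * i) (2 * n + 1)) = ((\<Prod>i<N. 1 - fps_X ^ (2 * i + 1))\<^sup>2 * (- 1) ^ n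
      * ((1 + fps_X ^ (2 * n + 1)) * inverse (1 - fps_X ^ (2 * n + 1)))
      * (inverse (fpoch (fps_X\<^sup>2) (N - Suc n)) * inverse (fpoch (fps_X\<^sup>2) (N + n))) * (\<Prod>i<N. node (4 * i) (2 * n + 1))) * fps_X ^ (n * (n + 1))"
      unfolding odd_block_eq[OF n] by (simp only: mult_ac)
    then show "fps_nth (odd_block N n * (\<Prod>i<N. node (4 * i) (2 * n + 1))) k = 0"
      using k by (simp only: fps_nth_mult_X_power_low)
  next
    show "flim (\<lambda>N. (\<Prod>i<N. node (2 * i + 1) (4 * k)) * even_block N k)
      ((qpoch (- 1) 2 1)\<^sup>2 * inverse ((qpoch 1 2 1)\<^sup>2) * (fps_X ^ (4 * k\<^sup>2) * (G k oo fps_X ^ 4)))" for k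
      by (rule c)
  next
    fix N n k :: nat assume n: "n < N" and k: "k < n"
    \<comment> \<open>The factor of the node 1 alone carries \<open>q^(4 n - 1)\<close>, which
      exceeds the order \<open>k\<close> in question.\<close>
    have e: "\<not> 4 * n \<le> 2 * 0 + 1" "odd (2 * 0 + 1 + 4 * n)" "k < 4 * n - (2 * 0 + 1)" using k by auto
    obtain M where M: "N = Suc M" using n by (cases N) auto
    define R where "R = (1 + node_sign (2 * 0 + 1) * fps_X ^ (2 * 0 + 1))\<^sup>2 *
      inverse ((1 + 1 * fps_X ^ (4 * n - (2 * 0 + 1))) * (1 + 1 * fps_X ^ (2 * 0 + 1 + 4 * n)))"
    have "node (2 * 0 + 1) (4 * n) = R * fps_X ^ (4 * n - (2 * 0 + 1))"
      unfolding node_mixed[OF e(2)] if_not_P[OF e(1)] R_def by (simp only: mult_ac)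
    then have "(\<Prod>i<N. node (2 * i + 1) (4 * n)) * even_block N n
      = (R * (\<Prod>i<M. node (2 * Suc i + 1) (4 * n)) * even_block N n) * fps_X ^ (4 * n - (2 * 0 + 1))"
      unfolding M prod.lessThan_Suc_shift o_def by (simp only: mult_ac)
    then show "fps_nth ((\<Prod>i<N. node (2 * i + 1) (4 * n)) * even_block N n) k = 0"
      using e(3) by (simp only: fps_nth_mult_X_power_low)
  qed
  then have "flim (\<lambda>_. 1) (fsum UNIV (\<lambda>n. 4 * (qpoch (- 1) 2 1)\<^sup>2 * (qpoch 1 4 4)\<^sup>2 * (inverse (Euler 2))\<^sup>2 * inverse (qpoch 1 2 1) * mock_term n)
      + fsum UNIV (\<lambda>k. (qpoch (- 1) 2 1)\<^sup>2 * inverse ((qpoch 1 2 1)\<^sup>2) * (fps_X ^ (4 * k\<^sup>2) * (G k oo fps_X ^ 4))))"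
    by (rule flim_eventually[where ?N0.0 = 1]) (rule sum_nodes, simp)
  from flim_unique[OF flim_const this] show ?thesis by (rule that)
qed

subsection \<open>Dissection of the product and the congruences for omega\<close>

lemma fps_section_add: "fps_section m r (F + G) = fps_section m r F + fps_section m r G"
  by (simp add: fps_eq_iff)

lemma fsum_compose_X_power:
  fixes F :: "'i \<Rightarrow> 'a::comm_ring_1 fps"
  assumes "m > 0" shows "fsum I F oo fps_X ^ m = fsum I (\<lambda>i. F i oo fps_X ^ m)"
proof (rule fps_ext)
  fix n
  show "fps_nth (fsum I F oo fps_X ^ m) n = fps_nth (fsum I (\<lambda>i. F i oo fps_X ^ m)) n"
    using assms by (cases "m dvd n") (simp_all add: fps_nth_compose_X_power fsum_def)
qed

lemma fps_section_compose:
  fixes G :: "'a::comm_ring_1 fps"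
  assumes "r < m" shows "fps_section m r (G oo fps_X ^ m) = (if r = 0 then G else 0)"
proof -
  have "fps_section m r 1 = (if r = 0 then 1 else 0 :: 'a fps)"
    using assms by (auto simp: fps_eq_iff)
  then show ?thesis using fps_section_mult[OF assms, of G 1] by simp
qed

lemma fps_section_2_decomposition:
  fixes F0 F1 :: "'a::comm_ring_1 fps"
  shows "fps_section 2 0 ((F0 oo fps_X ^ 2) + fps_X * (F1 oo fps_X ^ 2)) = F0"
    and "fps_section 2 1 ((F0 oo fps_X ^ 2) + fps_X * (F1 oo fps_X ^ 2)) = F1"
proof -
  have "fps_section 2 0 fps_X = (0 :: 'a fps)" by (auto simp: fps_eq_iff fps_X_def)
  moreover have "fps_section 2 1 fps_X = (1 :: 'a fps)" by (auto simp: fps_eq_iff fps_X_def)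
  ultimately have X: "fps_section 2 0 (fps_X * (F1 oo fps_X ^ 2)) = 0" "fps_section 2 1 (fps_X * (F1 oo fps_X ^ 2)) = F1"
    using fps_section_mult[of 0 2 F1 fps_X] fps_section_mult[of 1 2 F1 fps_X] by (simp_all add: mult.commute)
  show "fps_section 2 0 ((F0 oo fps_X ^ 2) + fps_X * (F1 oo fps_X ^ 2)) = F0"
    unfolding fps_section_add X by (simp add: fps_section_compose)
  show "fps_section 2 1 ((F0 oo fps_X ^ 2) + fps_X * (F1 oo fps_X ^ 2)) = F1"
    unfolding fps_section_add X by (simp add: fps_section_compose)
qed

text \<open>Pairs \<open>(a, b)\<close> are \<open>(u + v, u - v)\<close> or
  \<open>(u + v + 1, u - v)\<close> by parity, with sum of squares \<open>2 (u^2 + v^2)\<close>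
  resp. \<open>1 + 2 (u (u + 1) + v (v + 1))\<close>.\<close>

lemma theta_even_square:
  "theta_even (\<lambda>_. 1) * theta_even (\<lambda>_. 1)
    = ((theta_even (\<lambda>_. 1) * theta_even (\<lambda>_. 1)) oo fps_X ^ 2)
      + fps_X * ((theta_odd (\<lambda>_. 1) * theta_odd (\<lambda>_. 1)) oo fps_X ^ 2 :: rat fps)"
proof -
  define e :: "int \<Rightarrow> rat fps" where "e k = fps_X ^ nat (k\<^sup>2)" for k
  define o' :: "int \<Rightarrow> rat fps" where "o' k = fps_X ^ (2 * tri k)" for k
  have le: "lfin UNIV e" and lo: "lfin UNIV o'"
    using lfin_theta_even[of "\<lambda>_. 1 :: rat fps"] lfin_theta_odd[of "\<lambda>_. 1 :: rat fps"] by (simp_all add: e_def[abs_def] o'_def[abs_def])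
  have te: "theta_even (\<lambda>_. 1) = fsum UNIV e" and to: "theta_odd (\<lambda>_. 1) = (fsum UNIV o' :: rat fps)"
    by (simp_all add: theta_even_def theta_odd_def e_def[abs_def] o'_def[abs_def])
  let ?P = "\<lambda>(a, b). e a * e b :: rat fps"
  define S :: "(int \<times> int) set" where "S = {(a, b). even (a + b)}"
  have l: "lfin (UNIV \<times> UNIV) ?P" by (rule lfin_times[OF le le])
  have be: "bij_betw (\<lambda>(u, v). (u + v, u - v)) (UNIV \<times> UNIV) S"
  proof (rule bij_betwI[where g = "\<lambda>(a, b). ((a + b) div 2, (a - b) div 2)"])
    have "even (a + b) \<Longrightarrow> (a + b) div 2 + (a - b) div 2 = a \<and> (a + b) div 2 - (a - b) div 2 = b" for a b :: int
      by presburger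
    then show "y \<in> S \<Longrightarrow> (\<lambda>(u, v). (u + v, u - v)) ((\<lambda>(a, b). ((a + b) div 2, (a - b) div 2)) y) = y" for y
      by (auto simp: S_def)
  qed (auto simp: S_def)
  have bo: "bij_betw (\<lambda>(u, v). (u + v + 1, u - v)) (UNIV \<times> UNIV) (- S)"
  proof (rule bij_betwI[where g = "\<lambda>(a, b). ((a + b) div 2, (a - b) div 2)"])
    have "odd (a + b) \<Longrightarrow> (a + b) div 2 + (a - b) div 2 + 1 = a \<and> (a + b) div 2 - (a - b) div 2 = b" for a b :: int
      by presburger
    then show "y \<in> - S \<Longrightarrow> (\<lambda>(u, v). (u + v + 1, u - v)) ((\<lambda>(a, b). ((a + b) div 2, (a - b) div 2)) y) = y" for y
      by (auto simp: S_def)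
  qed (auto simp: S_def)
  have "fsum UNIV e * fsum UNIV e = fsum (S \<union> - S) ?P"
    unfolding fsum_times[OF le le] by (rule fsum_cong) auto
  also have "\<dots> = fsum S ?P + fsum (- S) ?P"
    by (rule fsum_Un_disjoint) (auto intro: lfin_subset[OF l])
  also have "fsum S ?P = fsum (UNIV \<times> UNIV) (\<lambda>(u, v). (e u * e v) oo fps_X ^ 2)"
  proof (rule fsum_reindex_bij[OF be])
    fix x :: "int \<times> int"
    obtain u v where x: "x = (u, v)" by (cases x)
    have "int (nat ((u + v)\<^sup>2) + nat ((u - v)\<^sup>2)) = (u + v)\<^sup>2 + (u - v)\<^sup>2" by simp
    also have "\<dots> = 2 * (u\<^sup>2 + v\<^sup>2)" by algebra
    also have "\<dots> = int (2 * (nat (u\<^sup>2) + nat (v\<^sup>2)))" by simp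
    finally have "int (nat ((u + v)\<^sup>2) + nat ((u - v)\<^sup>2)) = int (2 * (nat (u\<^sup>2) + nat (v\<^sup>2)))" .
    then have n: "nat ((u + v)\<^sup>2) + nat ((u - v)\<^sup>2) = 2 * (nat (u\<^sup>2) + nat (v\<^sup>2))" by (simp only: of_nat_eq_iff)
    show "?P ((\<lambda>(u, v). (u + v, u - v)) x) = (\<lambda>(u, v). (e u * e v) oo fps_X ^ 2) x"
      unfolding x prod.case e_def power_add[symmetric] n by (subst fps_X_power_compose_X_power) simp_all
  qed
  also have "\<dots> = (fsum UNIV e * fsum UNIV e) oo fps_X ^ 2"
    unfolding fsum_times[OF le le] by (subst fsum_compose_X_power) (auto intro!: fsum_cong)
  also have "fsum (- S) ?P = fsum (UNIV \<times> UNIV) (\<lambda>x. fps_X * (case x of (u, v) \<Rightarrow> (o' u * o' v) oo fps_X ^ 2))"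
  proof (rule fsum_reindex_bij[OF bo])
    fix x :: "int \<times> int"
    obtain u v where x: "x = (u, v)" by (cases x)
    have "int (nat ((u + v + 1)\<^sup>2) + nat ((u - v)\<^sup>2)) = (u + v + 1)\<^sup>2 + (u - v)\<^sup>2" by simp
    also have "\<dots> = 1 + 2 * (u * (u + 1) + v * (v + 1))" by algebra
    also have "\<dots> = int (Suc (2 * (2 * tri u + 2 * tri v)))" unfolding two_tri[symmetric] by simp
    finally have "int (nat ((u + v + 1)\<^sup>2) + nat ((u - v)\<^sup>2)) = int (Suc (2 * (2 * tri u + 2 * tri v)))" .
    then have n: "nat ((u + v + 1)\<^sup>2) + nat ((u - v)\<^sup>2) = Suc (2 * (2 * tri u + 2 * tri v))" by (simp only: of_nat_eq_iff)
    show "?P ((\<lambda>(u, v). (u + v + 1, u - v)) x) = fps_X * (case x of (u, v) \<Rightarrow> (o' u * o' v) oo fps_X ^ 2)"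
      unfolding x prod.case e_def o'_def power_add[symmetric] n by (subst fps_X_power_compose_X_power) simp_all
  qed
  also have "\<dots> = fps_X * ((fsum UNIV o' * fsum UNIV o') oo fps_X ^ 2)"
  proof -
    have "lfin (UNIV \<times> UNIV) (\<lambda>(u, v). o' u * o' v)" by (rule lfin_times[OF lo lo])
    then have "lfin (UNIV \<times> UNIV) (\<lambda>x. (case x of (u, v) \<Rightarrow> (o' u * o' v)) oo fps_X ^ 2)"
      unfolding lfin_def by (auto simp: fps_nth_compose_X_power)
    then have "fsum (UNIV \<times> UNIV) (\<lambda>x. fps_X * ((case x of (u, v) \<Rightarrow> o' u * o' v) oo fps_X ^ 2))
        = fps_X * fsum (UNIV \<times> UNIV) (\<lambda>x. (case x of (u, v) \<Rightarrow> o' u * o' v) oo fps_X ^ 2)"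
      by (rule fsum_mult_left)
    moreover have "(case x of (u, v) \<Rightarrow> o' u * o' v) oo fps_X ^ 2 = (case x of (u, v) \<Rightarrow> (o' u * o' v) oo fps_X ^ 2)" for x :: "int \<times> int"
      by (cases x) simp
    ultimately show ?thesis
      unfolding fsum_times[OF lo lo] by (simp add: fsum_compose_X_power)
  qed
  finally show ?thesis unfolding te to .
qed

lemma theta_odd_psi: "theta_odd (\<lambda>_. 1) = 2 * (psi oo fps_X ^ 2)"
proof -
  have t: "tri (- 1 - int j) = tri (int j)" for j
    using two_tri[of "- 1 - int j"] two_tri[of "int j"] by (simp add: algebra_simps)
  have l: "lfin UNIV (\<lambda>k. 1 * fps_X ^ (2 * tri k) :: rat fps)" by (rule lfin_theta_odd)
  have "theta_odd (\<lambda>_. 1) = fsum UNIV (\<lambda>j::nat. fps_X ^ (2 * tri (int j))) + fsum UNIV (\<lambda>j::nat. fps_X ^ (2 * tri (int j)) :: rat fps)"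
    using fsum_int_fold[OF l] by (simp add: theta_odd_def t)
  also have "fsum UNIV (\<lambda>j::nat. fps_X ^ (2 * tri (int j))) = psi oo fps_X ^ 2"
    unfolding psi_def by (simp add: fsum_compose_X_power fps_X_power_compose_X_power)
  finally show ?thesis by (simp only: mult_2)
qed

text \<open>Euler's theorem on partitions into distinct and into odd parts, obtained by cancelling
  \<open>Euler 2\<close>.\<close>

lemma qpoch_1_1_1_inverse: "qpoch 1 1 1 * qpoch (- 1) 2 1 = 1"
proof -
  have "qpoch 1 1 1 * Euler 1 = Euler 2"
    using qpoch_plus_minus[of 1 1] by simp
  then have "(qpoch 1 1 1 * qpoch (- 1) 2 1) * Euler 2 = 1 * Euler 2"
    unfolding Euler_1 by (simp only: mult.assoc mult_1_left)
  moreover have "Euler 2 \<noteq> 0" using qpoch_nth_0[of "- 1" 2 2] by (metis fps_zero_nth zero_neq_one)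
  ultimately show ?thesis by (simp only: mult_cancel_right simp_thms)
qed

lemma qpoch_compose_neg: "b > 0 \<Longrightarrow> c > 0 \<Longrightarrow> m > 0 \<Longrightarrow> qpoch (- 1) b c oo fps_X ^ m = qpoch (- 1) (m * b) (m * c)"
  by (rule qpoch_compose) (simp_all add: fps_compose_uminus)

lemma qpoch_compose_pos: "b > 0 \<Longrightarrow> c > 0 \<Longrightarrow> m > 0 \<Longrightarrow> qpoch 1 b c oo fps_X ^ m = qpoch 1 (m * b) (m * c)"
  by (rule qpoch_compose) simp_all

lemma qpoch_product_odd: "qpoch (- 1) 2 1 * qpoch 1 2 1 * Euler 4 = Euler 2"
  unfolding Euler_2 using qpoch_plus_minus[of 2 1] by (simp add: mult.commute)

text \<open>Multiplying \<open>mock_theta_identity\<close> by \<open>(B / A)^2\<close> makes its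
  second sum a series in \<open>q^4\<close>, without coefficients at \<open>4 n + 2\<close>. The
  first sum becomes \<open>2 D^2 / E4\<close>, again in \<open>q^4\<close>, times \<open>P\<close>;
  and the index \<open>4 n + 2\<close> of \<open>P\<close> is
  \<open>2 (4 n + 1) + 1 = 8 n + 3\<close> in \<open>omega\<close>.\<close>

lemma section_quotient_omega:
  "fps_section 4 2 ((qpoch 1 2 1)\<^sup>2 * (inverse (qpoch (- 1) 2 1))\<^sup>2)
    = 2 * (qpoch 1 1 1)\<^sup>2 * inverse (Euler 1) * fps_section 8 3 mock_omega"
proof -
  define A B D E1 E2 E4 :: "rat fps" where "A = qpoch (- 1) 2 1" and "B = qpoch 1 2 1" and "D = qpoch 1 4 4"
    and "E1 = Euler 1" and "E2 = Euler 2" and "E4 = Euler 4"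
  have inv: "A * inverse A = 1" "B * inverse B = 1" "E2 * inverse E2 = 1" "E4 * inverse E4 = 1"
    by (simp_all add: A_def B_def E2_def E4_def fps_inverse_unit)
  obtain G where G: "1 = fsum UNIV (\<lambda>n. 4 * A\<^sup>2 * D\<^sup>2 * (inverse E2)\<^sup>2 * inverse B * mock_term n)
      + fsum UNIV (\<lambda>k. A\<^sup>2 * inverse (B\<^sup>2) * (fps_X ^ (4 * k\<^sup>2) * (G k oo fps_X ^ 4)))"
    using mock_theta_identity unfolding A_def B_def D_def E2_def by blast
  have l1: "lfin UNIV mock_term"
  proof (rule lfinI[of _ "\<lambda>n. n"])
    fix n k :: nat assume "k < n"
    moreover have "2 * n \<le> (n + 1) * (3 * n + 2)" by simp
    then have "n \<le> (n + 1) * (3 * n + 2) div 2" by linarith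
    ultimately have k: "k < (n + 1) * (3 * n + 2) div 2" by linarith
    have "mock_term n = ((- 1) ^ n * inverse (1 - fps_X ^ (2 * n + 1))) * fps_X ^ ((n + 1) * (3 * n + 2) div 2)"
      unfolding mock_term_def by (simp only: mult_ac)
    then show "fps_nth (mock_term n) k = 0" using k by (simp only: fps_nth_mult_X_power_low)
  qed simp
  define H where "H k = fps_X ^ (4 * k\<^sup>2) * (G k oo fps_X ^ 4)" for k :: nat
  have l2: "lfin UNIV H"
  proof (rule lfinI[of _ "\<lambda>n. n"])
    fix n k :: nat assume "k < n"
    moreover have "n \<le> 4 * n\<^sup>2" by (cases n) (auto simp: power2_eq_square)
    ultimately have "k < 4 * n\<^sup>2" by linarith
    then show "fps_nth (H n) k = 0" unfolding H_def by (simp only: fps_X_power_mult_nth if_True)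
  qed simp
  define M where "M = fsum UNIV mock_term"
  define P where "P = fps_X * fps_section 2 1 mock_omega"
  have P: "E1 * P = 2 * M"
    unfolding P_def M_def mock_term_def[abs_def] E1_def by (rule mock_omega_odd_section)
  have G': "1 = 4 * A\<^sup>2 * D\<^sup>2 * (inverse E2)\<^sup>2 * inverse B * M + A\<^sup>2 * inverse (B\<^sup>2) * fsum UNIV H"
    using G unfolding H_def[symmetric] M_def by (simp only: fsum_mult_left[OF l1] fsum_mult_left[OF l2])
  have iB: "inverse (B\<^sup>2) = (inverse B)\<^sup>2" by (simp only: power2_eq_square fps_inverse_mult)
  have r1: "A * B * E4 = E2" unfolding A_def B_def E4_def E2_def by (rule qpoch_product_odd)
  have r2: "E1 = A * E2" unfolding A_def E1_def E2_def by (rule Euler_1)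
  have ring: "b\<^sup>2 * a'\<^sup>2 = 2 * d\<^sup>2 * e4' * p + h"
    if "1 = 4 * a\<^sup>2 * d\<^sup>2 * e2'\<^sup>2 * b' * m + a\<^sup>2 * b'\<^sup>2 * h" "e1 * p = 2 * m" "a * a' = 1" "b * b' = 1"
      "e2 * e2' = 1" "e4 * e4' = 1" "a * b * e4 = e2" "e1 = a * e2" for a a' b b' d e1 e2 e2' e4 e4' m p h :: "rat fps"
  proof -
    have "b\<^sup>2 * a'\<^sup>2 = b\<^sup>2 * a'\<^sup>2 * (4 * a\<^sup>2 * d\<^sup>2 * e2'\<^sup>2 * b' * m + a\<^sup>2 * b'\<^sup>2 * h)" unfolding that(1)[symmetric] by simp
    also have "\<dots> = 2 * ((b * b') * (a * a')\<^sup>2 * b * d\<^sup>2 * e2'\<^sup>2) * (2 * m) + (a * a')\<^sup>2 * (b * b')\<^sup>2 * h" by algebra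
    also have "\<dots> = 2 * (b * d\<^sup>2 * e2'\<^sup>2) * (e1 * p) + h"
      by (simp only: that(2-4) power_one mult_1_left)
    also have "\<dots> = 2 * d\<^sup>2 * ((b * a) * e2 * e2'\<^sup>2) * p + h" unfolding that(8) by algebra
    also have "(b * a) * e2 * e2'\<^sup>2 = (a * b * e4) * e4' * (e2 * e2') * e2'" using that(6) by algebra
    also have "\<dots> = e4'" unfolding that(7) that(5) using that(5) by algebra
    finally show ?thesis .
  qed
  have main: "B\<^sup>2 * (inverse A)\<^sup>2 = 2 * D\<^sup>2 * inverse E4 * P + fsum UNIV H"
    by (rule ring[OF G'[unfolded iB] P inv r1 r2])
  define W :: "rat fps" where "W = 2 * (qpoch 1 1 1)\<^sup>2 * inverse (Euler 1)"
  have 0: "fps_nth (fps_X ^ 4 :: rat fps) 0 = 0" by simp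
  have W: "W oo fps_X ^ 4 = 2 * D\<^sup>2 * inverse E4"
  proof -
    have "inverse (Euler 1) oo fps_X ^ 4 = inverse E4"
      by (subst fps_compose_inverse_X_power) (simp_all add: qpoch_compose_neg E4_def)
    moreover have "qpoch 1 1 1 oo fps_X ^ 4 = D"
      by (subst qpoch_compose_pos) (simp_all add: D_def)
    moreover have "(2 :: rat fps) oo fps_X ^ 4 = 2"
      by (simp add: numeral_fps_const)
    ultimately show ?thesis
      unfolding W_def power2_eq_square by (simp only: fps_compose_mult_distrib[OF 0])
  qed
  have S1: "fps_section 4 2 ((W oo fps_X ^ 4) * P) = W * fps_section 4 2 P"
    by (rule fps_section_mult) simp
  have S2: "fps_section 4 2 P = fps_section 8 3 mock_omega"
  proof (rule fps_ext)
    fix n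
    have "4 * n + 2 = Suc (4 * n + 1)" "2 * (4 * n + 1) + 1 = 8 * n + 3" by auto
    then show "fps_nth (fps_section 4 2 P) n = fps_nth (fps_section 8 3 mock_omega) n"
      unfolding fps_section_nth P_def by (simp add: fps_X_mult_nth numeral_3_eq_3)
  qed
  have S3: "fps_section 4 2 (H k) = 0" for k
  proof -
    have "H k = (fps_X ^ (k\<^sup>2) * G k) oo fps_X ^ 4"
      unfolding H_def fps_compose_mult_distrib[OF 0] by (simp add: fps_X_power_compose_X_power)
    then show ?thesis by (simp add: fps_section_compose)
  qed
  have "fps_section 4 2 (B\<^sup>2 * (inverse A)\<^sup>2) = W * fps_section 8 3 mock_omega"
    unfolding main W[symmetric] fps_section_add S1 S2 fps_section_fsum S3 by simp
  then show ?thesis unfolding W_def A_def B_def .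
qed

text \<open>Two bisections, with \<open>f\<close> for \<open>theta_even\<close>. The quotient is
  \<open>f^2\<close> over a series in \<open>q^2\<close>, and the even part of \<open>f^2\<close> is
  \<open>f^2\<close> at \<open>q^2\<close>, so the first gives \<open>U f^2\<close>. This is
  \<open>f^4\<close> over a series in \<open>q^2\<close>, and the odd part of \<open>f^4\<close> is
  the mixed term \<open>2 f^2 t^2\<close> of the squared decomposition.\<close>

lemma section_quotient_theta:
  "fps_section 4 2 ((qpoch 1 2 1)\<^sup>2 * (inverse (qpoch (- 1) 2 1))\<^sup>2)
    = (inverse ((qpoch (- 1) 2 1)\<^sup>2 * (Euler 1)\<^sup>2))\<^sup>2 * (8 * (theta_even (\<lambda>_. 1))\<^sup>2 * (psi oo fps_X ^ 2)\<^sup>2)"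
proof -
  define A B E1 E2 :: "rat fps" where "A = qpoch (- 1) 2 1" and "B = qpoch 1 2 1"
    and "E1 = Euler 1" and "E2 = Euler 2"
  define A2 :: "rat fps" where "A2 = qpoch (- 1) 4 2"
  define f :: "rat fps" where "f = theta_even (\<lambda>_. 1)"
  define t :: "rat fps" where "t = theta_odd (\<lambda>_. 1)"
  have f: "f = B\<^sup>2 * E2" unfolding f_def B_def E2_def by (rule phi_product)
  have sq: "f * f = ((f * f) oo fps_X ^ 2) + fps_X * ((t * t) oo fps_X ^ 2)"
    unfolding f_def t_def by (rule theta_even_square)
  have AB: "A * B = A2" unfolding A_def B_def A2_def using qpoch_plus_minus[of 2 1] by (simp add: mult.commute)
  have E1: "E1 = A * E2" unfolding A_def E1_def E2_def by (rule Euler_1)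
  have Ac: "A oo fps_X ^ 2 = A2" "E1 oo fps_X ^ 2 = E2"
    unfolding A_def A2_def E1_def E2_def by (simp_all add: qpoch_compose_neg)
  have n0: "fps_nth A 0 = 1" "fps_nth A2 0 = 1" "fps_nth B 0 = 1" "fps_nth E1 0 = 1" "fps_nth E2 0 = 1"
    by (simp_all add: A_def A2_def B_def E1_def E2_def)
  have 0: "fps_nth (fps_X ^ 2 :: rat fps) 0 = 0" by simp
  have cancel: "x = y * inverse z" if "z * x = y" "fps_nth z 0 = 1" for x y z :: "rat fps"
  proof -
    have "y * inverse z = (z * inverse z) * x" unfolding that(1)[symmetric] by (simp only: mult_ac)
    then show ?thesis unfolding fps_inverse_unit[OF that(2)] by simp
  qed
  define U V where "U = inverse ((E1 * A)\<^sup>2)" and "V = inverse ((A\<^sup>2 * E1\<^sup>2)\<^sup>2)"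
  have Uc: "U oo fps_X ^ 2 = inverse ((E2 * A2)\<^sup>2)"
  proof -
    have "(E1 * A)\<^sup>2 oo fps_X ^ 2 = (E2 * A2)\<^sup>2"
      unfolding power2_eq_square[of "E1 * A"] power2_eq_square[of "E2 * A2"] fps_compose_mult_distrib[OF 0] Ac ..
    then show ?thesis unfolding U_def by (subst fps_compose_inverse_X_power) (simp_all add: n0 fps_power_zeroth)
  qed
  have Vc: "V oo fps_X ^ 2 = inverse ((A2\<^sup>2 * E2\<^sup>2)\<^sup>2)"
  proof -
    have "(A\<^sup>2 * E1\<^sup>2)\<^sup>2 oo fps_X ^ 2 = (A2\<^sup>2 * E2\<^sup>2)\<^sup>2"
      unfolding power2_eq_square[of A] power2_eq_square[of E1] power2_eq_square[of A2] power2_eq_square[of E2]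
        power2_eq_square[of "_ * _"] fps_compose_mult_distrib[OF 0] Ac ..
    then show ?thesis unfolding V_def by (subst fps_compose_inverse_X_power) (simp_all add: n0 fps_power_zeroth)
  qed
  have "(E2 * A2)\<^sup>2 * (B\<^sup>2 * (inverse A)\<^sup>2) = f * f"
  proof -
    have "A * inverse A = 1" by (rule fps_inverse_unit) (rule n0)
    moreover have "a * i = 1 \<Longrightarrow> (e * (a * b))\<^sup>2 * (b\<^sup>2 * i\<^sup>2) = (b\<^sup>2 * e) * (b\<^sup>2 * e)" for a b e i :: "rat fps"
      by algebra
    ultimately show ?thesis unfolding f AB[symmetric] by blast
  qed
  then have 1: "B\<^sup>2 * (inverse A)\<^sup>2 = (U oo fps_X ^ 2) * (f * f)"
    unfolding Uc by (subst mult.commute[of "inverse _"], intro cancel) (simp_all add: n0 power2_eq_square)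
  have Z: "fps_section 2 0 (B\<^sup>2 * (inverse A)\<^sup>2) = U * (f * f)"
  proof -
    have "fps_section 2 0 (f * f) = f * f"
      by (subst sq) (rule fps_section_2_decomposition)
    then show ?thesis unfolding 1 by (subst fps_section_mult) simp_all
  qed
  have "(A2\<^sup>2 * E2\<^sup>2)\<^sup>2 * (U * (f * f)) = f * f * (f * f)"
  proof -
    have u: "(E1 * A)\<^sup>2 * U = 1" unfolding U_def by (rule fps_inverse_unit) (simp add: n0 power2_eq_square)
    have "((a * e) * a)\<^sup>2 * u = 1 \<Longrightarrow> ((a * b)\<^sup>2 * e\<^sup>2)\<^sup>2 * (u * ((b\<^sup>2 * e) * (b\<^sup>2 * e))) = (b\<^sup>2 * e) * (b\<^sup>2 * e) * ((b\<^sup>2 * e) * (b\<^sup>2 * e))"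
      for a b e u :: "rat fps" by algebra
    from this[OF u[unfolded E1]] show ?thesis unfolding f AB[symmetric] .
  qed
  then have 2: "U * (f * f) = (V oo fps_X ^ 2) * (f * f * (f * f))"
    unfolding Vc by (subst mult.commute[of "inverse _"], intro cancel) (simp_all add: n0 power2_eq_square)
  have 3: "fps_section 2 1 (f * f * (f * f)) = 2 * (f * f * (t * t))"
  proof -
    have X2: "fps_X * fps_X = (fps_X oo fps_X ^ 2 :: rat fps)" by (simp add: power2_eq_square)
    have two: "(2 :: rat fps) oo fps_X ^ 2 = 2" by (simp add: numeral_fps_const)
    have "f * f * (f * f) = (((f * f) oo fps_X ^ 2) + fps_X * ((t * t) oo fps_X ^ 2)) * (((f * f) oo fps_X ^ 2) + fps_X * ((t * t) oo fps_X ^ 2))"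
      by (simp only: sq[symmetric])
    also have "\<dots> = ((f * f) oo fps_X ^ 2) * ((f * f) oo fps_X ^ 2) + (fps_X * fps_X) * (((t * t) oo fps_X ^ 2) * ((t * t) oo fps_X ^ 2))
      + fps_X * (2 * (((f * f) oo fps_X ^ 2) * ((t * t) oo fps_X ^ 2)))"
      by algebra
    also have "\<dots> = ((f * f * (f * f) + fps_X * (t * t * (t * t))) oo fps_X ^ 2) + fps_X * ((2 * (f * f * (t * t))) oo fps_X ^ 2)"
      by (simp only: X2 fps_compose_add_distrib fps_compose_mult_distrib[OF 0] two)
    finally show ?thesis
      by (rule trans[OF arg_cong[where f = "fps_section 2 1"] fps_section_2_decomposition(2)])
  qed
  have s: "fps_section 4 2 F = fps_section 2 1 (fps_section 2 0 F)" for F :: "rat fps"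
    by (rule fps_ext) (simp add: algebra_simps)
  have "fps_section 4 2 (B\<^sup>2 * (inverse A)\<^sup>2) = V * (2 * (f * f * (t * t)))"
    unfolding s Z 2 by (subst fps_section_mult) (simp, simp only: 3)
  also have "t = 2 * (psi oo fps_X ^ 2)" unfolding t_def by (rule theta_odd_psi)
  also have "V * (2 * (f * f * ((2 * (psi oo fps_X ^ 2)) * (2 * (psi oo fps_X ^ 2))))) = V * (8 * f\<^sup>2 * (psi oo fps_X ^ 2)\<^sup>2)"
    by algebra
  also have "V = (inverse (A\<^sup>2 * E1\<^sup>2))\<^sup>2"
    unfolding V_def power2_eq_square by (simp only: fps_inverse_mult)
  finally show ?thesis unfolding A_def B_def E1_def f_def .
qed

text \<open>Both evaluations of the same section are equated; \<open>R = 1 / A\<close> and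
  \<open>F T = B^2 E4^2\<close> then reduce all products to \<open>Euler 1\<close> and
  \<open>Euler 2\<close>.\<close>

theorem mock_omega_section_8_3: "fps_section 8 3 mock_omega * Euler 1 ^ 9 = 4 * Euler 2 ^ 10"
proof -
  define A B E1 E2 E4 R F T O' :: "rat fps" where "A = qpoch (- 1) 2 1" and "B = qpoch 1 2 1"
    and "E1 = Euler 1" and "E2 = Euler 2" and "E4 = Euler 4" and "R = qpoch 1 1 1"
    and "F = theta_even (\<lambda>_. 1)" and "T = psi oo fps_X ^ 2" and "O' = fps_section 8 3 mock_omega"
  have eq: "2 * R\<^sup>2 * inverse E1 * O' = (inverse (A\<^sup>2 * E1\<^sup>2))\<^sup>2 * (8 * F\<^sup>2 * T\<^sup>2)"
    using section_quotient_omega section_quotient_theta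
    unfolding A_def E1_def R_def F_def T_def O'_def by simp
  have n0: "fps_nth A 0 = 1" "fps_nth E1 0 = 1" by (simp_all add: A_def E1_def)
  have i1: "E1 * inverse E1 = 1" "(A\<^sup>2 * E1\<^sup>2) * inverse (A\<^sup>2 * E1\<^sup>2) = 1"
    by (rule fps_inverse_unit, simp add: n0 power2_eq_square)+
  have RA: "R * A = 1" unfolding R_def A_def by (rule qpoch_1_1_1_inverse)
  have AB: "A * B * E4 = E2" unfolding A_def B_def E4_def E2_def by (rule qpoch_product_odd)
  have E1: "E1 = A * E2" unfolding A_def E1_def E2_def by (rule Euler_1)
  have FT: "F * T = B\<^sup>2 * E4\<^sup>2"
  proof -
    have T: "T = qpoch 1 4 2 * Euler 8"
    proof -
      have "T = (qpoch 1 2 1 oo fps_X ^ 2) * (Euler 4 oo fps_X ^ 2)"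
        unfolding T_def psi_product by (rule fps_compose_mult_distrib) simp
      then show ?thesis by (simp add: qpoch_compose_neg qpoch_compose_pos)
    qed
    have E4: "E4 = qpoch (- 1) 8 4 * Euler 8"
      unfolding E4_def using qpoch_split2[of 4 4 "- 1"] by simp
    have "qpoch 1 4 2 * qpoch (- 1) 4 2 = qpoch (- 1) 8 4" using qpoch_plus_minus[of 4 2] by simp
    then have "E2 * T = E4 * E4"
      unfolding T E2_def Euler_2 by (subst (2) E4) (simp add: E4_def mult_ac)
    moreover have "F = B\<^sup>2 * E2" unfolding F_def B_def E2_def by (rule phi_product)
    ultimately show ?thesis by (simp add: power2_eq_square mult.assoc)
  qed
  have "O' * E1 ^ 9 = 4 * E2 ^ 10"
  proof -
    define i j where "i = inverse E1" and "j = inverse (A\<^sup>2 * E1\<^sup>2)"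
    have ring: "2 * (x * (e * i) * e ^ 9) = 2 * (4 * f ^ 10 * (e * i))"
      if "2 * r\<^sup>2 * i * x = j\<^sup>2 * (8 * p\<^sup>2 * t\<^sup>2)" "r * a = 1" "e * i = 1" "a\<^sup>2 * e\<^sup>2 * j = 1"
        "p * t = b\<^sup>2 * d\<^sup>2" "a * b * d = f" "e = a * f" for a b d e f i j p r t x :: "rat fps"
    proof -
      have "2 * (x * (e * i) * e ^ 9) = i * (2 * x * (e ^ 4 * e ^ 6))" by algebra
      also have "e ^ 6 = (a * f) ^ 6" using that(7) by simp
      also have "2 * x * (e ^ 4 * (a * f) ^ 6) = 2 * (r * a)\<^sup>2 * (e * i) * x * (e ^ 4 * (a * f) ^ 6)"
        unfolding that(2,3) by simp
      also have "\<dots> = (2 * r\<^sup>2 * i * x) * (a ^ 8 * e ^ 5 * f ^ 6)" by algebra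
      also have "\<dots> = 8 * (a\<^sup>2 * e\<^sup>2 * j)\<^sup>2 * (p * t)\<^sup>2 * a ^ 4 * e * f ^ 6" unfolding that(1) by algebra
      also have "\<dots> = 8 * (a * b * d) ^ 4 * e * f ^ 6" unfolding that(4,5) power_one mult_1_right by algebra
      also have "i * (8 * (a * b * d) ^ 4 * e * f ^ 6) = 2 * (4 * f ^ 10 * (e * i))" unfolding that(6) by algebra
      finally show ?thesis .
    qed
    show ?thesis
      using fps_cancel_numeral[OF ring[OF eq RA i1 FT AB E1]] unfolding i1(1) by simp
  qed
  then show ?thesis unfolding O'_def E1_def E2_def .
qed

lemma int_coeffs_Euler_1: "int_coeffs (Euler 1)"
proof -
  have "int_coeffs ((- 1) ^ nat \<bar>j\<bar> * fps_X ^ jexp 3 1 j)" for j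
    by (intro int_coeffs_mult int_coeffs_power) (auto simp: int_coeffs_def)
  then show ?thesis unfolding Euler_1_pentagonal int_coeffs_def fsum_def fps_nth_Abs_fps
    by (intro allI Ints_sum) simp
qed

text \<open>With \<open>F = (E2 / E1)^2\<close> the series \<open>4 E2^10 / E1^9\<close> is
  \<open>4 F^5 E1\<close>. In the convolution at \<open>5 m + r\<close>, an index of
  \<open>F^5\<close> prime to 5 gives a factor 5, and an index divisible by 5 leaves a coefficient
  of \<open>E1\<close> in the class \<open>r\<close>, which vanishes.\<close>

lemma a_omega_5:
  assumes "r = 3 \<or> r = 4" shows "5 dvd a_omega (40 * m + 8 * r + 3)"
proof -
  define n where "n = 5 * m + r"
  define E :: "rat fps" where "E = Euler 1"
  have E2: "Euler 2 = E oo fps_X ^ 2" unfolding E_def by (simp add: qpoch_compose_neg)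
  have E: "int_coeffs E" unfolding E_def by (rule int_coeffs_Euler_1)
  have "int_coeffs (Euler 2)"
    using E unfolding E2 int_coeffs_def by (simp add: fps_nth_compose_X_power)
  define F where "F = (Euler 2)\<^sup>2 * (inverse E)\<^sup>2"
  have F: "int_coeffs F"
    unfolding F_def using \<open>int_coeffs (Euler 2)\<close> E
    by (intro int_coeffs_mult int_coeffs_power int_coeffs_inverse) (simp_all add: E_def)
  have i: "E * inverse E = 1" unfolding E_def by (rule fps_inverse_unit) simp
  have ring: "x = 4 * ((f\<^sup>2 * i\<^sup>2) ^ 5 * e)" if "x * e ^ 9 = 4 * f ^ 10" "e * i = 1" for x e f i :: "rat fps"
  proof -
    have "4 * ((f\<^sup>2 * i\<^sup>2) ^ 5 * e) = (4 * f ^ 10) * i ^ 10 * e" by algebra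
    also have "\<dots> = x * (e * i) ^ 10" unfolding that(1)[symmetric] by algebra
    finally show ?thesis unfolding that(2) by simp
  qed
  have S: "fps_section 8 3 mock_omega = 4 * (F ^ 5 * E)"
    unfolding F_def by (rule ring[OF mock_omega_section_8_3[folded E_def] i])
  have "\<exists>z. fps_nth (F ^ 5) i * fps_nth E (n - i) = of_int (5 * z)" if "i \<le> n" for i
  proof (cases "5 dvd i")
    case True
    then obtain k where k: "i = 5 * k" by blast
    then have "k \<le> m" using that assms by (auto simp: n_def)
    then have "n - i = 5 * (m - k) + r" by (simp add: n_def k diff_mult_distrib2)
    then have "(n - i) mod 5 = r" using assms by auto
    then have "fps_nth E (n - i) = 0" unfolding E_def by (intro Euler_1_nth_eq_0) (use assms in auto)
    then show ?thesis by (intro exI[of _ 0]) simp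
  next
    case False
    then obtain z where z: "fps_nth (F ^ 5) i = of_int (5 * z)"
      using prime_power_coeff[OF F, of 5 i] by auto
    obtain w where "fps_nth E (n - i) = of_int w"
      using E unfolding int_coeffs_def by (auto elim: Ints_cases)
    then show ?thesis by (intro exI[of _ "z * w"]) (simp add: z)
  qed
  then obtain z where z: "\<And>i. i \<le> n \<Longrightarrow> fps_nth (F ^ 5) i * fps_nth E (n - i) = of_int (5 * z i)" by metis
  have "fps_nth (F ^ 5 * E) n = of_int (5 * (\<Sum>i=0..n. z i))"
    unfolding fps_mult_nth sum_distrib_left of_int_sum by (rule sum.cong) (use z in auto)
  then have "of_int (a_omega (8 * n + 3)) = (of_int (5 * (4 * (\<Sum>i=0..n. z i))) :: rat)"
    using arg_cong[OF S, of "\<lambda>F. fps_nth F n"] arg_cong[OF mock_omega_eq, of "\<lambda>F. fps_nth F (8 * n + 3)"]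
    by (simp add: fps_nth_numeral_mult)
  then have "a_omega (8 * n + 3) = 5 * (4 * (\<Sum>i=0..n. z i))" by (simp only: of_int_eq_iff)
  moreover have "8 * n + 3 = 40 * m + 8 * r + 3" by (simp add: n_def)
  ultimately show ?thesis by simp
qed

theorem theorem1p1:
  fixes n :: nat
  shows "([a_omega (40 * n + 27) = a_omega (40 * n + 35)] (mod 5) \<and>
          [a_omega (40 * n + 35) = 0] (mod 5)) \<and>
         [a_cesaro (3 * n + 1) = 0] (mod 3) \<and>
         ([a_cesaro (7 * n + 2) = a_cesaro (7 * n + 3)] (mod 7) \<and>
          [a_cesaro (7 * n + 3) = a_cesaro (7 * n + 5)] (mod 7) \<and>
          [a_cesaro (7 * n + 5) = 0] (mod 7))"
proof -
  have "[a_omega (40 * n + 27) = 0] (mod 5)" "[a_omega (40 * n + 35) = 0] (mod 5)"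
    using a_omega_5[of 3 n] a_omega_5[of 4 n] by (simp_all add: cong_0_iff add.commute)
  moreover have "[a_cesaro (3 * n + 1) = 0] (mod 3)"
    using a_cesaro_3[of n] by (simp add: cong_0_iff)
  moreover have "[a_cesaro (7 * n + 2) = 0] (mod 7)" "[a_cesaro (7 * n + 3) = 0] (mod 7)"
    "[a_cesaro (7 * n + 5) = 0] (mod 7)"
    using a_cesaro_7[of 2 n] a_cesaro_7[of 3 n] a_cesaro_7[of 5 n] by (simp_all add: cong_0_iff)
  ultimately show ?thesis
    by (simp add: cong_def)
qed

end
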